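(* Let $\Gamma$ be a countable discrete sofic group with sofic approximation $\Sigma$. Let $A$ be a finitely presented $\mathbb{Z}(\Gamma)$-module. Then $h_{\Sigma}(\widehat{A},\Gamma)<\infty$ if and only if $\mathrm{mdim}_{\Sigma,M}(\widehat{A},\Gamma)=0$.
   Context: $\widehat{A}$ is the Pontryagin dual of $A$ (homomorphisms to $\mathbb{R}/\mathbb{Z}$) with action $(g\chi)(a)=\chi(g^{-1}a)$. **Sofic approximations.** A sofic approximation of a countable discrete group $\Gamma$ is a sequence $\Sigma=(\sigma_i:\Gamma\to S_{d_i})_i$ of functions into symmetric groups (not assumed to be homomorphisms) such that $d_i\to\infty$; $\frac1{d_i}|\{j:(\sigma_i(g)\sigma_i(h))(j)=\sigma_i(gh)(j)\}|\to 1$ for all $g,h\in\Gamma$; and $\frac1{d_i}|\{j:\sigma_i(g)(j)\ne\sigma_i(h)(j)\}|\to 1$ for all $g\neq h$ in $\Gamma$. $\Gamma$ is sofic if it has a sofic approximation. **Topological entropy.** Let $\Gamma$ act by homeomorphisms on a compact metrizable space $X$. A continuous pseudometric $\rho$ on $X$ is dynamically generating if for all $x\neq y$ there is $g\in\Gamma$ with $\rho(gx,gy)>0$. For $\phi,\psi:\{1,\dots,d\}\to X$ put $\rho_2(\phi,\psi)=\left(\frac1d\sum_j\rho(\phi(j),\psi(j))^2\right)^{1/2}$ and $\rho_\infty(\phi,\psi)=\max_j\rho(\phi(j),\psi(j))$. For a pseudometric space $(Y,\theta)$, $S_\varepsilon(Y,\theta)$ is the smallest cardinality of $A\subseteq Y$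 such that every point of $Y$ is within distance $\le\varepsilon$ of a point of $A$, and $N_\varepsilon(Y,\theta)$ is the largest cardinality of a subset with pairwise distances $>\varepsilon$ ($\log 0=-\infty$). For $\sigma:\Gamma\to S_d$, $F\subseteq\Gamma$ finite, $\delta>0$, $\mathrm{Map}(\rho,F,\delta,\sigma)$ is the set of $\phi:\{1,\dots,d\}\to X$ with $\rho_2(\phi\circ\sigma(g),g\phi)<\delta$ for all $g\in F$. Then \[h_\Sigma(X,\Gamma)=\sup_{\varepsilon>0}\inf_{F,\delta}\limsup_{i\to\infty}\frac1{d_i}\log S_\varepsilon(\mathrm{Map}(\rho,F,\delta,\sigma_i),\rho_2),\] independent of the dynamically generating pseudometric $\rho$. **Metric mean dimension.** For a compatible metric $\rho$ on $X$, \[\mathrm{mdim}_{\Sigma,M}(X,\rho)=\liminf_{\varepsilon\to0}\frac{1}{|\log\varepsilon|}\inf_{F,\delta}\limsup_{i\to\infty}\frac1{d_i}\log N_\varepsilon(\mathrm{Map}(\rho,F,\delta,\sigma_i),\rho_\infty),\] and $\mathrm{mdim}_{\Sigma,M}(X,\Gamma)$ is the infimum of $\mathrm{mdim}_{\Sigma,M}(X,\rho)$ over all compatible metrics $\rho$ on $X$. *)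

theory Defs
  imports "HOL-Analysis.Analysis" "HOL-Library.Poly_Mapping"
begin

text \<open>
  Groups are types of class \<open>group_add\<close>, which is not commutative in general: the group law of
  \<open>\<Gamma>\<close> is written \<open>g + h\<close>, its identity \<open>0\<close> and inverses \<open>- g\<close>.  The point of this choice is
  that \<open>'g \<Rightarrow>\<^sub>0 int\<close>, the finitely supported functions with their library (convolution) ring
  structure, is then the integral group ring \<open>\<int>(\<Gamma>)\<close>, in which \<open>Poly_Mapping.single g 1\<close> is the
  group element \<open>g\<close>.
\<close>

type_synonym 'g group_ring = "'g \<Rightarrow>\<^sub>0 int"

section \<open>Finitely presented left modules\<close>

text \<open>The library locale \<open>module\<close> is restricted to commutative rings of scalars.\<close>

locale left_module =
  fixes smul :: "'r::ring_1 \<Rightarrow> 'm::ab_group_add \<Rightarrow> 'm"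
  assumes smul_add_right: "smul r (x + y) = smul r x + smul r y"
    and smul_add_left: "smul (r + s) x = smul r x + smul s x"
    and smul_smul: "smul r (smul s x) = smul (r * s) x"
    and smul_one: "smul 1 x = x"

text \<open>\<open>R\<^sup>n\<close>, as sequences vanishing from index \<open>n\<close> on.\<close>

definition free_module :: "nat \<Rightarrow> (nat \<Rightarrow> 'r::ring_1) set" where
  "free_module n = {v. \<forall>i\<ge>n. v i = 0}"

text \<open>The homomorphism \<open>R\<^sup>n \<rightarrow> M\<close> sending the \<open>i\<close>-th basis vector to \<open>x i\<close>.\<close>

definition free_hom ::
    "('r::ring_1 \<Rightarrow> 'm::ab_group_add \<Rightarrow> 'm) \<Rightarrow> nat \<Rightarrow> (nat \<Rightarrow> 'm) \<Rightarrow> (nat \<Rightarrow> 'r) \<Rightarrow> 'm" where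
  "free_hom smul n x v = (\<Sum>i<n. smul (v i) (x i))"

text \<open>The left submodule of \<open>R\<^sup>n\<close> generated by a finite set \<open>S\<close>.\<close>

definition generated_submodule :: "(nat \<Rightarrow> 'r::ring_1) set \<Rightarrow> (nat \<Rightarrow> 'r) set" where
  "generated_submodule S = {\<lambda>i. \<Sum>w\<in>S. c w * w i | c. True}"

definition finitely_presented :: "('r::ring_1 \<Rightarrow> 'm::ab_group_add \<Rightarrow> 'm) \<Rightarrow> bool" where
  "finitely_presented smul \<longleftrightarrow>
    (\<exists>n x. free_hom smul n x ` free_module n = UNIV \<and>
      (\<exists>S. finite S \<and>
        {v \<in> free_module n. free_hom smul n x v = 0} = generated_submodule S))"

section \<open>The circle group and the Pontryagin dual\<close>

quotient_type circle = real / "\<lambda>x y. x - y \<in> \<int>"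
proof (rule equivpI)
  show "reflp (\<lambda>x y::real. x - y \<in> \<int>)"
    by (simp add: reflp_def)
  show "symp (\<lambda>x y::real. x - y \<in> \<int>)"
    by (auto simp: symp_def) (metis Ints_minus minus_diff_eq)
  show "transp (\<lambda>x y::real. x - y \<in> \<int>)"
    by (auto simp: transp_def) (metis Ints_add diff_add_cancel add_diff_eq)
qed

instantiation circle :: ab_group_add
begin

lift_definition zero_circle :: circle is 0 .

lift_definition plus_circle :: "circle \<Rightarrow> circle \<Rightarrow> circle" is "(+)"
  by (metis Ints_add add_diff_add)

lift_definition uminus_circle :: "circle \<Rightarrow> circle" is uminus
  by (metis Ints_minus minus_diff_minus)

lift_definition minus_circle :: "circle \<Rightarrow> circle \<Rightarrow> circle" is "(-)"
proof -
  fix a b c e :: real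
  assume "a - b \<in> \<int>" "c - e \<in> \<int>"
  then have "(a - b) - (c - e) \<in> \<int>" by (rule Ints_diff)
  then show "(a - c) - (b - e) \<in> \<int>" by (simp add: algebra_simps)
qed

instance
  by intro_classes (transfer; simp add: algebra_simps)+

end

text \<open>The quotient topology of \<open>\<real>/\<int>\<close>.\<close>

instantiation circle :: topological_space
begin

definition open_circle :: "circle set \<Rightarrow> bool" where
  "open_circle U \<longleftrightarrow> open (abs_circle -` U)"

instance
  by intro_classes (auto simp: open_circle_def vimage_Union open_Int)

end

text \<open>
  The dual of a discrete abelian group.  As the group is discrete, the compact-open topology
  on the characters is the topology of pointwise convergence, which is the library topology on
  functions.
\<close>

definition pontryagin_dual :: "('a::ab_group_add \<Rightarrow> circle) topology" where
  "pontryagin_dual = top_of_set {\<xi>. Modules.additive \<xi>}"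

definition dual_action ::
    "('g::group_add group_ring \<Rightarrow> 'a::ab_group_add \<Rightarrow> 'a) \<Rightarrow> 'g \<Rightarrow> ('a \<Rightarrow> circle) \<Rightarrow> ('a \<Rightarrow> circle)" where
  "dual_action smul g \<xi> = (\<lambda>a. \<xi> (smul (Poly_Mapping.single (- g) 1) a))"

section \<open>Sofic approximations\<close>

definition sofic_approximation :: "(nat \<Rightarrow> nat) \<Rightarrow> (nat \<Rightarrow> 'g::group_add \<Rightarrow> nat \<Rightarrow> nat) \<Rightarrow> bool" where
  "sofic_approximation d \<sigma> \<longleftrightarrow>
    (\<forall>i g. \<sigma> i g permutes {1..d i}) \<and>
    filterlim d at_top sequentially \<and>
    (\<forall>g h. (\<lambda>i. real (card {j \<in> {1..d i}. (\<sigma> i g \<circ> \<sigma> i h) j = \<sigma> i (g + h) j}) / real (d i))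
      \<longlonglongrightarrow> 1) \<and>
    (\<forall>g h. g \<noteq> h \<longrightarrow>
      (\<lambda>i. real (card {j \<in> {1..d i}. \<sigma> i g j \<noteq> \<sigma> i h j}) / real (d i)) \<longlonglongrightarrow> 1)"

section \<open>Covering and separation numbers\<close>

text \<open>Both numbers take the value \<open>\<infinity>\<close> if there is no finite one.\<close>

definition covering_number :: "real \<Rightarrow> 'y set \<Rightarrow> ('y \<Rightarrow> 'y \<Rightarrow> real) \<Rightarrow> enat" where
  "covering_number \<epsilon> Y \<theta> =
    (INF A\<in>{A. finite A \<and> A \<subseteq> Y \<and> (\<forall>y\<in>Y. \<exists>a\<in>A. \<theta> y a \<le> \<epsilon>)}. enat (card A))"

definition separation_number :: "real \<Rightarrow> 'y set \<Rightarrow> ('y \<Rightarrow> 'y \<Rightarrow> real) \<Rightarrow> enat" where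
  "separation_number \<epsilon> Y \<theta> =
    (SUP A\<in>{A. finite A \<and> A \<subseteq> Y \<and> (\<forall>a\<in>A. \<forall>b\<in>A. a \<noteq> b \<longrightarrow> \<theta> a b > \<epsilon>)}. enat (card A))"

definition enat_log :: "enat \<Rightarrow> ereal" where
  "enat_log n = (case n of enat k \<Rightarrow> if k = 0 then -\<infinity> else ereal (ln (real k)) | \<infinity> \<Rightarrow> \<infinity>)"

section \<open>Sofic topological entropy and metric mean dimension\<close>

definition continuous_pseudometric :: "'x topology \<Rightarrow> ('x \<Rightarrow> 'x \<Rightarrow> real) \<Rightarrow> bool" where
  "continuous_pseudometric X \<rho> \<longleftrightarrow>
    (\<forall>x\<in>topspace X. \<forall>y\<in>topspace X. 0 \<le> \<rho> x y \<and> \<rho> x y = \<rho> y x) \<and>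
    (\<forall>x\<in>topspace X. \<rho> x x = 0) \<and>
    (\<forall>x\<in>topspace X. \<forall>y\<in>topspace X. \<forall>z\<in>topspace X. \<rho> x z \<le> \<rho> x y + \<rho> y z) \<and>
    continuous_map (prod_topology X X) euclideanreal (\<lambda>(x, y). \<rho> x y)"

definition dynamically_generating ::
    "'x topology \<Rightarrow> ('g \<Rightarrow> 'x \<Rightarrow> 'x) \<Rightarrow> ('x \<Rightarrow> 'x \<Rightarrow> real) \<Rightarrow> bool" where
  "dynamically_generating X act \<rho> \<longleftrightarrow>
    (\<forall>x\<in>topspace X. \<forall>y\<in>topspace X. x \<noteq> y \<longrightarrow> (\<exists>g. \<rho> (act g x) (act g y) > 0))"

definition compatible_metric :: "'x topology \<Rightarrow> ('x \<Rightarrow> 'x \<Rightarrow> real) \<Rightarrow> bool" where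
  "compatible_metric X \<rho> \<longleftrightarrow>
    Metric_space (topspace X) \<rho> \<and> Metric_space.mtopology (topspace X) \<rho> = X"

definition rho_2 :: "('x \<Rightarrow> 'x \<Rightarrow> real) \<Rightarrow> nat \<Rightarrow> (nat \<Rightarrow> 'x) \<Rightarrow> (nat \<Rightarrow> 'x) \<Rightarrow> real" where
  "rho_2 \<rho> d \<phi> \<psi> = sqrt ((1 / real d) * (\<Sum>j\<in>{1..d}. (\<rho> (\<phi> j) (\<psi> j))\<^sup>2))"

definition rho_inf :: "('x \<Rightarrow> 'x \<Rightarrow> real) \<Rightarrow> nat \<Rightarrow> (nat \<Rightarrow> 'x) \<Rightarrow> (nat \<Rightarrow> 'x) \<Rightarrow> real" where
  "rho_inf \<rho> d \<phi> \<psi> = (MAX j\<in>{1..d}. \<rho> (\<phi> j) (\<psi> j))"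

text \<open>Maps \<open>{1..d} \<rightarrow> X\<close> are extensional functions, so that each of them is counted once.\<close>

definition Map_sofic ::
    "'x topology \<Rightarrow> ('g \<Rightarrow> 'x \<Rightarrow> 'x) \<Rightarrow> ('x \<Rightarrow> 'x \<Rightarrow> real) \<Rightarrow> 'g set \<Rightarrow> real \<Rightarrow>
     nat \<Rightarrow> ('g \<Rightarrow> nat \<Rightarrow> nat) \<Rightarrow> (nat \<Rightarrow> 'x) set" where
  "Map_sofic X act \<rho> F \<delta> d \<sigma> =
    {\<phi> \<in> {1..d} \<rightarrow>\<^sub>E topspace X. \<forall>g\<in>F. rho_2 \<rho> d (\<phi> \<circ> \<sigma> g) (act g \<circ> \<phi>) < \<delta>}"

definition sofic_entropy_wrt ::
    "(nat \<Rightarrow> nat) \<Rightarrow> (nat \<Rightarrow> 'g \<Rightarrow> nat \<Rightarrow> nat) \<Rightarrow> 'x topology \<Rightarrow> ('g \<Rightarrow> 'x \<Rightarrow> 'x) \<Rightarrow>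
     ('x \<Rightarrow> 'x \<Rightarrow> real) \<Rightarrow> ereal" where
  "sofic_entropy_wrt d \<sigma> X act \<rho> =
    (SUP \<epsilon>\<in>{0<..}. INF (F, \<delta>)\<in>{F. finite F} \<times> {0<..}.
      limsup (\<lambda>i. ereal (1 / real (d i)) *
        enat_log (covering_number \<epsilon> (Map_sofic X act \<rho> F \<delta> (d i) (\<sigma> i)) (rho_2 \<rho> (d i)))))"

text \<open>
  For a group acting by homeomorphisms on a compact metrizable space the value does not depend
  on the dynamically generating continuous pseudometric, hence not on the choice made here.
\<close>

definition sofic_entropy ::
    "(nat \<Rightarrow> nat) \<Rightarrow> (nat \<Rightarrow> 'g \<Rightarrow> nat \<Rightarrow> nat) \<Rightarrow> 'x topology \<Rightarrow> ('g \<Rightarrow> 'x \<Rightarrow> 'x) \<Rightarrow> ereal" where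
  "sofic_entropy d \<sigma> X act =
    sofic_entropy_wrt d \<sigma> X act
      (SOME \<rho>. continuous_pseudometric X \<rho> \<and> dynamically_generating X act \<rho>)"

definition metric_mean_dimension_wrt ::
    "(nat \<Rightarrow> nat) \<Rightarrow> (nat \<Rightarrow> 'g \<Rightarrow> nat \<Rightarrow> nat) \<Rightarrow> 'x topology \<Rightarrow> ('g \<Rightarrow> 'x \<Rightarrow> 'x) \<Rightarrow>
     ('x \<Rightarrow> 'x \<Rightarrow> real) \<Rightarrow> ereal" where
  "metric_mean_dimension_wrt d \<sigma> X act \<rho> =
    Liminf (at_right 0) (\<lambda>\<epsilon>. ereal (1 / \<bar>ln \<epsilon>\<bar>) *
      (INF (F, \<delta>)\<in>{F. finite F} \<times> {0<..}.
        limsup (\<lambda>i. ereal (1 / real (d i)) *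
          enat_log (separation_number \<epsilon> (Map_sofic X act \<rho> F \<delta> (d i) (\<sigma> i)) (rho_inf \<rho> (d i))))))"

definition metric_mean_dimension ::
    "(nat \<Rightarrow> nat) \<Rightarrow> (nat \<Rightarrow> 'g \<Rightarrow> nat \<Rightarrow> nat) \<Rightarrow> 'x topology \<Rightarrow> ('g \<Rightarrow> 'x \<Rightarrow> 'x) \<Rightarrow> ereal" where
  "metric_mean_dimension d \<sigma> X act =
    (INF \<rho>\<in>{\<rho>. compatible_metric X \<rho>}. metric_mean_dimension_wrt d \<sigma> X act \<rho>)"

end

theory Submission
  imports Defs
begin

text \<open>
  Write the module as the quotient of \<open>\<int>(\<Gamma>)\<^sup>n\<close> by the submodule generated by a finite set \<open>S\<close>.  A
  character is then a point of \<open>(\<real>/\<int>)\<close> to the power \<open>\<Gamma> \<times> n\<close> that satisfies all translates of the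
  equations in \<open>S\<close>, and a map \<open>\<sigma> k\<close> of the sofic approximation turns these equations into a finite
  system of linear equations with integer coefficients, whose unknowns are indexed by
  \<open>{..<n} \<times> {1..d k}\<close>.  Choose a minimal set \<open>info\<close> of unknowns that determines a real solution; its
  size is the dimension of the solution space.  Both sides of the theorem are equivalent to
  \<open>card info / d k \<longlonglongrightarrow> 0\<close>, and this is proved as a cycle of three implications.

  If the metric mean dimension is \<open>0\<close>, then \<open>card info / d k \<longlonglongrightarrow> 0\<close> (\<open>mdim_ge\<close>).  The solutions
  contain a cube of dimension \<open>card info\<close> and edge length \<open>1/2\<close>.  Reduced modulo \<open>1\<close> and corrected at
  each site by a compactness argument, its points become almost equivariant maps into the dual
  (\<open>solution_to_Map\<close>).  For any compatible metric, the distance to the characters that are small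
  at a given generator is a \<open>1\<close>-Lipschitz function that separates opposite faces of the cube.  By the
  Poincare-Miranda theorem the vector of these functions is onto a cube whose edge length \<open>c\<close> does not
  depend on \<open>k\<close>, so there are about \<open>(c / \<epsilon>)\<close> to the power \<open>card info\<close> points that are
  \<open>\<epsilon>\<close>-separated in the supremum metric (\<open>many_separated_maps\<close>).

  If \<open>card info / d k \<longlonglongrightarrow> 0\<close>, then the entropy is finite (\<open>entropy_le_if_info_small\<close>).  Lift an almost
  equivariant map to a real vector \<open>y\<close> in the unit cube and round \<open>L y\<close> to an integer vector \<open>p\<close>,
  where \<open>1/L\<close> is the required precision.  The linear system applied to \<open>y\<close> is nearly integral and
  bounded, so that in most rows its value at \<open>p\<close> lies in a set whose size is bounded independently
  of \<open>L\<close>.  These values and the few coordinates of \<open>p\<close> in \<open>info\<close> determine \<open>p\<close>, so the number of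
  vectors \<open>p\<close> is exponential in \<open>d k\<close> with a rate that is independent of the precision.  Integrality
  thus replaces a bound for the small singular values of the system.

  Finally, finite entropy forces metric mean dimension at most \<open>0\<close> for every action on a compact
  metrizable space (\<open>finite_entropy_imp_mdim_le_0\<close>): maps that are close in the mean are close at most
  sites, and at each of the few remaining sites a bounded amount of information suffices.  The metric mean
  dimension is never negative here, which is the case \<open>a = 0\<close> of \<open>mdim_ge\<close>.
\<close>

section \<open>The circle as a compact metric group\<close>

text \<open>
  The distance from a real number to the nearest integer.  It induces the quotient topology, so the
  circle becomes a metric space, and translation invariance of the distance makes the estimates
  below additive.
\<close>

lift_definition circle_norm :: "circle \<Rightarrow> real" is "\<lambda>t. \<bar>t - of_int (round t)\<bar>"
proof -
  have le: "\<bar>s - of_int (round s)\<bar> \<le> \<bar>t - of_int (round t)\<bar>" if "s - t \<in> \<int>" for s t :: real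
  proof -
    from that obtain m where "s - t = of_int m" by (auto elim: Ints_cases)
    then have "t - of_int (round t) = s - of_int (round t + m)" by simp
    then show ?thesis using round_diff_minimal[of s "round t + m"] by simp
  qed
  fix s t :: real
  assume "s - t \<in> \<int>"
  moreover from this have "t - s \<in> \<int>" by (metis Ints_minus minus_diff_eq)
  ultimately show "\<bar>s - of_int (round s)\<bar> = \<bar>t - of_int (round t)\<bar>"
    using le[of s t] le[of t s] by simp
qed

lemma circle_norm_abs_circle_le: "circle_norm (abs_circle t) \<le> \<bar>t - of_int m\<bar>"
  by transfer (rule round_diff_minimal)

lemma circle_norm_abs_circle_le_abs: "circle_norm (abs_circle t) \<le> \<bar>t\<bar>"
  using circle_norm_abs_circle_le[of t 0] by simp

lemma circle_norm_abs_circle: "circle_norm (abs_circle t) = \<bar>t - of_int (round t)\<bar>"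
  by (simp add: circle_norm.abs_eq)

lemma circle_norm_nonneg [simp]: "0 \<le> circle_norm c"
  by transfer simp

lemma abs_circle_eq_iff: "abs_circle s = abs_circle t \<longleftrightarrow> s - t \<in> \<int>"
  by (simp add: circle.abs_eq_iff)

lemma abs_circle_surj: "\<exists>t. abs_circle t = c"
  by (induction c rule: circle.abs_induct) auto

lemma abs_circle_add: "abs_circle (s + t) = abs_circle s + abs_circle t"
  by (simp add: plus_circle.abs_eq)

lemma abs_circle_diff: "abs_circle (s - t) = abs_circle s - abs_circle t"
  by (simp add: minus_circle.abs_eq)

lemma abs_circle_0 [simp]: "abs_circle 0 = 0"
  by (simp add: zero_circle_def)

lemma abs_circle_sum: "abs_circle (sum f A) = (\<Sum>a\<in>A. abs_circle (f a))"
  by (induction A rule: infinite_finite_induct) (auto simp: abs_circle_add)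

lemma circle_norm_eq_0_iff [simp]: "circle_norm c = 0 \<longleftrightarrow> c = 0"
proof -
  obtain t where t: "c = abs_circle t" using abs_circle_surj by metis
  have "c = 0 \<longleftrightarrow> t \<in> \<int>"
    using abs_circle_eq_iff[of t 0] by (simp add: t)
  also have "\<dots> \<longleftrightarrow> \<bar>t - of_int (round t)\<bar> = 0"
  proof
    assume "t \<in> \<int>"
    then show "\<bar>t - of_int (round t)\<bar> = 0" by (auto elim: Ints_cases)
  next
    assume "\<bar>t - of_int (round t)\<bar> = 0"
    then have "t = of_int (round t)" by simp
    then show "t \<in> \<int>" by (metis Ints_of_int)
  qed
  finally show ?thesis by (simp add: t circle_norm_abs_circle)
qed

lemma circle_norm_0 [simp]: "circle_norm 0 = 0"
  by simp

lemma circle_norm_minus [simp]: "circle_norm (- c) = circle_norm c"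
proof -
  have le: "circle_norm (- c) \<le> circle_norm c" for c
  proof -
    obtain t where t: "c = abs_circle t" using abs_circle_surj by metis
    have "circle_norm (abs_circle (- t)) \<le> \<bar>- t - of_int (- round t)\<bar>"
      by (rule circle_norm_abs_circle_le)
    also have "\<dots> = circle_norm c" by (simp add: t circle_norm_abs_circle)
    finally show ?thesis by (simp add: t uminus_circle.abs_eq)
  qed
  from le[of c] le[of "- c"] show ?thesis by simp
qed

lemma circle_norm_add: "circle_norm (b + c) \<le> circle_norm b + circle_norm c"
proof -
  obtain s t where st: "b = abs_circle s" "c = abs_circle t" using abs_circle_surj by metis
  have "circle_norm (abs_circle (s + t)) \<le> \<bar>s + t - of_int (round s + round t)\<bar>"
    by (rule circle_norm_abs_circle_le)
  also have "\<dots> \<le> circle_norm b + circle_norm c"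
    by (simp add: st circle_norm_abs_circle)
  finally show ?thesis by (simp add: st abs_circle_add)
qed

lemma circle_norm_commute: "circle_norm (b - c) = circle_norm (c - b)"
  by (metis circle_norm_minus minus_diff_eq)

lemma circle_norm_triangle: "circle_norm (a - c) \<le> circle_norm (a - b) + circle_norm (b - c)"
  using circle_norm_add[of "a - b" "b - c"] by simp

lemma circle_norm_sum: "circle_norm (sum f A) \<le> (\<Sum>a\<in>A. circle_norm (f a))"
proof (induction A rule: infinite_finite_induct)
  case (insert a A)
  then show ?case using circle_norm_add[of "f a" "sum f A"] by simp
qed auto

instantiation circle :: metric_space
begin

definition dist_circle :: "circle \<Rightarrow> circle \<Rightarrow> real" where
  "dist_circle b c = circle_norm (b - c)"

definition uniformity_circle :: "(circle \<times> circle) filter" where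
  "uniformity_circle = (INF e\<in>{0<..}. principal {(b, c). dist b c < e})"

instance
proof
  show "(uniformity :: (circle \<times> circle) filter) = (INF e\<in>{0<..}. principal {(b, c). dist b c < e})"
    by (rule uniformity_circle_def)
  show dist_0: "dist b c = 0 \<longleftrightarrow> b = c" for b c :: circle
    by (simp add: dist_circle_def)
  show tri: "dist a b \<le> dist a c + dist b c" for a b c :: circle
    using circle_norm_triangle[of a b c] by (simp add: dist_circle_def circle_norm_commute)
  show "open U \<longleftrightarrow> (\<forall>b\<in>U. \<forall>\<^sub>F (b', c) in uniformity. b' = b \<longrightarrow> c \<in> U)" for U :: "circle set"
  proof -
    have base: "(\<forall>\<^sub>F (b', c) in uniformity. b' = b \<longrightarrow> c \<in> U) \<longleftrightarrow>
        (\<exists>e>0. \<forall>c. dist b c < e \<longrightarrow> c \<in> U)" for b :: circle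
      unfolding uniformity_circle_def
    proof (subst eventually_INF_base)
      show "{0<..} \<noteq> ({} :: real set)" by auto
      show "\<exists>x\<in>{0<..}. principal {(b, c::circle). dist b c < x} \<le>
          inf (principal {(b, c). dist b c < r}) (principal {(b, c). dist b c < s})"
        if "r \<in> {0<..}" "s \<in> {0<..}" for r s :: real
        using that by (intro bexI[of _ "min r s"]) auto
    qed (auto simp: eventually_principal)
    have "open U \<longleftrightarrow> (\<forall>b\<in>U. \<exists>e>0. \<forall>c. dist b c < e \<longrightarrow> c \<in> U)"
    proof
      assume "open U"
      then have o: "open (abs_circle -` U)" by (simp add: open_circle_def)
      show "\<forall>b\<in>U. \<exists>e>0. \<forall>c. dist b c < e \<longrightarrow> c \<in> U"
      proof
        fix b assume "b \<in> U"
        obtain s where s: "b = abs_circle s" using abs_circle_surj by metis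
        with \<open>b \<in> U\<close> o obtain e where e: "e > 0" "\<And>t. dist t s < e \<Longrightarrow> abs_circle t \<in> U"
          unfolding open_dist by force
        have "c \<in> U" if "dist b c < e" for c
        proof -
          obtain t where t: "c = abs_circle t" using abs_circle_surj by metis
          \<comment> \<open>the representative of the same class that is nearest to the given one\<close>
          let ?t = "t + of_int (round (s - t))"
          have "c = abs_circle ?t" by (simp add: t abs_circle_eq_iff)
          moreover have "dist ?t s < e"
            using that by (simp add: s t dist_circle_def flip: abs_circle_diff)
              (simp add: circle_norm_abs_circle dist_real_def)
          ultimately show ?thesis using e(2) by simp
        qed
        with e(1) show "\<exists>e>0. \<forall>c. dist b c < e \<longrightarrow> c \<in> U" by blast
      qed
    next
      assume *: "\<forall>b\<in>U. \<exists>e>0. \<forall>c. dist b c < e \<longrightarrow> c \<in> U"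
      have "open (abs_circle -` U)"
        unfolding open_dist
      proof
        fix s assume "s \<in> abs_circle -` U"
        with * obtain e where e: "e > 0" "\<And>c. dist (abs_circle s) c < e \<Longrightarrow> c \<in> U" by auto
        have "abs_circle t \<in> U" if "dist t s < e" for t
        proof (rule e(2))
          show "dist (abs_circle s) (abs_circle t) < e"
            using that circle_norm_abs_circle_le_abs[of "s - t"]
            by (simp add: dist_circle_def abs_circle_diff dist_real_def)
        qed
        with e(1) show "\<exists>e>0. \<forall>t. dist t s < e \<longrightarrow> t \<in> abs_circle -` U" by auto
      qed
      then show "open U" by (simp add: open_circle_def)
    qed
    then show ?thesis by (simp add: base)
  qed
qed

end

lemma continuous_on_circle_norm: "continuous_on A circle_norm"
proof -
  have "circle_norm c = dist c 0" for c by (simp add: dist_circle_def)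
  then show ?thesis by (simp add: continuous_intros)
qed

lemma compact_UNIV_circle: "compact (UNIV :: circle set)"
proof -
  have "continuous_on {0..1} abs_circle"
    unfolding continuous_on_iff
  proof (intro ballI allI impI)
    fix s e :: real assume "e > 0"
    then show "\<exists>r>0. \<forall>t\<in>{0..1}. dist t s < r \<longrightarrow> dist (abs_circle t) (abs_circle s) < e"
      using circle_norm_abs_circle_le_abs
      by (intro exI[of _ e]) (auto simp: dist_circle_def dist_real_def simp flip: abs_circle_diff
          intro: le_less_trans)
  qed
  then have "compact (abs_circle ` {0..1})" by (rule compact_continuous_image) simp
  moreover have "abs_circle ` {0..1} = UNIV"
  proof -
    have "c \<in> abs_circle ` {0..1}" for c
    proof -
      obtain t where t: "c = abs_circle t" using abs_circle_surj by metis
      have "c = abs_circle (frac t)" by (simp add: t abs_circle_eq_iff frac_def)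
      then show ?thesis using frac_ge_0[of t] frac_lt_1[of t] by (intro image_eqI) auto
    qed
    then show ?thesis by auto
  qed
  ultimately show ?thesis by simp
qed

lemma compact_UNIV_circle_fun: "compact (UNIV :: ('b \<Rightarrow> circle) set)"
proof -
  have "compact_space (euclidean :: circle topology)"
    by (simp add: compact_space_def compact_UNIV_circle)
  then have "compact_space (product_topology (\<lambda>_::'b. euclidean :: circle topology) UNIV)"
    by (simp add: compact_space_product_topology)
  then have "compact_space (euclidean :: ('b \<Rightarrow> circle) topology)"
    unfolding euclidean_product_topology .
  then show ?thesis by (simp add: compact_space_def)
qed

lemma continuous_on_circle_add:
  fixes f g :: "'b::topological_space \<Rightarrow> circle"
  assumes "continuous_on A f" "continuous_on A g"
  shows "continuous_on A (\<lambda>x. f x + g x)"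
proof -
  have "((\<lambda>x. f x + g x) \<longlongrightarrow> f a + g a) (at a within A)"
    if a: "(f \<longlongrightarrow> f a) (at a within A)" "(g \<longlongrightarrow> g a) (at a within A)" for a
  proof (rule metric_tendsto_imp_tendsto)
    show "((\<lambda>x. dist (f x) (f a) + dist (g x) (g a)) \<longlongrightarrow> 0 + 0) (at a within A)"
      using a by (intro tendsto_add) (simp_all flip: tendsto_dist_iff)
    show "\<forall>\<^sub>F x in at a within A. dist (f x + g x) (f a + g a) \<le>
        dist (dist (f x) (f a) + dist (g x) (g a)) (0 + 0)"
      using circle_norm_add[of "f x - f a" "g x - g a" for x]
      by (auto simp: dist_circle_def algebra_simps)
  qed
  with assms show ?thesis by (simp add: continuous_on_def)
qed

lemma continuous_on_circle_minus:
  fixes f :: "'b::topological_space \<Rightarrow> circle"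
  assumes "continuous_on A f"
  shows "continuous_on A (\<lambda>x. - f x)"
proof -
  have "((\<lambda>x. - f x) \<longlongrightarrow> - f a) (at a within A)" if "(f \<longlongrightarrow> f a) (at a within A)" for a
    using that unfolding tendsto_dist_iff[of f] tendsto_dist_iff[of "\<lambda>x. - f x"]
    by (simp add: dist_circle_def circle_norm_commute add.commute)
  with assms show ?thesis by (simp add: continuous_on_def)
qed

lemma continuous_on_circle_diff:
  fixes f g :: "'b::topological_space \<Rightarrow> circle"
  assumes "continuous_on A f" "continuous_on A g"
  shows "continuous_on A (\<lambda>x. f x - g x)"
  using continuous_on_circle_add[OF assms(1) continuous_on_circle_minus[OF assms(2)]] by simp

lemma continuous_on_circle_sum:
  fixes f :: "'c \<Rightarrow> 'b::topological_space \<Rightarrow> circle"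
  assumes "\<And>i. i \<in> I \<Longrightarrow> continuous_on A (f i)"
  shows "continuous_on A (\<lambda>x. \<Sum>i\<in>I. f i x)"
  using assms by (induction I rule: infinite_finite_induct) (auto intro: continuous_on_circle_add)

lift_definition int_circle :: "int \<Rightarrow> circle \<Rightarrow> circle" is "\<lambda>k t. of_int k * t"
  by (metis Ints_mult Ints_of_int right_diff_distrib)

lemma int_circle_abs_circle: "int_circle k (abs_circle t) = abs_circle (of_int k * t)"
  by (simp add: int_circle.abs_eq)

lemma int_circle_add_left: "int_circle (k + l) c = int_circle k c + int_circle l c"
  by transfer (simp add: algebra_simps)

lemma int_circle_diff_right: "int_circle k (b - c) = int_circle k b - int_circle k c"
  by transfer (simp add: algebra_simps)

lemma int_circle_0 [simp]: "int_circle 0 c = 0"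
  by transfer simp

lemma int_circle_0_right [simp]: "int_circle k 0 = 0"
  by transfer simp

lemma int_circle_1 [simp]: "int_circle 1 c = c"
  by transfer simp

lemma int_circle_uminus: "int_circle (- k) c = - int_circle k c"
  by transfer simp

lemma circle_norm_int_circle: "circle_norm (int_circle k c) \<le> of_int \<bar>k\<bar> * circle_norm c"
proof -
  obtain t where t: "c = abs_circle t" using abs_circle_surj by metis
  have "circle_norm (abs_circle (of_int k * t)) \<le> \<bar>of_int k * t - of_int (k * round t)\<bar>"
    by (rule circle_norm_abs_circle_le)
  also have "\<dots> = of_int \<bar>k\<bar> * circle_norm c"
    by (simp add: t circle_norm_abs_circle flip: abs_mult right_diff_distrib)
  finally show ?thesis by (simp add: t int_circle_abs_circle)
qed

lemma continuous_on_int_circle: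
  fixes f :: "'b::topological_space \<Rightarrow> circle"
  assumes "continuous_on A f"
  shows "continuous_on A (\<lambda>x. int_circle k (f x))"
proof -
  have "((\<lambda>x. int_circle k (f x)) \<longlongrightarrow> int_circle k (f a)) (at a within A)"
    if a: "(f \<longlongrightarrow> f a) (at a within A)" for a
  proof (rule metric_tendsto_imp_tendsto)
    show "((\<lambda>x. of_int \<bar>k\<bar> * dist (f x) (f a)) \<longlongrightarrow> of_int \<bar>k\<bar> * 0) (at a within A)"
      using a by (intro tendsto_mult tendsto_const) (simp flip: tendsto_dist_iff)
    show "\<forall>\<^sub>F x in at a within A. dist (int_circle k (f x)) (int_circle k (f a)) \<le>
        dist (of_int \<bar>k\<bar> * dist (f x) (f a)) (of_int \<bar>k\<bar> * 0)"
      using circle_norm_int_circle[of k "f x - f a" for x]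
      by (auto simp: dist_circle_def int_circle_diff_right abs_mult)
  qed
  with assms show ?thesis by (simp add: continuous_on_def)
qed

text \<open>
  A homomorphism from the integers is determined by its value at \<open>1\<close>.  This turns the action of
  integer coefficients on characters into integer multiples in the circle.
\<close>

lemma additive_to_circle_of_int:
  fixes f :: "int \<Rightarrow> circle"
  assumes add: "\<And>k l. f (k + l) = f k + f l"
  shows "f k = int_circle k (f 1)"
proof -
  have f0: "f 0 = 0" using add[of 0 0] by simp
  have n: "f (int m) = int_circle (int m) (f 1)" for m
    by (induction m) (auto simp: f0 add int_circle_add_left)
  show ?thesis
  proof (cases "k \<ge> 0")
    case True
    then show ?thesis using n[of "nat k"] by simp
  next
    case False
    then have "f (- k) = int_circle (- k) (f 1)" using n[of "nat (- k)"] by simp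
    moreover have "f k + f (- k) = 0" using add[of k "- k"] f0 by simp
    ultimately show ?thesis by (simp add: int_circle_uminus)
  qed
qed

section \<open>Compact spaces and pseudometrics\<close>

lemma openin_sublevel:
  fixes h :: "'z::topological_space \<Rightarrow> real"
  assumes "continuous_on Z h"
  shows "openin (top_of_set Z) {z \<in> Z. h z < e}"
proof -
  have "{z \<in> Z. h z < e} = Z \<inter> h -` {..<e}" by auto
  then show ?thesis using continuous_openin_preimage_gen[OF assms, of "{..<e}"] by simp
qed

text \<open>
  The form of compactness used throughout: if exact conditions force membership in an open set, then
  finitely many of them, satisfied up to a uniform tolerance, suffice.  The set \<open>U\<close> and the sets where
  one of the functions exceeds a positive number form an open cover.
\<close>

lemma compact_finite_tolerance:
  fixes f :: "'k \<Rightarrow> 'z::topological_space \<Rightarrow> real"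
  assumes "compact Z"
    and cont: "\<And>k. k \<in> K \<Longrightarrow> continuous_on Z (f k)"
    and nonneg: "\<And>k z. k \<in> K \<Longrightarrow> z \<in> Z \<Longrightarrow> 0 \<le> f k z"
    and U: "openin (top_of_set Z) U"
    and zero: "\<And>z. z \<in> Z \<Longrightarrow> (\<And>k. k \<in> K \<Longrightarrow> f k z = 0) \<Longrightarrow> z \<in> U"
  obtains E \<tau> where "finite E" "E \<subseteq> K" "\<tau> > 0"
    "\<And>z. z \<in> Z \<Longrightarrow> (\<And>k. k \<in> E \<Longrightarrow> f k z < \<tau>) \<Longrightarrow> z \<in> U"
proof -
  define V where "V = (\<lambda>(k, e). {z \<in> Z. - f k z < - e})"
  let ?C = "insert U (V ` (K \<times> {0<..}))"
  have "\<forall>c\<in>?C. openin (top_of_set Z) c"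
  proof
    fix c assume "c \<in> ?C"
    then consider "c = U" | k e where "k \<in> K" "c = {z \<in> Z. - f k z < - e}" by (auto simp: V_def)
    then show "openin (top_of_set Z) c"
      using U cont by cases (auto intro!: openin_sublevel continuous_on_minus simp del: neg_less_iff_less)
  qed
  moreover have "Z \<subseteq> \<Union>?C"
  proof
    fix z assume z: "z \<in> Z"
    show "z \<in> \<Union>?C"
    proof (cases "\<forall>k\<in>K. f k z = 0")
      case True
      then show ?thesis using zero[OF z] by auto
    next
      case False
      then obtain k where k: "k \<in> K" "f k z \<noteq> 0" by auto
      then have "f k z > 0" using nonneg[OF k(1) z] by simp
      then have "z \<in> V (k, f k z / 2)" using z by (simp add: V_def)
      with k \<open>f k z > 0\<close> show ?thesis by force
    qed
  qed
  ultimately obtain D where D: "D \<subseteq> ?C" "finite D" "Z \<subseteq> \<Union>D"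
    using \<open>compact Z\<close> unfolding compact_eq_openin_cover by meson
  have "D - {U} \<subseteq> V ` (K \<times> {0<..})" using D(1) by auto
  then obtain P where P: "P \<subseteq> K \<times> {0<..}" "finite P" "D - {U} = V ` P"
    using finite_subset_image[of "D - {U}" V "K \<times> {0<..}"] D(2) by auto
  define \<tau> where "\<tau> = Min (insert 1 (snd ` P))"
  have \<tau>: "\<tau> > 0" unfolding \<tau>_def using P(1,2) by auto
  have sub: "fst ` P \<subseteq> K" using P by auto
  have U: "z \<in> U" if z: "z \<in> Z" and small: "\<And>k. k \<in> fst ` P \<Longrightarrow> f k z < \<tau>" for z
  proof (rule ccontr)
    assume "z \<notin> U"
    moreover obtain c where "c \<in> D" "z \<in> c" using D(3) z by blast
    ultimately have "c \<in> V ` P" unfolding P(3)[symmetric] by blast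
    with \<open>z \<in> c\<close> obtain k e where ke: "(k, e) \<in> P" "z \<in> V (k, e)" by force
    have "\<tau> \<le> e" unfolding \<tau>_def using ke(1) P(2) by (intro Min_le) force+
    moreover have "f k z < \<tau>" using ke(1) by (intro small) force
    ultimately show False using ke(2) by (simp add: V_def)
  qed
  have fin: "finite (fst ` P)" using P(2) by simp
  show ?thesis
  proof (rule that)
    show "finite (fst ` P)" "fst ` P \<subseteq> K" "\<tau> > 0" by (fact fin sub \<tau>)+
    show "z \<in> U" if "z \<in> Z" "\<And>k. k \<in> fst ` P \<Longrightarrow> f k z < \<tau>" for z
      using U that by blast
  qed
qed

lemma continuous_pseudometric_iff:
  fixes X :: "'x::topological_space set"
  shows "continuous_pseudometric (top_of_set X) \<rho> \<longleftrightarrow>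
    (\<forall>x\<in>X. \<forall>y\<in>X. 0 \<le> \<rho> x y \<and> \<rho> x y = \<rho> y x) \<and> (\<forall>x\<in>X. \<rho> x x = 0) \<and>
    (\<forall>x\<in>X. \<forall>y\<in>X. \<forall>z\<in>X. \<rho> x z \<le> \<rho> x y + \<rho> y z) \<and>
    continuous_on (X \<times> X) (\<lambda>p. \<rho> (fst p) (snd p))"
proof -
  have "prod_topology (top_of_set X) (top_of_set X) = top_of_set (X \<times> X)"
    by simp
  then show ?thesis
    by (simp add: continuous_pseudometric_def case_prod_beta')
qed

locale compact_action =
  fixes X :: "'x::topological_space set" and act :: "'g::group_add \<Rightarrow> 'x \<Rightarrow> 'x"
  assumes compact_X: "compact X"
    and act_in: "x \<in> X \<Longrightarrow> act g x \<in> X"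
    and act_continuous: "continuous_on X (act g)"
    and act_add: "x \<in> X \<Longrightarrow> act (g + h) x = act g (act h x)"
    and act_0: "x \<in> X \<Longrightarrow> act 0 x = x"
begin

abbreviation "pseudo \<rho> \<equiv> continuous_pseudometric (top_of_set X) \<rho>"
abbreviation "generating \<rho> \<equiv> dynamically_generating (top_of_set X) act \<rho>"

lemma
  assumes "pseudo \<rho>"
  shows pseudo_nonneg: "x \<in> X \<Longrightarrow> y \<in> X \<Longrightarrow> 0 \<le> \<rho> x y"
    and pseudo_commute: "x \<in> X \<Longrightarrow> y \<in> X \<Longrightarrow> \<rho> x y = \<rho> y x"
    and pseudo_refl: "x \<in> X \<Longrightarrow> \<rho> x x = 0"
    and pseudo_triangle: "x \<in> X \<Longrightarrow> y \<in> X \<Longrightarrow> z \<in> X \<Longrightarrow> \<rho> x z \<le> \<rho> x y + \<rho> y z"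
    and pseudo_continuous: "continuous_on (X \<times> X) (\<lambda>p. \<rho> (fst p) (snd p))"
  using assms unfolding continuous_pseudometric_iff by blast+

lemma pseudo_bounded:
  assumes "pseudo \<rho>"
  obtains D where "D > 0" "\<And>x y. x \<in> X \<Longrightarrow> y \<in> X \<Longrightarrow> \<rho> x y \<le> D"
proof -
  have "compact ((\<lambda>p. \<rho> (fst p) (snd p)) ` (X \<times> X))"
    using pseudo_continuous[OF assms] compact_X by (intro compact_continuous_image compact_Times)
  then have "bounded ((\<lambda>p. \<rho> (fst p) (snd p)) ` (X \<times> X))" by (rule compact_imp_bounded)
  then obtain D where D: "D > 0" "\<forall>t\<in>(\<lambda>p. \<rho> (fst p) (snd p)) ` (X \<times> X). norm t \<le> D"
    unfolding bounded_pos by blast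
  show ?thesis
  proof (rule that[OF D(1)])
    fix x y assume "x \<in> X" "y \<in> X"
    then have "norm (\<rho> x y) \<le> D" using D(2) by force
    then show "\<rho> x y \<le> D" by simp
  qed
qed

lemma pseudo_continuous_act:
  assumes "pseudo \<rho>"
  shows "continuous_on (X \<times> X) (\<lambda>p. \<rho> (act g (fst p)) (act g (snd p)))"
proof -
  have "continuous_on (X \<times> X) (\<lambda>p. (act g (fst p), act g (snd p)))"
    by (intro continuous_on_Pair continuous_on_compose2[OF act_continuous] continuous_on_fst
        continuous_on_snd continuous_on_id) auto
  moreover have "(\<lambda>p. (act g (fst p), act g (snd p))) ` (X \<times> X) \<subseteq> X \<times> X" using act_in by auto
  ultimately have "continuous_on (X \<times> X)
      (\<lambda>p. \<rho> (fst (act g (fst p), act g (snd p))) (snd (act g (fst p), act g (snd p))))"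
    using continuous_on_compose2[OF pseudo_continuous[OF assms]] by blast
  then show ?thesis by simp
qed

text \<open>
  Because the pseudometric \<open>\<rho>\<close> is dynamically generating, closeness along a finite part of the orbits
  implies closeness for any other continuous pseudometric.  Comparing pseudometrics in this way
  replaces the invariance of entropy under a change of the pseudometric.
\<close>

lemma pseudo_finite_window:
  assumes "pseudo \<rho>" "generating \<rho>" "pseudo \<rho>'" "\<epsilon> > 0"
  obtains E \<tau> where "finite E" "\<tau> > 0"
    "\<And>x y. x \<in> X \<Longrightarrow> y \<in> X \<Longrightarrow> (\<And>g. g \<in> E \<Longrightarrow> \<rho> (act g x) (act g y) < \<tau>) \<Longrightarrow> \<rho>' x y < \<epsilon>"
proof -
  obtain E \<tau> where E: "finite E" "E \<subseteq> UNIV" "\<tau> > 0"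
    "\<And>z. z \<in> X \<times> X \<Longrightarrow> (\<And>g. g \<in> E \<Longrightarrow> \<rho> (act g (fst z)) (act g (snd z)) < \<tau>) \<Longrightarrow>
      z \<in> {z \<in> X \<times> X. \<rho>' (fst z) (snd z) < \<epsilon>}"
  proof (rule compact_finite_tolerance[where Z = "X \<times> X" and K = UNIV and
        f = "\<lambda>g z. \<rho> (act g (fst z)) (act g (snd z))" and U = "{z \<in> X \<times> X. \<rho>' (fst z) (snd z) < \<epsilon>}"])
    show "compact (X \<times> X)" by (intro compact_Times compact_X)
    show "continuous_on (X \<times> X) (\<lambda>z. \<rho> (act g (fst z)) (act g (snd z)))" for g
      by (rule pseudo_continuous_act[OF assms(1)])
    show "0 \<le> \<rho> (act g (fst z)) (act g (snd z))" if "z \<in> X \<times> X" for g z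
      using that act_in pseudo_nonneg[OF assms(1)] by auto
    show "openin (top_of_set (X \<times> X)) {z \<in> X \<times> X. \<rho>' (fst z) (snd z) < \<epsilon>}"
      by (intro openin_sublevel pseudo_continuous assms)
    fix z assume z: "z \<in> X \<times> X" and 0: "\<And>g. g \<in> UNIV \<Longrightarrow> \<rho> (act g (fst z)) (act g (snd z)) = 0"
    have "fst z = snd z"
    proof (rule ccontr)
      assume "fst z \<noteq> snd z"
      with z assms(2) obtain g where "\<rho> (act g (fst z)) (act g (snd z)) > 0"
        unfolding dynamically_generating_def by (auto simp: mem_Times_iff)
      with 0 show False by simp
    qed
    with z show "z \<in> {z \<in> X \<times> X. \<rho>' (fst z) (snd z) < \<epsilon>}"
      using pseudo_refl[OF assms(3)] \<open>\<epsilon> > 0\<close> by auto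
  qed blast
  show ?thesis
  proof (rule that[OF E(1,3)])
    fix x y assume "x \<in> X" "y \<in> X" "\<And>g. g \<in> E \<Longrightarrow> \<rho> (act g x) (act g y) < \<tau>"
    then show "\<rho>' x y < \<epsilon>" using E(4)[of "(x, y)"] by auto
  qed
qed

lemma compatible_imp_pseudo:
  assumes "compatible_metric (top_of_set X) \<rho>"
  shows "pseudo \<rho>" "generating \<rho>"
proof -
  interpret Metric_space X \<rho> using assms by (simp add: compatible_metric_def)
  have top: "mtopology = top_of_set X" using assms by (simp add: compatible_metric_def)
  have "continuous_map (prod_topology mtopology mtopology) euclideanreal (\<lambda>(x, y). \<rho> x y)"
    using continuous_map_metric[of "metric (X, \<rho>)"] by (simp add: mtopology_of_def)
  then show "pseudo \<rho>"
    by (auto simp: continuous_pseudometric_def top commute triangle)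
  show "generating \<rho>"
    unfolding dynamically_generating_def
  proof (intro ballI impI exI[of _ 0])
    fix x y assume "x \<in> topspace (top_of_set X)" "y \<in> topspace (top_of_set X)" "x \<noteq> y"
    then show "\<rho> (act 0 x) (act 0 y) > 0" by (simp add: act_0)
  qed
qed

text \<open>
  Equality of labels gives closeness, so finitely many labels describe a point up to \<open>\<epsilon>\<close>.
\<close>

lemma pseudo_finite_partition:
  assumes "pseudo \<rho>" "\<epsilon> > 0"
  obtains m :: nat and lab where "lab ` X \<subseteq> {..<m}"
    "\<And>x y. x \<in> X \<Longrightarrow> y \<in> X \<Longrightarrow> lab x = lab y \<Longrightarrow> \<rho> x y \<le> \<epsilon>"
proof -
  let ?V = "\<lambda>a. {x \<in> X. \<rho> a x < \<epsilon> / 2}"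
  have "\<forall>c\<in>?V ` X. openin (top_of_set X) c"
  proof safe
    fix a assume a: "a \<in> X"
    have "continuous_on X (\<lambda>x. \<rho> (fst (a, x)) (snd (a, x)))"
      by (rule continuous_on_compose2[OF pseudo_continuous[OF assms(1)]])
        (use a in \<open>auto intro!: continuous_intros\<close>)
    then show "openin (top_of_set X) (?V a)" by (intro openin_sublevel) simp
  qed
  moreover have "X \<subseteq> \<Union>(?V ` X)" using pseudo_refl[OF assms(1)] assms(2) by force
  ultimately obtain D where D: "D \<subseteq> ?V ` X" "finite D" "X \<subseteq> \<Union>D"
    using compact_X unfolding compact_eq_openin_cover by meson
  obtain P where P: "P \<subseteq> X" "finite P" "D = ?V ` P"
    using finite_subset_image[OF D(2,1)] by auto
  obtain num where num: "bij_betw num P {0..<card P}" using ex_bij_betw_finite_nat[OF P(2)] by blast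
  define near where "near x = (SOME a. a \<in> P \<and> \<rho> a x < \<epsilon> / 2)" for x
  have near: "near x \<in> P \<and> \<rho> (near x) x < \<epsilon> / 2" if "x \<in> X" for x
  proof -
    have "\<exists>a. a \<in> P \<and> \<rho> a x < \<epsilon> / 2" using that D(3) P(3) by auto
    then show ?thesis unfolding near_def by (rule someI_ex)
  qed
  show ?thesis
  proof (rule that[of "num \<circ> near" "card P"])
    show "(num \<circ> near) ` X \<subseteq> {..<card P}"
      using near num by (auto simp: bij_betw_def)
    fix x y assume xy: "x \<in> X" "y \<in> X" "(num \<circ> near) x = (num \<circ> near) y"
    then have "near x = near y"
      using near[of x] near[of y] inj_onD[OF bij_betw_imp_inj_on[OF num], of "near x" "near y"] by simp
    then have "\<rho> x y \<le> \<rho> (near x) x + \<rho> (near y) y"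
      using pseudo_triangle[OF assms(1), of x "near x" y] xy near[of x] near[of y] P(1)
        pseudo_commute[OF assms(1), of x "near x"] by auto
    then show "\<rho> x y \<le> \<epsilon>" using near[of x] near[of y] xy by auto
  qed
qed

end

section \<open>Statements that hold at most sites\<close>

text \<open>
  Closeness in the mean square is handled by means of its bounded version, closeness outside a small
  proportion of the sites \<open>{1..d}\<close>; \<open>mostly_if_rho_2_le\<close> and \<open>rho_2_le_if_mostly\<close> pass between the
  two.
\<close>

definition mostly :: "real \<Rightarrow> nat \<Rightarrow> (nat \<Rightarrow> bool) \<Rightarrow> bool" where
  "mostly \<beta> d P \<longleftrightarrow> real (card {j \<in> {1..d}. \<not> P j}) \<le> \<beta> * real d"

lemma exists_small_multiple:
  fixes K \<beta> :: real
  assumes "0 \<le> K" "0 < \<beta>"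
  obtains \<gamma> where "0 < \<gamma>" "K * \<gamma> \<le> \<beta>"
proof
  show "0 < \<beta> / (K + 1)" using assms by (intro divide_pos_pos) auto
  show "K * (\<beta> / (K + 1)) \<le> \<beta>" using assms by (simp add: divide_le_eq mult_left_mono)
qed

lemma mostly_mono:
  assumes "mostly \<beta> d P" "\<And>j. j \<in> {1..d} \<Longrightarrow> P j \<Longrightarrow> Q j" "\<beta> \<le> \<gamma>"
  shows "mostly \<gamma> d Q"
proof -
  have "card {j \<in> {1..d}. \<not> Q j} \<le> card {j \<in> {1..d}. \<not> P j}"
    using assms(2) by (intro card_mono) auto
  then have "real (card {j \<in> {1..d}. \<not> Q j}) \<le> \<beta> * real d"
    using assms(1) unfolding mostly_def by linarith
  also have "\<dots> \<le> \<gamma> * real d" using assms(3) by (intro mult_right_mono) auto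
  finally show ?thesis by (simp add: mostly_def)
qed

lemma mostly_conj:
  assumes "mostly \<beta> d P" "mostly \<gamma> d Q"
  shows "mostly (\<beta> + \<gamma>) d (\<lambda>j. P j \<and> Q j)"
proof -
  have "{j \<in> {1..d}. \<not> (P j \<and> Q j)} = {j \<in> {1..d}. \<not> P j} \<union> {j \<in> {1..d}. \<not> Q j}" by auto
  then have "card {j \<in> {1..d}. \<not> (P j \<and> Q j)} \<le> card {j \<in> {1..d}. \<not> P j} + card {j \<in> {1..d}. \<not> Q j}"
    using card_Un_le[of "{j \<in> {1..d}. \<not> P j}" "{j \<in> {1..d}. \<not> Q j}"] by simp
  then have "real (card {j \<in> {1..d}. \<not> (P j \<and> Q j)}) \<le>
      real (card {j \<in> {1..d}. \<not> P j}) + real (card {j \<in> {1..d}. \<not> Q j})" by linarith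
  then show ?thesis using assms by (simp add: mostly_def distrib_right)
qed

text \<open>
  Union bound over the exceptional sets.
\<close>

lemma mostly_ball:
  assumes "finite E" "\<And>e. e \<in> E \<Longrightarrow> mostly \<beta> d (P e)"
  shows "mostly (real (card E) * \<beta>) d (\<lambda>j. \<forall>e\<in>E. P e j)"
  using assms
proof (induction E rule: finite_induct)
  case empty
  then show ?case by (simp add: mostly_def)
next
  case (insert e E)
  have "mostly (\<beta> + real (card E) * \<beta>) d (\<lambda>j. P e j \<and> (\<forall>e\<in>E. P e j))"
    using insert by (intro mostly_conj) auto
  then show ?case by (rule mostly_mono) (use insert in \<open>auto simp: algebra_simps\<close>)
qed

lemma mostly_permute:
  assumes "\<pi> permutes {1..d}" "mostly \<beta> d P"
  shows "mostly \<beta> d (\<lambda>j. P (\<pi> j))"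
proof -
  have "{j \<in> {1..d}. \<not> P j} = \<pi> ` {j \<in> {1..d}. \<not> P (\<pi> j)}"
  proof (intro equalityI subsetI)
    fix j assume j: "j \<in> {j \<in> {1..d}. \<not> P j}"
    have "j \<in> \<pi> ` {1..d}" using j unfolding permutes_image[OF assms(1)] by simp
    then obtain k where "j = \<pi> k" "k \<in> {1..d}" by (rule imageE)
    then show "j \<in> \<pi> ` {j \<in> {1..d}. \<not> P (\<pi> j)}" using j by auto
  next
    fix j assume "j \<in> \<pi> ` {j \<in> {1..d}. \<not> P (\<pi> j)}"
    then obtain k where "j = \<pi> k" "k \<in> {1..d}" "\<not> P (\<pi> k)" by auto
    then show "j \<in> {j \<in> {1..d}. \<not> P j}" using permutes_in_image[OF assms(1), of k] by simp
  qed
  then have "card {j \<in> {1..d}. \<not> P j} = card {j \<in> {1..d}. \<not> P (\<pi> j)}"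
    by (simp add: card_image inj_on_subset[OF permutes_inj[OF assms(1)] subset_UNIV])
  with assms(2) show ?thesis by (simp add: mostly_def)
qed

text \<open>
  Chebyshev's inequality.
\<close>

lemma mostly_if_rho_2_le:
  assumes rho: "rho_2 \<rho> d \<phi> \<psi> \<le> \<delta>" and nonneg: "\<And>j. j \<in> {1..d} \<Longrightarrow> 0 \<le> \<rho> (\<phi> j) (\<psi> j)"
    and "\<delta> \<le> \<tau> * sqrt \<beta>" "\<tau> > 0" "\<beta> \<ge> 0"
  shows "mostly \<beta> d (\<lambda>j. \<rho> (\<phi> j) (\<psi> j) < \<tau>)"
proof (cases "d = 0")
  case True
  then show ?thesis by (simp add: mostly_def)
next
  case False
  let ?S = "\<Sum>j\<in>{1..d}. (\<rho> (\<phi> j) (\<psi> j))\<^sup>2"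
  let ?B = "{j \<in> {1..d}. \<not> \<rho> (\<phi> j) (\<psi> j) < \<tau>}"
  have "real (card ?B) * \<tau>\<^sup>2 = (\<Sum>j\<in>?B. \<tau>\<^sup>2)" by simp
  also have "\<dots> \<le> (\<Sum>j\<in>?B. (\<rho> (\<phi> j) (\<psi> j))\<^sup>2)"
    using \<open>\<tau> > 0\<close> by (intro sum_mono power_mono) auto
  also have "\<dots> \<le> ?S" by (intro sum_mono2) auto
  finally have 1: "real (card ?B) * \<tau>\<^sup>2 \<le> ?S" .
  have "sqrt (1 / real d * ?S) \<le> \<tau> * sqrt \<beta>"
    using rho assms(3) unfolding rho_2_def by linarith
  then have "1 / real d * ?S \<le> (\<tau> * sqrt \<beta>)\<^sup>2" by (rule sqrt_le_D)
  also have "\<dots> = \<tau>\<^sup>2 * \<beta>" using \<open>\<beta> \<ge> 0\<close> by (simp add: power_mult_distrib)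
  finally have "?S \<le> \<tau>\<^sup>2 * \<beta> * real d" using False by (simp add: field_simps)
  with 1 have "\<tau>\<^sup>2 * real (card ?B) \<le> \<tau>\<^sup>2 * (\<beta> * real d)" by (simp add: algebra_simps)
  then show ?thesis using \<open>\<tau> > 0\<close> by (simp add: mostly_def)
qed

lemma rho_2_le_if_mostly:
  assumes m: "mostly \<beta> d (\<lambda>j. \<rho> (\<phi> j) (\<psi> j) < \<tau>)"
    and bounds: "\<And>j. j \<in> {1..d} \<Longrightarrow> 0 \<le> \<rho> (\<phi> j) (\<psi> j)" "\<And>j. j \<in> {1..d} \<Longrightarrow> \<rho> (\<phi> j) (\<psi> j) \<le> D"
    and "\<beta> * D\<^sup>2 + \<tau>\<^sup>2 \<le> \<delta>\<^sup>2" "0 \<le> \<delta>"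
  shows "rho_2 \<rho> d \<phi> \<psi> \<le> \<delta>"
proof (cases "d = 0")
  case True
  then show ?thesis using \<open>0 \<le> \<delta>\<close> by (simp add: rho_2_def)
next
  case False
  let ?B = "{j \<in> {1..d}. \<not> \<rho> (\<phi> j) (\<psi> j) < \<tau>}"
  have "(\<Sum>j\<in>{1..d}. (\<rho> (\<phi> j) (\<psi> j))\<^sup>2) \<le> (\<Sum>j\<in>{1..d}. \<tau>\<^sup>2 + (if j \<in> ?B then D\<^sup>2 else 0))"
  proof (rule sum_mono)
    fix j assume j: "j \<in> {1..d}"
    show "(\<rho> (\<phi> j) (\<psi> j))\<^sup>2 \<le> \<tau>\<^sup>2 + (if j \<in> ?B then D\<^sup>2 else 0)"
    proof (cases "j \<in> ?B")
      case True
      have "(\<rho> (\<phi> j) (\<psi> j))\<^sup>2 \<le> D\<^sup>2" using bounds[OF j] by (intro power_mono) auto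
      then show ?thesis using True by (simp add: add_increasing)
    next
      case False
      then have "(\<rho> (\<phi> j) (\<psi> j))\<^sup>2 \<le> \<tau>\<^sup>2" using j bounds(1)[OF j] by (intro power_mono) auto
      then show ?thesis using False by auto
    qed
  qed
  also have "\<dots> = real d * \<tau>\<^sup>2 + real (card ?B) * D\<^sup>2"
    by (simp add: sum.distrib sum.If_cases Int_def)
  also have "\<dots> \<le> real d * \<tau>\<^sup>2 + (\<beta> * real d) * D\<^sup>2"
    using m unfolding mostly_def by (intro add_left_mono mult_right_mono) auto
  also have "\<dots> = real d * (\<beta> * D\<^sup>2 + \<tau>\<^sup>2)" by (simp add: algebra_simps)
  also have "\<dots> \<le> real d * \<delta>\<^sup>2" using assms(4) by (intro mult_left_mono) auto
  finally have "1 / real d * (\<Sum>j\<in>{1..d}. (\<rho> (\<phi> j) (\<psi> j))\<^sup>2) \<le> \<delta>\<^sup>2"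
    using False by (simp add: field_simps)
  then have "sqrt (1 / real d * (\<Sum>j\<in>{1..d}. (\<rho> (\<phi> j) (\<psi> j))\<^sup>2)) \<le> sqrt (\<delta>\<^sup>2)"
    by (rule real_sqrt_le_mono)
  then show ?thesis using \<open>0 \<le> \<delta>\<close> by (simp add: rho_2_def)
qed

section \<open>Almost equivariant maps\<close>

locale sofic =
  fixes d :: "nat \<Rightarrow> nat" and \<sigma> :: "nat \<Rightarrow> 'g::group_add \<Rightarrow> nat \<Rightarrow> nat"
  assumes sofic: "sofic_approximation d \<sigma>"
begin

lemma sofic_permutes: "\<sigma> i g permutes {1..d i}"
  using sofic by (simp add: sofic_approximation_def)

lemma sofic_in: "\<sigma> i g j \<in> {1..d i} \<longleftrightarrow> j \<in> {1..d i}"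
  by (rule permutes_in_image[OF sofic_permutes])

lemma sofic_d_pos: "\<forall>\<^sub>F i in sequentially. 0 < d i"
proof -
  have "filterlim d at_top sequentially" using sofic by (simp add: sofic_approximation_def)
  then show ?thesis using eventually_gt_at_top[of 0] unfolding filterlim_iff by blast
qed

lemma sofic_multiplicative:
  assumes "finite P" "\<beta> > 0"
  shows "\<forall>\<^sub>F i in sequentially. mostly \<beta> (d i) (\<lambda>j. \<forall>(g, h)\<in>P. \<sigma> i g (\<sigma> i h j) = \<sigma> i (g + h) j)"
proof -
  obtain \<gamma> where \<gamma>: "\<gamma> > 0" "real (card P) * \<gamma> \<le> \<beta>"
    using exists_small_multiple[of "real (card P)" \<beta>] assms(2) by auto
  have one: "\<forall>\<^sub>F i in sequentially. mostly \<gamma> (d i) (\<lambda>j. \<sigma> i g (\<sigma> i h j) = \<sigma> i (g + h) j)" for g h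
  proof -
    have "(\<lambda>i. real (card {j \<in> {1..d i}. (\<sigma> i g \<circ> \<sigma> i h) j = \<sigma> i (g + h) j}) / real (d i)) \<longlonglongrightarrow> 1"
      using sofic by (simp add: sofic_approximation_def)
    then have "\<forall>\<^sub>F i in sequentially. 1 - \<gamma> <
        real (card {j \<in> {1..d i}. (\<sigma> i g \<circ> \<sigma> i h) j = \<sigma> i (g + h) j}) / real (d i)"
      using \<gamma>(1) by (intro order_tendstoD) auto
    with sofic_d_pos show ?thesis
    proof eventually_elim
      case (elim i)
      let ?A = "{j \<in> {1..d i}. (\<sigma> i g \<circ> \<sigma> i h) j = \<sigma> i (g + h) j}"
      have "{j \<in> {1..d i}. \<not> (\<sigma> i g (\<sigma> i h j) = \<sigma> i (g + h) j)} = {1..d i} - ?A" by auto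
      from arg_cong[OF this, of card]
      have "card {j \<in> {1..d i}. \<not> (\<sigma> i g (\<sigma> i h j) = \<sigma> i (g + h) j)} = card {1..d i} - card ?A"
        by (subst (asm) card_Diff_subset) auto
      moreover have "card ?A \<le> card {1..d i}" by (rule card_mono) auto
      ultimately have "real (card {j \<in> {1..d i}. \<not> (\<sigma> i g (\<sigma> i h j) = \<sigma> i (g + h) j)}) =
          real (d i) - real (card ?A)" by (simp add: of_nat_diff)
      also have "\<dots> \<le> \<gamma> * real (d i)" using elim by (simp add: field_simps)
      finally show ?case by (simp add: mostly_def)
    qed
  qed
  have "\<forall>\<^sub>F i in sequentially. \<forall>p\<in>P.
      mostly \<gamma> (d i) (\<lambda>j. \<sigma> i (fst p) (\<sigma> i (snd p) j) = \<sigma> i (fst p + snd p) j)"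
    using one by (intro eventually_ball_finite assms) auto
  then show ?thesis
  proof eventually_elim
    case (elim i)
    then have "mostly (real (card P) * \<gamma>) (d i)
        (\<lambda>j. \<forall>p\<in>P. \<sigma> i (fst p) (\<sigma> i (snd p) j) = \<sigma> i (fst p + snd p) j)"
      using assms(1) by (intro mostly_ball) auto
    then show ?case by (rule mostly_mono) (use \<gamma>(2) in auto)
  qed
qed

end

text \<open>
  The maps of \<open>Map_sofic\<close> with the mean square condition replaced by closeness at most sites.
\<close>

definition almost_equivariant ::
    "'x set \<Rightarrow> ('g \<Rightarrow> 'x \<Rightarrow> 'x) \<Rightarrow> ('x \<Rightarrow> 'x \<Rightarrow> real) \<Rightarrow> 'g set \<Rightarrow> real \<Rightarrow> real \<Rightarrow>
     nat \<Rightarrow> ('g \<Rightarrow> nat \<Rightarrow> nat) \<Rightarrow> (nat \<Rightarrow> 'x) \<Rightarrow> bool" where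
  "almost_equivariant X act \<rho> F \<tau> \<beta> d \<sigma> \<phi> \<longleftrightarrow>
    \<phi> \<in> {1..d} \<rightarrow>\<^sub>E X \<and> (\<forall>g\<in>F. mostly \<beta> d (\<lambda>j. \<rho> (\<phi> (\<sigma> g j)) (act g (\<phi> j)) < \<tau>))"

locale sofic_compact_action = compact_action X act + sofic d \<sigma>
  for X :: "'x::topological_space set" and act :: "'g::group_add \<Rightarrow> 'x \<Rightarrow> 'x"
    and d and \<sigma> :: "nat \<Rightarrow> 'g \<Rightarrow> nat \<Rightarrow> nat"
begin

abbreviation "Map \<rho> F \<delta> i \<equiv> Map_sofic (top_of_set X) act \<rho> F \<delta> (d i) (\<sigma> i)"

abbreviation "separation_rate \<rho> \<epsilon> \<equiv> INF (F, \<delta>)\<in>{F. finite F} \<times> {0<..}.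
  limsup (\<lambda>i. ereal (1 / real (d i)) * enat_log (separation_number \<epsilon> (Map \<rho> F \<delta> i) (rho_inf \<rho> (d i))))"

lemma Map_D: "\<phi> \<in> Map \<rho> F \<delta> i \<Longrightarrow> j \<in> {1..d i} \<Longrightarrow> \<phi> j \<in> X"
  by (auto simp: Map_sofic_def)

lemma Map_imp_almost_equivariant:
  assumes "pseudo \<rho>" "\<phi> \<in> Map \<rho> F \<delta> i" "\<delta> \<le> \<tau> * sqrt \<beta>" "\<tau> > 0" "\<beta> > 0"
  shows "almost_equivariant X act \<rho> F \<tau> \<beta> (d i) (\<sigma> i) \<phi>"
  unfolding almost_equivariant_def
proof (intro conjI ballI)
  show "\<phi> \<in> {1..d i} \<rightarrow>\<^sub>E X" using assms(2) by (simp add: Map_sofic_def)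
  fix g assume "g \<in> F"
  then have "rho_2 \<rho> (d i) (\<phi> \<circ> \<sigma> i g) (act g \<circ> \<phi>) \<le> \<delta>"
    using assms(2) by (auto simp: Map_sofic_def intro: less_imp_le)
  then have "mostly \<beta> (d i) (\<lambda>j. \<rho> ((\<phi> \<circ> \<sigma> i g) j) ((act g \<circ> \<phi>) j) < \<tau>)"
  proof (rule mostly_if_rho_2_le)
    fix j assume "j \<in> {1..d i}"
    then show "0 \<le> \<rho> ((\<phi> \<circ> \<sigma> i g) j) ((act g \<circ> \<phi>) j)"
      using Map_D[OF assms(2)] sofic_in[of i g j] act_in pseudo_nonneg[OF assms(1)] by auto
  qed (use assms in auto)
  then show "mostly \<beta> (d i) (\<lambda>j. \<rho> (\<phi> (\<sigma> i g j)) (act g (\<phi> j)) < \<tau>)" by simp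
qed

lemma almost_equivariant_imp_Map:
  assumes "pseudo \<rho>" "\<delta> > 0"
  obtains \<tau> \<beta> where "\<tau> > 0" "\<beta> > 0"
    "\<And>F i \<phi>. almost_equivariant X act \<rho> F \<tau> \<beta> (d i) (\<sigma> i) \<phi> \<Longrightarrow> \<phi> \<in> Map \<rho> F \<delta> i"
proof -
  obtain D where D: "D > 0" "\<And>x y. x \<in> X \<Longrightarrow> y \<in> X \<Longrightarrow> \<rho> x y \<le> D"
    using pseudo_bounded[OF assms(1)] by blast
  define \<tau> \<beta> where "\<tau> = \<delta> / 4" and "\<beta> = \<delta>\<^sup>2 / (16 * D\<^sup>2)"
  show ?thesis
  proof (rule that[of \<tau> \<beta>])
    show "\<tau> > 0" "\<beta> > 0" using D(1) \<open>\<delta> > 0\<close> by (auto simp: \<tau>_def \<beta>_def)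
    fix F i \<phi> assume ae: "almost_equivariant X act \<rho> F \<tau> \<beta> (d i) (\<sigma> i) \<phi>"
    have "rho_2 \<rho> (d i) (\<phi> \<circ> \<sigma> i g) (act g \<circ> \<phi>) < \<delta>" if "g \<in> F" for g
    proof -
      have X: "(\<phi> \<circ> \<sigma> i g) j \<in> X" "(act g \<circ> \<phi>) j \<in> X" if "j \<in> {1..d i}" for j
      proof -
        have "\<phi> k \<in> X" if "k \<in> {1..d i}" for k
          using ae that by (auto simp: almost_equivariant_def)
        then show "(\<phi> \<circ> \<sigma> i g) j \<in> X" "(act g \<circ> \<phi>) j \<in> X"
          using that sofic_in[of i g j] act_in by (simp_all del: atLeastAtMost_iff)
      qed
      have "rho_2 \<rho> (d i) (\<phi> \<circ> \<sigma> i g) (act g \<circ> \<phi>) \<le> \<delta> / 2"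
      proof (rule rho_2_le_if_mostly)
        show "mostly \<beta> (d i) (\<lambda>j. \<rho> ((\<phi> \<circ> \<sigma> i g) j) ((act g \<circ> \<phi>) j) < \<tau>)"
          using ae \<open>g \<in> F\<close> by (simp add: almost_equivariant_def)
        show "\<beta> * D\<^sup>2 + \<tau>\<^sup>2 \<le> (\<delta> / 2)\<^sup>2"
          using D(1) by (simp add: \<beta>_def \<tau>_def power_divide)
      qed (use X D pseudo_nonneg[OF assms(1)] \<open>\<delta> > 0\<close> in auto)
      with \<open>\<delta> > 0\<close> show ?thesis by simp
    qed
    then show "\<phi> \<in> Map \<rho> F \<delta> i" using ae by (simp add: almost_equivariant_def Map_sofic_def)
  qed
qed

text \<open>
  Almost equivariance can be transferred from a dynamically generating pseudometric to any other
  continuous one.  To see that \<open>\<phi> (\<sigma> h j)\<close> and \<open>h \<phi> j\<close> are close for \<open>\<rho>'\<close> one compares their translates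
  by a finite window \<open>E\<close>, and \<open>g (\<phi> (\<sigma> h j))\<close>, \<open>\<phi> (\<sigma> (g + h) j)\<close>, \<open>g (h (\<phi> j))\<close> are close for \<open>\<rho>\<close> at
  the sites where \<open>\<sigma>\<close> is multiplicative.
\<close>

lemma Map_change_metric:
  assumes "pseudo \<rho>" "generating \<rho>" "pseudo \<rho>'" "finite F'" "\<tau>' > 0" "\<beta>' > 0"
  obtains F \<delta> where "finite F" "\<delta> > 0"
    "\<forall>\<^sub>F i in sequentially. \<forall>\<phi>\<in>Map \<rho> F \<delta> i. almost_equivariant X act \<rho>' F' \<tau>' \<beta>' (d i) (\<sigma> i) \<phi>"
proof -
  obtain E \<tau> where E: "finite E" "\<tau> > 0"
    "\<And>x y. x \<in> X \<Longrightarrow> y \<in> X \<Longrightarrow> (\<And>g. g \<in> E \<Longrightarrow> \<rho> (act g x) (act g y) < \<tau>) \<Longrightarrow> \<rho>' x y < \<tau>'"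
    using pseudo_finite_window[OF assms(1-3,5)] by blast
  obtain \<beta> where \<beta>: "\<beta> > 0" "(2 * real (card E) + 1) * \<beta> \<le> \<beta>'"
    using exists_small_multiple[of "2 * real (card E) + 1" \<beta>'] assms(6) by auto
  define F where "F = E \<union> (\<lambda>(g, h). g + h) ` (E \<times> F')"
  define \<delta> where "\<delta> = \<tau> / 2 * sqrt \<beta>"
  have "\<forall>\<^sub>F i in sequentially. mostly \<beta> (d i) (\<lambda>j. \<forall>(g, h)\<in>E \<times> F'. \<sigma> i g (\<sigma> i h j) = \<sigma> i (g + h) j)"
    using E(1) assms(4) \<beta>(1) by (intro sofic_multiplicative) auto
  then have "\<forall>\<^sub>F i in sequentially. \<forall>\<phi>\<in>Map \<rho> F \<delta> i.
      almost_equivariant X act \<rho>' F' \<tau>' \<beta>' (d i) (\<sigma> i) \<phi>"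
  proof eventually_elim
    case (elim i)
    show ?case
    proof
      fix \<phi> assume \<phi>: "\<phi> \<in> Map \<rho> F \<delta> i"
      have "almost_equivariant X act \<rho> F (\<tau> / 2) \<beta> (d i) (\<sigma> i) \<phi>"
        using E(2) \<beta>(1) by (intro Map_imp_almost_equivariant[OF assms(1) \<phi>]) (auto simp: \<delta>_def)
      then have ae: "\<phi> \<in> {1..d i} \<rightarrow>\<^sub>E X"
        "\<And>g. g \<in> F \<Longrightarrow> mostly \<beta> (d i) (\<lambda>j. \<rho> (\<phi> (\<sigma> i g j)) (act g (\<phi> j)) < \<tau> / 2)"
        by (auto simp: almost_equivariant_def)
      have "mostly \<beta>' (d i) (\<lambda>j. \<rho>' (\<phi> (\<sigma> i h j)) (act h (\<phi> j)) < \<tau>')" if h: "h \<in> F'" for h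
      proof -
        have "mostly (\<beta> + \<beta>) (d i) (\<lambda>j. \<rho> (\<phi> (\<sigma> i (g + h) j)) (act (g + h) (\<phi> j)) < \<tau> / 2 \<and>
            \<rho> (\<phi> (\<sigma> i g (\<sigma> i h j))) (act g (\<phi> (\<sigma> i h j))) < \<tau> / 2)" if "g \<in> E" for g
        proof (rule mostly_conj)
          show "mostly \<beta> (d i) (\<lambda>j. \<rho> (\<phi> (\<sigma> i (g + h) j)) (act (g + h) (\<phi> j)) < \<tau> / 2)"
            using that h by (intro ae(2)) (auto simp: F_def)
          show "mostly \<beta> (d i) (\<lambda>j. \<rho> (\<phi> (\<sigma> i g (\<sigma> i h j))) (act g (\<phi> (\<sigma> i h j))) < \<tau> / 2)"
            using that ae(2)[of g] by (intro mostly_permute[OF sofic_permutes]) (auto simp: F_def)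
        qed
        from mostly_conj[OF mostly_ball[OF E(1) this] elim]
        show ?thesis
        proof (rule mostly_mono)
          fix j assume j: "j \<in> {1..d i}"
            and *: "(\<forall>g\<in>E. \<rho> (\<phi> (\<sigma> i (g + h) j)) (act (g + h) (\<phi> j)) < \<tau> / 2 \<and>
                \<rho> (\<phi> (\<sigma> i g (\<sigma> i h j))) (act g (\<phi> (\<sigma> i h j))) < \<tau> / 2) \<and>
              (\<forall>(g, h)\<in>E \<times> F'. \<sigma> i g (\<sigma> i h j) = \<sigma> i (g + h) j)"
          have X: "\<phi> k \<in> X" if "k \<in> {1..d i}" for k using ae(1) that by auto
          have hj: "\<sigma> i h j \<in> {1..d i}" using j sofic_in by blast
          show "\<rho>' (\<phi> (\<sigma> i h j)) (act h (\<phi> j)) < \<tau>'"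
          proof (rule E(3))
            fix g assume g: "g \<in> E"
            let ?a = "act g (\<phi> (\<sigma> i h j))" and ?b = "\<phi> (\<sigma> i (g + h) j)" and ?c = "act g (act h (\<phi> j))"
            have in_X: "?a \<in> X" "?b \<in> X" "?c \<in> X"
              using X hj j sofic_in act_in by auto
            have "\<rho> ?b ?c < \<tau> / 2" using * g X[OF j] by (simp add: act_add)
            moreover have "\<rho> ?b ?a < \<tau> / 2" using * g h by auto
            ultimately show "\<rho> ?a ?c < \<tau>"
              using pseudo_triangle[OF assms(1) in_X] pseudo_commute[OF assms(1) in_X(1,2)] by simp
          qed (use X hj j act_in in auto)
        qed (use \<beta>(2) in \<open>auto simp: algebra_simps\<close>)
      qed
      with ae(1) show "almost_equivariant X act \<rho>' F' \<tau>' \<beta>' (d i) (\<sigma> i) \<phi>"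
        by (simp add: almost_equivariant_def)
    qed
  qed
  moreover have "finite F" using E(1) assms(4) by (simp add: F_def)
  moreover have "\<delta> > 0" using E(2) \<beta>(1) by (simp add: \<delta>_def)
  ultimately show ?thesis using that by blast
qed

end

section \<open>Exponential growth rates of covering and separation numbers\<close>

lemma enat_log_le:
  assumes "n \<le> enat k" "real k \<le> exp y"
  shows "enat_log n \<le> ereal y"
proof -
  obtain m where m: "n = enat m" "m \<le> k" using assms(1) by (cases n) auto
  show ?thesis
  proof (cases "m = 0")
    case False
    then have "ln (real m) \<le> ln (exp y)" using m assms(2) by (subst ln_le_cancel_iff) auto
    then show ?thesis using False by (simp add: enat_log_def m(1))
  qed (simp add: enat_log_def m(1))
qed

lemma enat_log_ge:
  assumes "enat k \<le> n" "1 \<le> k"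
  shows "ereal (ln (real k)) \<le> enat_log n"
  using assms by (cases n) (auto simp: enat_log_def)

definition separated :: "real \<Rightarrow> ('y \<Rightarrow> 'y \<Rightarrow> real) \<Rightarrow> 'y set \<Rightarrow> bool" where
  "separated \<epsilon> \<theta> A \<longleftrightarrow> finite A \<and> (\<forall>a\<in>A. \<forall>b\<in>A. a \<noteq> b \<longrightarrow> \<theta> a b > \<epsilon>)"

lemma enat_log_separation_le:
  assumes "\<And>A. A \<subseteq> Y \<Longrightarrow> separated \<epsilon> \<theta> A \<Longrightarrow> real (card A) \<le> exp y"
  shows "enat_log (separation_number \<epsilon> Y \<theta>) \<le> ereal y"
proof (rule enat_log_le)
  show "separation_number \<epsilon> Y \<theta> \<le> enat (nat \<lfloor>exp y\<rfloor>)"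
    unfolding separation_number_def
  proof (rule SUP_least)
    fix A assume "A \<in> {A. finite A \<and> A \<subseteq> Y \<and> (\<forall>a\<in>A. \<forall>b\<in>A. a \<noteq> b \<longrightarrow> \<theta> a b > \<epsilon>)}"
    then have "real (card A) \<le> exp y" by (intro assms) (auto simp: separated_def)
    then show "enat (card A) \<le> enat (nat \<lfloor>exp y\<rfloor>)" by (simp add: le_nat_floor)
  qed
  show "real (nat \<lfloor>exp y\<rfloor>) \<le> exp y" by (simp add: of_nat_floor)
qed

lemma enat_log_separation_ge:
  assumes "A \<subseteq> Y" "separated \<epsilon> \<theta> A" "1 \<le> k" "k \<le> card A"
  shows "ereal (ln (real k)) \<le> enat_log (separation_number \<epsilon> Y \<theta>)"
proof (rule enat_log_ge)
  have "enat (card A) \<le> separation_number \<epsilon> Y \<theta>"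
    unfolding separation_number_def using assms(1,2) by (intro SUP_upper) (auto simp: separated_def)
  with assms(4) show "enat k \<le> separation_number \<epsilon> Y \<theta>"
    by (meson enat_ord_simps(1) order_trans)
qed fact

text \<open>
  A separated set of largest size is a cover.
\<close>

lemma enat_log_covering_le:
  assumes bound: "\<And>A. A \<subseteq> Y \<Longrightarrow> separated \<epsilon> \<theta> A \<Longrightarrow> real (card A) \<le> exp y"
    and refl: "\<And>a. a \<in> Y \<Longrightarrow> \<theta> a a \<le> \<epsilon>"
    and sym: "\<And>a b. a \<in> Y \<Longrightarrow> b \<in> Y \<Longrightarrow> \<theta> a b = \<theta> b a"
  shows "enat_log (covering_number \<epsilon> Y \<theta>) \<le> ereal y"
proof -
  let ?sep = "\<lambda>A. A \<subseteq> Y \<and> separated \<epsilon> \<theta> A"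
  have "?sep {}" by (simp add: separated_def)
  moreover have "\<forall>A. ?sep A \<longrightarrow> card A < Suc (nat \<lfloor>exp y\<rfloor>)"
    using bound by (auto simp: less_Suc_eq_le intro: le_nat_floor)
  ultimately have "\<exists>A. ?sep A \<and> (\<forall>B. ?sep B \<longrightarrow> card B \<le> card A)"
    by (rule Lattices_Big.ex_has_greatest_nat)
  then obtain A where A: "?sep A" and max: "\<And>B. ?sep B \<Longrightarrow> card B \<le> card A"
    by meson
  have "\<exists>a\<in>A. \<theta> b a \<le> \<epsilon>" if b: "b \<in> Y" for b
  proof (rule ccontr)
    assume none: "\<not> (\<exists>a\<in>A. \<theta> b a \<le> \<epsilon>)"
    then have "b \<notin> A" using refl[OF b] by auto
    have "?sep (insert b A)"
    proof
      have far: "\<theta> b a > \<epsilon>" "\<theta> a b > \<epsilon>" if "a \<in> A" for a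
      proof -
        show "\<theta> b a > \<epsilon>" using none that by (simp add: not_le)
        then show "\<theta> a b > \<epsilon>" using sym[OF b, of a] A that by auto
      qed
      show "insert b A \<subseteq> Y" using A b by blast
      show "separated \<epsilon> \<theta> (insert b A)" using A far by (simp add: separated_def)
    qed
    from max[OF this] show False using A \<open>b \<notin> A\<close> by (simp add: separated_def)
  qed
  then have "covering_number \<epsilon> Y \<theta> \<le> enat (card A)"
    unfolding covering_number_def using A by (intro INF_lower) (auto simp: separated_def)
  moreover have "real (card A) \<le> exp y" using bound A by blast
  ultimately show ?thesis by (rule enat_log_le)
qed

text \<open>
  If the rate is finite, the infimum defining the covering number is attained.
\<close>

lemma covering_of_small_rate:
  assumes "ereal (1 / real d) * enat_log (covering_number \<epsilon> Y \<theta>) < ereal H" "d > 0"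
  obtains A where "finite A" "A \<subseteq> Y" "\<And>y. y \<in> Y \<Longrightarrow> \<exists>a\<in>A. \<theta> y a \<le> \<epsilon>" "real (card A) \<le> exp (H * real d)"
proof -
  obtain k where k: "covering_number \<epsilon> Y \<theta> = enat k"
    using assms by (cases "covering_number \<epsilon> Y \<theta>") (auto simp: enat_log_def)
  then have "(INF A\<in>{A. finite A \<and> A \<subseteq> Y \<and> (\<forall>y\<in>Y. \<exists>a\<in>A. \<theta> y a \<le> \<epsilon>)}. enat (card A)) < enat (Suc k)"
    unfolding covering_number_def by simp
  then obtain A where A: "finite A" "A \<subseteq> Y" "\<forall>y\<in>Y. \<exists>a\<in>A. \<theta> y a \<le> \<epsilon>" "card A < Suc k"
    unfolding INF_less_iff by auto
  have "real k \<le> exp (H * real d)"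
  proof (cases "k = 0")
    case False
    then have "ln (real k) / real d < H" using assms k by (simp add: enat_log_def)
    then have "ln (real k) \<le> H * real d" using \<open>d > 0\<close> by (simp add: field_simps)
    then have "exp (ln (real k)) \<le> exp (H * real d)" by simp
    then show ?thesis using False by simp
  qed simp
  with A show ?thesis by (intro that[of A]) auto
qed

lemma limsup_rate_le:
  assumes "\<forall>\<^sub>F i in sequentially. 0 < d i"
    and "\<forall>\<^sub>F i in sequentially. enat_log (N i) \<le> ereal (H * real (d i))"
  shows "limsup (\<lambda>i. ereal (1 / real (d i)) * enat_log (N i)) \<le> ereal H"
proof (rule Limsup_bounded)
  show "\<forall>\<^sub>F i in sequentially. ereal (1 / real (d i)) * enat_log (N i) \<le> ereal H"
    using assms
  proof eventually_elim
    case (elim i)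
    have "ereal (1 / real (d i)) * enat_log (N i) \<le> ereal (1 / real (d i)) * ereal (H * real (d i))"
      using elim(2) by (intro ereal_mult_left_mono) auto
    also have "\<dots> = ereal H" using elim(1) by simp
    finally show ?case .
  qed
qed

text \<open>
  Functions with values in \<open>G\<close> outside an exceptional set of at most \<open>b\<close> points, where they have
  values in \<open>H\<close>.  There are at most \<open>2 ^ card J\<close> exceptional sets; this crude bound is harmless since
  only the existence of an exponential rate matters.  What matters is that the size of \<open>H\<close>
  contributes only through \<open>b\<close>.
\<close>

lemma count_with_few_exceptions:
  fixes J :: "'j set" and G H :: "'v set"
  assumes fin: "finite J" "finite G" "finite H" and K: "card G \<le> K1" "card H \<le> K2" "1 \<le> K1" "1 \<le> K2"
    and C: "C \<subseteq> {f \<in> J \<rightarrow>\<^sub>E (G \<union> H). real (card {j \<in> J. f j \<notin> G}) \<le> b}"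
  shows "finite C" "real (card C) \<le> exp (real (card J) * ln (2 * real K1) + b * ln (real K2))"
proof -
  define \<B> where "\<B> = {B. B \<subseteq> J \<and> real (card B) \<le> b}"
  define P where "P B = (\<Pi>\<^sub>E j\<in>J. if j \<in> B then H else G)" for B
  have \<B>: "finite \<B>" "card \<B> \<le> 2 ^ card J"
  proof -
    have sub: "\<B> \<subseteq> Pow J" by (auto simp: \<B>_def)
    then show "finite \<B>" using fin(1) by (meson finite_Pow_iff finite_subset)
    show "card \<B> \<le> 2 ^ card J" using card_mono[OF _ sub] fin(1) by (simp add: card_Pow)
  qed
  have P_fin: "finite (P B)" for B using fin by (auto simp: P_def intro!: finite_PiE)
  have P_card: "real (card (P B)) \<le> real K1 ^ card J * exp (b * ln (real K2))" if B: "B \<in> \<B>" for B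
  proof -
    have BJ: "B \<subseteq> J" "finite B" using B fin(1) by (auto simp: \<B>_def intro: finite_subset)
    have "card (P B) = (\<Prod>j\<in>J. if j \<in> B then card H else card G)"
      using fin(1) by (simp add: P_def card_PiE if_distrib)
    also have "\<dots> \<le> (\<Prod>j\<in>J. K1 * (if j \<in> B then K2 else 1))"
    proof (rule prod_mono)
      fix j assume "j \<in> J"
      have "card H \<le> K1 * K2" using mult_le_mono[OF K(3) K(2)] by simp
      then show "0 \<le> (if j \<in> B then card H else card G) \<and>
          (if j \<in> B then card H else card G) \<le> K1 * (if j \<in> B then K2 else 1)"
        using K by auto
    qed
    also have "\<dots> = K1 ^ card J * K2 ^ card B"
    proof -
      have "J \<inter> B = B" using BJ by auto
      then show ?thesis using fin(1) by (simp add: prod.distrib prod.If_cases)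
    qed
    finally have "real (card (P B)) \<le> real (K1 ^ card J * K2 ^ card B)" by (rule of_nat_mono)
    also have "\<dots> = real K1 ^ card J * real K2 ^ card B" by simp
    also have "real K2 ^ card B = exp (real (card B) * ln (real K2))"
      using K(4) by (simp add: exp_of_nat_mult)
    also have "\<dots> \<le> exp (b * ln (real K2))"
      using B K(4) by (auto simp: \<B>_def intro!: mult_right_mono)
    finally show ?thesis using K(3) by (simp add: mult_left_mono)
  qed
  have sub: "C \<subseteq> (\<Union>B\<in>\<B>. P B)"
  proof
    fix f assume "f \<in> C"
    then have f: "f \<in> J \<rightarrow>\<^sub>E (G \<union> H)" "real (card {j \<in> J. f j \<notin> G}) \<le> b" using C by auto
    then have "f \<in> P {j \<in> J. f j \<notin> G}"
      unfolding P_def by (intro PiE_I) (auto dest: PiE_mem PiE_arb)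
    moreover have "{j \<in> J. f j \<notin> G} \<in> \<B>" using f(2) by (simp add: \<B>_def)
    ultimately show "f \<in> (\<Union>B\<in>\<B>. P B)" by (rule UN_I[rotated])
  qed
  have fin_U: "finite (\<Union>B\<in>\<B>. P B)" using \<B>(1) P_fin by auto
  with sub show "finite C" by (rule finite_subset)
  have "real (card C) \<le> real (card (\<Union>B\<in>\<B>. P B))" using card_mono[OF fin_U sub] by simp
  also have "\<dots> \<le> real (\<Sum>B\<in>\<B>. card (P B))"
    by (rule of_nat_mono) (rule card_UN_le[OF \<B>(1)])
  also have "\<dots> = (\<Sum>B\<in>\<B>. real (card (P B)))" by simp
  also have "\<dots> \<le> (\<Sum>B\<in>\<B>. real K1 ^ card J * exp (b * ln (real K2)))"
    using P_card by (intro sum_mono) auto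
  also have "\<dots> = real (card \<B>) * (real K1 ^ card J * exp (b * ln (real K2)))" by simp
  also have "\<dots> \<le> 2 ^ card J * (real K1 ^ card J * exp (b * ln (real K2)))"
  proof (rule mult_right_mono)
    have "real (card \<B>) \<le> real (2 ^ card J)" using \<B>(2) by (rule of_nat_mono)
    then show "real (card \<B>) \<le> 2 ^ card J" by simp
  qed auto
  also have "\<dots> = (2 * real K1) ^ card J * exp (b * ln (real K2))" by (simp add: power_mult_distrib)
  also have "(2 * real K1) ^ card J = exp (real (card J) * ln (2 * real K1))"
    using K(3) by (simp add: exp_of_nat_mult)
  finally show "real (card C) \<le> exp (real (card J) * ln (2 * real K1) + b * ln (real K2))"
    by (simp add: exp_add)
qed

section \<open>Finite entropy forces metric mean dimension zero\<close>

lemma almost_equivariant_mono: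
  assumes "almost_equivariant X act \<rho> F \<tau> \<beta> d \<sigma> \<phi>" "F' \<subseteq> F" "\<tau> \<le> \<tau>'" "\<beta> \<le> \<beta>'"
  shows "almost_equivariant X act \<rho> F' \<tau>' \<beta>' d \<sigma> \<phi>"
  unfolding almost_equivariant_def
proof (intro conjI ballI)
  show "\<phi> \<in> {1..d} \<rightarrow>\<^sub>E X" using assms(1) by (simp add: almost_equivariant_def)
  fix g assume "g \<in> F'"
  then have "mostly \<beta> d (\<lambda>j. \<rho> (\<phi> (\<sigma> g j)) (act g (\<phi> j)) < \<tau>)"
    using assms(1,2) by (auto simp: almost_equivariant_def)
  then show "mostly \<beta>' d (\<lambda>j. \<rho> (\<phi> (\<sigma> g j)) (act g (\<phi> j)) < \<tau>')"
    by (rule mostly_mono) (use assms in auto)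
qed

context sofic_compact_action
begin

text \<open>
  The separation rate for the supremum metric is at most the entropy plus a constant that does not
  depend on \<open>\<epsilon>\<close>.  A map is encoded by a centre of a mean square cover, by the sites where it is not
  close to the map \<open>s\<close> chosen for this centre, and by labels at these exceptional sites.  Their
  proportion \<open>\<beta>\<close> is chosen after the number \<open>m\<close> of labels, so that the labels contribute at most \<open>1\<close>
  to the rate; the choice of the exceptional set contributes at most \<open>ln 2\<close>.
\<close>

lemma finite_entropy_imp_separation_rate:
  assumes \<rho>0: "pseudo \<rho>0" "generating \<rho>0"
    and H: "sofic_entropy_wrt d \<sigma> (top_of_set X) act \<rho>0 < ereal H"
    and \<rho>: "pseudo \<rho>" "generating \<rho>" and "\<epsilon> > 0"
  obtains F \<delta> where "finite F" "\<delta> > 0"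
    "\<forall>\<^sub>F i in sequentially. enat_log (separation_number \<epsilon> (Map \<rho> F \<delta> i) (rho_inf \<rho> (d i)))
      \<le> ereal ((H + 2) * real (d i))"
proof -
  obtain E \<tau> where E: "finite E" "\<tau> > 0"
    "\<And>x y. x \<in> X \<Longrightarrow> y \<in> X \<Longrightarrow> (\<And>g. g \<in> E \<Longrightarrow> \<rho>0 (act g x) (act g y) < \<tau>) \<Longrightarrow> \<rho> x y < \<epsilon> / 2"
    using pseudo_finite_window[OF \<rho>0 \<rho>(1), of "\<epsilon> / 2"] \<open>\<epsilon> > 0\<close> by auto
  obtain lab :: "'x \<Rightarrow> nat" and m where lab: "lab ` X \<subseteq> {..<m}"
    "\<And>x y. x \<in> X \<Longrightarrow> y \<in> X \<Longrightarrow> lab x = lab y \<Longrightarrow> \<rho> x y \<le> \<epsilon>"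
    by (rule pseudo_finite_partition[OF \<rho>(1) \<open>\<epsilon> > 0\<close>]) (erule that)
  obtain \<beta> where \<beta>: "\<beta> > 0" "ln (real (Suc m)) * \<beta> \<le> 1"
    using exists_small_multiple[of "ln (real (Suc m))" 1] by auto
  obtain \<gamma> where \<gamma>: "\<gamma> > 0" "4 * real (card E) * \<gamma> \<le> \<beta>"
    using exists_small_multiple[of "4 * real (card E)" \<beta>] \<beta>(1) by auto
  define \<epsilon>0 where "\<epsilon>0 = \<tau> / 4 * sqrt \<gamma>"
  have "\<epsilon>0 > 0" using E(2) \<gamma>(1) by (simp add: \<epsilon>0_def)
  then have "(INF (F, \<delta>)\<in>{F. finite F} \<times> {0<..}. limsup (\<lambda>i. ereal (1 / real (d i)) *
      enat_log (covering_number \<epsilon>0 (Map \<rho>0 F \<delta> i) (rho_2 \<rho>0 (d i))))) < ereal H"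
    using H unfolding sofic_entropy_wrt_def by (meson SUP_upper greaterThan_iff order_le_less_trans)
  then obtain F1 \<delta>1 where F1: "finite F1" "\<delta>1 > 0"
    "limsup (\<lambda>i. ereal (1 / real (d i)) *
      enat_log (covering_number \<epsilon>0 (Map \<rho>0 F1 \<delta>1 i) (rho_2 \<rho>0 (d i)))) < ereal H"
    unfolding INF_less_iff by auto
  obtain \<tau>1 \<beta>1 where \<tau>1: "\<tau>1 > 0" "\<beta>1 > 0"
    "\<And>F i \<phi>. almost_equivariant X act \<rho>0 F \<tau>1 \<beta>1 (d i) (\<sigma> i) \<phi> \<Longrightarrow> \<phi> \<in> Map \<rho>0 F \<delta>1 i"
    by (rule almost_equivariant_imp_Map[OF \<rho>0(1) F1(2)]) (erule (1) that)
  obtain F \<delta> where F: "finite F" "\<delta> > 0"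
    "\<forall>\<^sub>F i in sequentially. \<forall>\<phi>\<in>Map \<rho> F \<delta> i.
      almost_equivariant X act \<rho>0 (F1 \<union> E) (min \<tau>1 (\<tau> / 4)) (min \<beta>1 \<gamma>) (d i) (\<sigma> i) \<phi>"
    using Map_change_metric[OF \<rho> \<rho>0(1), of "F1 \<union> E" "min \<tau>1 (\<tau> / 4)" "min \<beta>1 \<gamma>"]
      F1(1) E(1,2) \<tau>1(1,2) \<gamma>(1) by auto
  have "\<forall>\<^sub>F i in sequentially. enat_log (separation_number \<epsilon> (Map \<rho> F \<delta> i) (rho_inf \<rho> (d i)))
      \<le> ereal ((H + 2) * real (d i))"
    using F(3) Limsup_lessD[OF F1(3)] sofic_d_pos
  proof eventually_elim
    case (elim i)
    obtain A where A: "finite A" "A \<subseteq> Map \<rho>0 F1 \<delta>1 i" "real (card A) \<le> exp (H * real (d i))"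
      "\<And>\<phi>. \<phi> \<in> Map \<rho>0 F1 \<delta>1 i \<Longrightarrow> \<exists>\<alpha>\<in>A. rho_2 \<rho>0 (d i) \<phi> \<alpha> \<le> \<epsilon>0"
      using covering_of_small_rate[OF elim(2,3)] by metis
    show ?case
    proof (rule enat_log_separation_le)
      fix \<Phi> assume \<Phi>: "\<Phi> \<subseteq> Map \<rho> F \<delta> i" and sep: "separated \<epsilon> (rho_inf \<rho> (d i)) \<Phi>"
      then have fin\<Phi>: "finite \<Phi>" by (simp add: separated_def)
      have ae: "almost_equivariant X act \<rho>0 E (\<tau> / 4) \<gamma> (d i) (\<sigma> i) \<phi>"
        "\<phi> \<in> Map \<rho>0 F1 \<delta>1 i" if "\<phi> \<in> \<Phi>" for \<phi>
      proof -
        have *: "almost_equivariant X act \<rho>0 (F1 \<union> E) (min \<tau>1 (\<tau> / 4)) (min \<beta>1 \<gamma>) (d i) (\<sigma> i) \<phi>"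
          using elim(1) \<Phi> that by blast
        show "almost_equivariant X act \<rho>0 E (\<tau> / 4) \<gamma> (d i) (\<sigma> i) \<phi>"
          by (rule almost_equivariant_mono[OF *]) auto
        show "\<phi> \<in> Map \<rho>0 F1 \<delta>1 i"
          by (intro \<tau>1(3) almost_equivariant_mono[OF *]) auto
      qed
      have X: "\<phi> j \<in> X" if "\<phi> \<in> \<Phi>" "j \<in> {1..d i}" for \<phi> j
        using Map_D[of \<phi> \<rho> F \<delta> i j] \<Phi> that by auto
      have "\<forall>\<phi>\<in>\<Phi>. \<exists>\<alpha>. \<alpha> \<in> A \<and> rho_2 \<rho>0 (d i) \<phi> \<alpha> \<le> \<epsilon>0"
        using ae(2) A(4) by blast
      then obtain c where c: "\<And>\<phi>. \<phi> \<in> \<Phi> \<Longrightarrow> c \<phi> \<in> A" "\<And>\<phi>. \<phi> \<in> \<Phi> \<Longrightarrow> rho_2 \<rho>0 (d i) \<phi> (c \<phi>) \<le> \<epsilon>0"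
        by metis
      have "\<exists>s. \<forall>\<alpha>\<in>c ` \<Phi>. s \<alpha> \<in> \<Phi> \<and> c (s \<alpha>) = \<alpha>" by (rule bchoice) auto
      then obtain s where s: "\<And>\<phi>. \<phi> \<in> \<Phi> \<Longrightarrow> s (c \<phi>) \<in> \<Phi>" "\<And>\<phi>. \<phi> \<in> \<Phi> \<Longrightarrow> c (s (c \<phi>)) = c \<phi>"
        by blast
      \<comment> \<open>Two maps with the same centre are close for \<open>\<rho>0\<close> at most sites; almost equivariance moves this
        closeness along the window \<open>E\<close>, which gives closeness for \<open>\<rho>\<close>.\<close>
      have close: "mostly \<beta> (d i) (\<lambda>j. \<rho> (\<phi> j) (\<psi> j) < \<epsilon> / 2)"
        if \<phi>: "\<phi> \<in> \<Phi>" and \<psi>: "\<psi> \<in> \<Phi>" and same: "c \<phi> = c \<psi>" for \<phi> \<psi>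
      proof -
        have AX: "c \<phi> j \<in> X" if "j \<in> {1..d i}" for j
          using c(1)[OF \<phi>] A(2) Map_D[of "c \<phi>" \<rho>0 F1 \<delta>1 i j] that by auto
        have near: "mostly \<gamma> (d i) (\<lambda>j. \<rho>0 (\<xi> j) (c \<phi> j) < \<tau> / 4)" if \<xi>: "\<xi> \<in> \<Phi>" "c \<xi> = c \<phi>" for \<xi>
          using c(2)[OF \<xi>(1)] E(2) \<gamma>(1) X[OF \<xi>(1)] AX pseudo_nonneg[OF \<rho>0(1)]
          by (intro mostly_if_rho_2_le[where \<delta> = \<epsilon>0]) (auto simp: \<xi>(2) \<epsilon>0_def)
        have eq: "mostly \<gamma> (d i) (\<lambda>j. \<rho>0 (\<xi> (\<sigma> i g j)) (act g (\<xi> j)) < \<tau> / 4)"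
          if "\<xi> \<in> \<Phi>" "g \<in> E" for \<xi> g
          using ae(1)[OF that(1)] that(2) by (auto simp: almost_equivariant_def)
        have "mostly (\<gamma> + \<gamma> + (\<gamma> + \<gamma>)) (d i) (\<lambda>j.
            (\<rho>0 (\<phi> (\<sigma> i g j)) (act g (\<phi> j)) < \<tau> / 4 \<and> \<rho>0 (\<psi> (\<sigma> i g j)) (act g (\<psi> j)) < \<tau> / 4) \<and>
            (\<rho>0 (\<phi> (\<sigma> i g j)) (c \<phi> (\<sigma> i g j)) < \<tau> / 4 \<and> \<rho>0 (\<psi> (\<sigma> i g j)) (c \<phi> (\<sigma> i g j)) < \<tau> / 4))"
          if "g \<in> E" for g
        proof (intro mostly_conj)
          show "mostly \<gamma> (d i) (\<lambda>j. \<rho>0 (\<phi> (\<sigma> i g j)) (c \<phi> (\<sigma> i g j)) < \<tau> / 4)"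
            by (rule mostly_permute[OF sofic_permutes near[OF \<phi> refl]])
          show "mostly \<gamma> (d i) (\<lambda>j. \<rho>0 (\<psi> (\<sigma> i g j)) (c \<phi> (\<sigma> i g j)) < \<tau> / 4)"
            by (rule mostly_permute[OF sofic_permutes near[OF \<psi> same[symmetric]]])
        qed (use that \<phi> \<psi> eq in auto)
        from mostly_ball[OF E(1) this] show ?thesis
        proof (rule mostly_mono)
          fix j assume j: "j \<in> {1..d i}" and *: "\<forall>g\<in>E.
            (\<rho>0 (\<phi> (\<sigma> i g j)) (act g (\<phi> j)) < \<tau> / 4 \<and> \<rho>0 (\<psi> (\<sigma> i g j)) (act g (\<psi> j)) < \<tau> / 4) \<and>
            (\<rho>0 (\<phi> (\<sigma> i g j)) (c \<phi> (\<sigma> i g j)) < \<tau> / 4 \<and> \<rho>0 (\<psi> (\<sigma> i g j)) (c \<phi> (\<sigma> i g j)) < \<tau> / 4)"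
          show "\<rho> (\<phi> j) (\<psi> j) < \<epsilon> / 2"
          proof (rule E(3))
            fix g assume g: "g \<in> E"
            have gj: "\<sigma> i g j \<in> {1..d i}" using j sofic_in by blast
            let ?a = "act g (\<phi> j)" and ?b = "\<phi> (\<sigma> i g j)" and ?c = "c \<phi> (\<sigma> i g j)"
              and ?d = "\<psi> (\<sigma> i g j)" and ?e = "act g (\<psi> j)"
            have in_X: "?a \<in> X" "?b \<in> X" "?c \<in> X" "?d \<in> X" "?e \<in> X"
              using X[OF \<phi>] X[OF \<psi>] AX act_in j gj by auto
            note tri = pseudo_triangle[OF \<rho>0(1)] and comm = pseudo_commute[OF \<rho>0(1)]
            have "\<rho>0 ?a ?e \<le> \<rho>0 ?b ?a + \<rho>0 ?b ?c + \<rho>0 ?d ?c + \<rho>0 ?d ?e"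
              using tri[of ?a ?b ?e] tri[of ?b ?c ?e] tri[of ?c ?d ?e] comm[of ?a ?b] comm[of ?c ?d] in_X
              by linarith
            then show "\<rho>0 ?a ?e < \<tau>" using * g by fastforce
          qed (use X \<phi> \<psi> j in auto)
        qed (use \<gamma>(2) in \<open>auto simp: algebra_simps\<close>)
      qed
      define code where "code \<phi> = (\<lambda>j\<in>{1..d i}.
        if \<rho> (\<phi> j) (s (c \<phi>) j) < \<epsilon> / 2 then None else Some (lab (\<phi> j)))" for \<phi>
      have inj: "inj_on (\<lambda>\<phi>. (c \<phi>, code \<phi>)) \<Phi>"
      proof (rule inj_onI, rule ccontr)
        fix \<phi> \<psi> assume \<phi>: "\<phi> \<in> \<Phi>" and \<psi>: "\<psi> \<in> \<Phi>" and eq: "(c \<phi>, code \<phi>) = (c \<psi>, code \<psi>)" and "\<phi> \<noteq> \<psi>"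
        have "\<rho> (\<phi> j) (\<psi> j) \<le> \<epsilon>" if j: "j \<in> {1..d i}" for j
        proof -
          have code: "code \<phi> j = code \<psi> j" using eq by simp
          let ?r = "s (c \<phi>) j"
          have r: "?r \<in> X" using X[OF s(1)[OF \<phi>] j] .
          show ?thesis
          proof (cases "\<rho> (\<phi> j) ?r < \<epsilon> / 2")
            case True
            then have "\<rho> (\<psi> j) ?r < \<epsilon> / 2" using code eq j by (auto simp: code_def split: if_splits)
            then show ?thesis
              using True pseudo_triangle[OF \<rho>(1) X[OF \<phi> j] r X[OF \<psi> j]]
                pseudo_commute[OF \<rho>(1) r X[OF \<psi> j]] by linarith
          next
            case False
            then have "lab (\<phi> j) = lab (\<psi> j)" using code eq j by (auto simp: code_def split: if_splits)
            then show ?thesis using lab(2) X \<phi> \<psi> j by blast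
          qed
        qed
        then have "rho_inf \<rho> (d i) \<phi> \<psi> \<le> \<epsilon>"
          using elim(3) unfolding rho_inf_def by (subst Max_le_iff) auto
        with sep \<phi> \<psi> \<open>\<phi> \<noteq> \<psi>\<close> show False by (fastforce simp: separated_def)
      qed
      have codes: "code ` \<Phi> \<subseteq> {f \<in> {1..d i} \<rightarrow>\<^sub>E ({None} \<union> Some ` {..<m}).
          real (card {j \<in> {1..d i}. f j \<notin> {None}}) \<le> \<beta> * real (d i)}"
      proof (rule image_subsetI, rule CollectI, rule conjI)
        fix \<phi> assume \<phi>: "\<phi> \<in> \<Phi>"
        show "code \<phi> \<in> {1..d i} \<rightarrow>\<^sub>E ({None} \<union> Some ` {..<m})"
          unfolding code_def using lab(1) X[OF \<phi>] by (intro PiE_I) (auto split: if_splits)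
        have "{j \<in> {1..d i}. code \<phi> j \<notin> {None}} = {j \<in> {1..d i}. \<not> \<rho> (\<phi> j) (s (c \<phi>) j) < \<epsilon> / 2}"
          by (auto simp: code_def)
        then show "real (card {j \<in> {1..d i}. code \<phi> j \<notin> {None}}) \<le> \<beta> * real (d i)"
          using close[OF \<phi> s(1)[OF \<phi>]] s(2)[OF \<phi>] by (simp add: mostly_def)
      qed
      have "card (Some ` {..<m}) \<le> Suc m" by (simp add: card_image)
      note count = count_with_few_exceptions[OF _ _ _ _ this _ _ codes, of 1]
      have "real (card \<Phi>) = real (card ((\<lambda>\<phi>. (c \<phi>, code \<phi>)) ` \<Phi>))" using card_image[OF inj] by simp
      also have "\<dots> \<le> real (card (A \<times> code ` \<Phi>))"
        using A(1) fin\<Phi> c(1) by (intro of_nat_mono card_mono) auto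
      also have "\<dots> = real (card A) * real (card (code ` \<Phi>))" by (simp add: card_cartesian_product)
      also have "\<dots> \<le> exp (H * real (d i)) *
          exp (real (d i) * ln 2 + \<beta> * real (d i) * ln (real (Suc m)))"
        using A(3) count(2) by (intro mult_mono) auto
      also have "\<dots> = exp (H * real (d i) + real (d i) * ln 2 + (ln (real (Suc m)) * \<beta>) * real (d i))"
        by (simp add: exp_add algebra_simps)
      also have "\<dots> \<le> exp ((H + 2) * real (d i))"
      proof -
        have "real (d i) * ln 2 \<le> real (d i) * 1" using ln_2_less_1 by (intro mult_left_mono) auto
        moreover have "(ln (real (Suc m)) * \<beta>) * real (d i) \<le> 1 * real (d i)"
          using \<beta>(2) by (intro mult_right_mono) auto
        ultimately show ?thesis by (simp add: algebra_simps)
      qed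
      finally show "real (card \<Phi>) \<le> exp ((H + 2) * real (d i))" .
    qed
  qed
  with F(1,2) show ?thesis by (rule that)
qed

lemma tendsto_const_over_abs_ln:
  assumes "0 \<le> (C::real)"
  shows "((\<lambda>\<epsilon>. ereal (C / \<bar>ln \<epsilon>\<bar>)) \<longlongrightarrow> 0) (at_right 0)"
proof -
  have "((\<lambda>\<epsilon>::real. C / ln \<epsilon>) \<longlongrightarrow> 0) (at_right 0)"
    by (intro tendsto_divide_0[OF tendsto_const] filterlim_at_bot_imp_at_infinity ln_at_0)
  then have "((\<lambda>\<epsilon>::real. \<bar>C / ln \<epsilon>\<bar>) \<longlongrightarrow> 0) (at_right 0)" by (rule tendsto_rabs_zero)
  then have "((\<lambda>\<epsilon>. C / \<bar>ln \<epsilon>\<bar>) \<longlongrightarrow> 0) (at_right 0)" using assms by (simp add: abs_divide)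
  then show ?thesis by (simp add: zero_ereal_def)
qed

lemma finite_entropy_imp_mdim_le_0:
  assumes \<rho>0: "pseudo \<rho>0" "generating \<rho>0"
    and fin: "sofic_entropy_wrt d \<sigma> (top_of_set X) act \<rho>0 < \<infinity>"
    and \<rho>: "pseudo \<rho>" "generating \<rho>"
  shows "metric_mean_dimension_wrt d \<sigma> (top_of_set X) act \<rho> \<le> 0"
proof -
  obtain H :: nat where H: "sofic_entropy_wrt d \<sigma> (top_of_set X) act \<rho>0 < ereal (real H)"
    using less_PInf_Ex_of_nat[of "sofic_entropy_wrt d \<sigma> (top_of_set X) act \<rho>0"] fin by auto
  have "metric_mean_dimension_wrt d \<sigma> (top_of_set X) act \<rho> \<le>
      Liminf (at_right 0) (\<lambda>\<epsilon>. ereal ((real H + 2) / \<bar>ln \<epsilon>\<bar>))"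
    unfolding metric_mean_dimension_wrt_def
  proof (rule Liminf_mono)
    show "\<forall>\<^sub>F \<epsilon> in at_right 0. ereal (1 / \<bar>ln \<epsilon>\<bar>) *
      separation_rate \<rho> \<epsilon> \<le> ereal ((real H + 2) / \<bar>ln \<epsilon>\<bar>)"
      using eventually_at_right_less[of "0::real"]
    proof eventually_elim
      case (elim \<epsilon>)
      obtain F \<delta> where F: "finite F" "\<delta> > 0"
        "\<forall>\<^sub>F i in sequentially. enat_log (separation_number \<epsilon> (Map \<rho> F \<delta> i) (rho_inf \<rho> (d i)))
          \<le> ereal ((real H + 2) * real (d i))"
        using finite_entropy_imp_separation_rate[OF \<rho>0 H \<rho> elim] by blast
      have "separation_rate \<rho> \<epsilon> \<le> ereal (real H + 2)"
        using limsup_rate_le[OF sofic_d_pos F(3)] F(1,2) by (intro INF_lower2[of "(F, \<delta>)"]) auto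
      then have "ereal (1 / \<bar>ln \<epsilon>\<bar>) * separation_rate \<rho> \<epsilon> \<le>
          ereal (1 / \<bar>ln \<epsilon>\<bar>) * ereal (real H + 2)"
        by (intro ereal_mult_left_mono) auto
      also have "\<dots> = ereal ((real H + 2) / \<bar>ln \<epsilon>\<bar>)" by simp
      finally show ?case .
    qed
  qed
  also have "\<dots> = 0"
    by (rule lim_imp_Liminf) (auto intro!: tendsto_const_over_abs_ln)
  finally show ?thesis .
qed

end

section \<open>Characters of a finitely presented module\<close>

text \<open>
  The group ring is generated as an abelian group by the multiples of group elements.
\<close>

lemma additive_group_ring_eqI:
  fixes f f' :: "'g group_ring \<Rightarrow> 'b::ab_group_add"
  assumes add: "\<And>r r'. f (r + r') = f r + f r'" "\<And>r r'. f' (r + r') = f' r + f' r'"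
    and single: "\<And>s k. f (Poly_Mapping.single s k) = f' (Poly_Mapping.single s k)"
  shows "f r = f' r"
proof (induction "card (Poly_Mapping.keys r)" arbitrary: r rule: less_induct)
  case less
  show ?case
  proof (cases "Poly_Mapping.keys r = {}")
    case True
    then have "r = Poly_Mapping.single undefined 0" by simp
    then show ?thesis using single by metis
  next
    case False
    then obtain s where s: "s \<in> Poly_Mapping.keys r" by blast
    define q where "q = r - Poly_Mapping.single s (Poly_Mapping.lookup r s)"
    have r: "r = q + Poly_Mapping.single s (Poly_Mapping.lookup r s)" by (simp add: q_def)
    have "Poly_Mapping.keys q \<subseteq> Poly_Mapping.keys r - {s}"
      by (auto simp: q_def in_keys_iff lookup_minus lookup_single when_def split: if_splits)
    then have "Poly_Mapping.keys q \<subset> Poly_Mapping.keys r" using s by auto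
    then have "f q = f' q" by (intro less psubset_card_mono) auto
    then show ?thesis by (subst (1 2) r) (simp add: add single)
  qed
qed

text \<open>
  The value at \<open>r\<close> of the character of the group ring that takes the value \<open>z s\<close> at the group
  element \<open>s\<close>.
\<close>

definition eval_ring :: "'g group_ring \<Rightarrow> ('g \<Rightarrow> circle) \<Rightarrow> circle" where
  "eval_ring r z = (\<Sum>s\<in>Poly_Mapping.keys r. int_circle (Poly_Mapping.lookup r s) (z s))"

lemma eval_ring_superset:
  assumes "finite A" "Poly_Mapping.keys r \<subseteq> A"
  shows "eval_ring r z = (\<Sum>s\<in>A. int_circle (Poly_Mapping.lookup r s) (z s))"
  unfolding eval_ring_def using assms
  by (intro sum.mono_neutral_left) (auto simp: in_keys_iff)

lemma eval_ring_add: "eval_ring (r + r') z = eval_ring r z + eval_ring r' z"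
proof -
  let ?A = "Poly_Mapping.keys r \<union> Poly_Mapping.keys r'"
  have "Poly_Mapping.keys (r + r') \<subseteq> ?A" by (rule Poly_Mapping.keys_add)
  then have "eval_ring (r + r') z = (\<Sum>s\<in>?A. int_circle (Poly_Mapping.lookup (r + r') s) (z s))"
    by (intro eval_ring_superset) auto
  also have "\<dots> = (\<Sum>s\<in>?A. int_circle (Poly_Mapping.lookup r s) (z s)) +
      (\<Sum>s\<in>?A. int_circle (Poly_Mapping.lookup r' s) (z s))"
    by (simp add: lookup_add int_circle_add_left sum.distrib)
  also have "\<dots> = eval_ring r z + eval_ring r' z"
    by (subst (1 2) eval_ring_superset[of ?A]) auto
  finally show ?thesis .
qed

lemma eval_ring_single: "eval_ring (Poly_Mapping.single s k) z = int_circle k (z s)"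
  by (simp add: eval_ring_def)

lemma eval_ring_0 [simp]: "eval_ring 0 z = 0"
  by (simp add: eval_ring_def)

lemma eval_ring_translate:
  fixes r :: "'g::group_add group_ring"
  shows "eval_ring (Poly_Mapping.single g 1 * r) z = eval_ring r (\<lambda>s. z (g + s))"
proof (rule additive_group_ring_eqI[of "\<lambda>r. eval_ring (Poly_Mapping.single g 1 * r) z"])
  show "eval_ring (Poly_Mapping.single g 1 * Poly_Mapping.single s k) z =
      eval_ring (Poly_Mapping.single s k) (\<lambda>s. z (g + s))" for s k
    by (simp add: mult_single eval_ring_single)
qed (simp_all add: distrib_left eval_ring_add)

lemma additive_diff_right:
  fixes f :: "'b::ab_group_add \<Rightarrow> 'c::ab_group_add"
  assumes "\<And>a b. f (a + b) = f a + f b"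
  shows "f (a - b) = f a - f b"
  using assms[of "a - b" b] by (simp add: eq_diff_eq)

lemma countable_group_ring: "countable (UNIV :: 'g::countable group_ring set)"
proof -
  let ?graph = "\<lambda>r::'g group_ring. (\<lambda>s. (s, Poly_Mapping.lookup r s)) ` Poly_Mapping.keys r"
  have "inj ?graph"
  proof (rule injI, rule poly_mapping_eqI)
    fix r r' :: "'g group_ring" and s
    assume eq: "?graph r = ?graph r'"
    have "Poly_Mapping.keys r = fst ` ?graph r" for r :: "'g group_ring" by force
    then have keys: "Poly_Mapping.keys r = Poly_Mapping.keys r'" using eq by metis
    show "Poly_Mapping.lookup r s = Poly_Mapping.lookup r' s"
    proof (cases "s \<in> Poly_Mapping.keys r")
      case True
      then have "(s, Poly_Mapping.lookup r s) \<in> ?graph r'" unfolding eq[symmetric] by blast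
      then show ?thesis by auto
    next
      case False
      then show ?thesis using keys by (metis in_keys_iff)
    qed
  qed
  moreover have "countable (range ?graph)"
    by (rule countable_subset[OF _ countable_Collect_finite]) auto
  ultimately show ?thesis by (metis countable_image_inj_on)
qed

text \<open>
  The generators are \<open>x 0, \<dots>, x (n - 1)\<close>, and \<open>S\<close> generates the relations between them.
\<close>

locale finitely_presented_dual = left_module smul
  for smul :: "'g::{group_add, countable} group_ring \<Rightarrow> 'a::ab_group_add \<Rightarrow> 'a" +
  fixes n :: nat and x :: "nat \<Rightarrow> 'a" and S :: "(nat \<Rightarrow> 'g group_ring) set"
  assumes surj: "free_hom smul n x ` free_module n = UNIV"
    and finite_S: "finite S"
    and kernel: "{v \<in> free_module n. free_hom smul n x v = 0} = generated_submodule S"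
begin

lemma free_hom_surjE:
  obtains v where "v \<in> free_module n" "a = free_hom smul n x v"
proof -
  have "a \<in> free_hom smul n x ` free_module n" by (simp add: surj)
  then show ?thesis using that by (elim imageE)
qed

lemma smul_0_left [simp]: "smul 0 a = 0"
  using smul_add_left[of 0 0 a] by simp

abbreviation dual :: "('a \<Rightarrow> circle) set" where
  "dual \<equiv> {\<xi>. Modules.additive \<xi>}"

abbreviation act :: "'g \<Rightarrow> ('a \<Rightarrow> circle) \<Rightarrow> 'a \<Rightarrow> circle" where
  "act \<equiv> dual_action smul"

definition gen :: "'g \<Rightarrow> nat \<Rightarrow> 'a" where
  "gen s i = smul (Poly_Mapping.single s 1) (x i)"

text \<open>
  The character of the free module with prescribed values \<open>z (s, i)\<close> at the translates by \<open>s\<close> of the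
  \<open>i\<close>-th basis vector.
\<close>

definition eval_free :: "('g \<times> nat \<Rightarrow> circle) \<Rightarrow> (nat \<Rightarrow> 'g group_ring) \<Rightarrow> circle" where
  "eval_free z v = (\<Sum>i<n. eval_ring (v i) (\<lambda>s. z (s, i)))"

lemma eval_free_add: "eval_free z (\<lambda>i. v i + v' i) = eval_free z v + eval_free z v'"
  by (simp add: eval_free_def eval_ring_add sum.distrib)

lemma character_smul:
  assumes "\<xi> \<in> dual"
  shows "\<xi> (smul r a) = eval_ring r (\<lambda>s. \<xi> (smul (Poly_Mapping.single s 1) a))"
proof (rule additive_group_ring_eqI[of "\<lambda>r. \<xi> (smul r a)"])
  have add: "\<xi> (b + c) = \<xi> b + \<xi> c" for b c
    using assms additive.add[of \<xi>] by simp
  show "\<xi> (smul (r + r') a) = \<xi> (smul r a) + \<xi> (smul r' a)" for r r'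
    by (simp add: smul_add_left add)
  show "\<xi> (smul (Poly_Mapping.single s k) a) =
      eval_ring (Poly_Mapping.single s k) (\<lambda>s. \<xi> (smul (Poly_Mapping.single s 1) a))" for s k
    using additive_to_circle_of_int[of "\<lambda>k. \<xi> (smul (Poly_Mapping.single s k) a)" k]
    by (simp add: single_add smul_add_left add eval_ring_single)
qed (simp add: eval_ring_add)

lemma character_free_hom:
  assumes "\<xi> \<in> dual"
  shows "\<xi> (free_hom smul n x v) = eval_free (\<lambda>(s, i). \<xi> (gen s i)) v"
proof -
  have "\<xi> (free_hom smul n x v) = (\<Sum>i<n. \<xi> (smul (v i) (x i)))"
    using assms additive.sum[of \<xi>] by (simp add: free_hom_def)
  also have "\<dots> = eval_free (\<lambda>(s, i). \<xi> (gen s i)) v"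
    unfolding eval_free_def gen_def prod.case by (intro sum.cong refl character_smul[OF assms])
  finally show ?thesis .
qed

lemma character_eqI:
  assumes "\<xi> \<in> dual" "\<xi>' \<in> dual" "\<And>s i. i < n \<Longrightarrow> \<xi> (gen s i) = \<xi>' (gen s i)"
  shows "\<xi> = \<xi>'"
proof
  fix a
  obtain v where a: "a = free_hom smul n x v" by (rule free_hom_surjE)
  show "\<xi> a = \<xi>' a"
    using assms(3) by (simp add: a character_free_hom[OF assms(1)] character_free_hom[OF assms(2)] eval_free_def)
qed

lemma relation_in_kernel:
  assumes "w \<in> S"
  shows "free_hom smul n x w = 0"
proof -
  have "(\<lambda>i. \<Sum>w'\<in>S. (if w' = w then 1 else 0) * w' i) \<in> generated_submodule S"
    unfolding generated_submodule_def
    by (intro CollectI exI[of _ "\<lambda>w'. if w' = w then 1 else 0"]) simp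
  moreover have "(\<lambda>i. \<Sum>w'\<in>S. (if w' = w then 1 else 0) * w' i) = w"
    using assms finite_S by (simp add: if_distrib[of "\<lambda>c. c * _"] cong: if_cong)
  ultimately show ?thesis using kernel by auto
qed

lemma relation_character:
  assumes "w \<in> S" "\<xi> \<in> dual"
  shows "eval_free (\<lambda>(s, i). \<xi> (gen s i)) w = 0"
proof -
  have "\<xi> 0 = 0" using assms(2) by (simp add: additive.zero)
  then show ?thesis using character_free_hom[OF assms(2), of w] relation_in_kernel[OF assms(1)] by simp
qed

text \<open>
  Values at the translates of the generators extend to a character if they satisfy all translates of
  the relations: \<open>eval_free z\<close> then vanishes on every multiple \<open>r w\<close> of a relation, hence on the kernel
  of the presentation, and descends to the module.
\<close>

lemma character_extension:
  assumes rel: "\<And>g w. w \<in> S \<Longrightarrow> eval_free (\<lambda>(s, i). z (g + s, i)) w = 0"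
  obtains \<xi> where "\<xi> \<in> dual" "\<And>s i. i < n \<Longrightarrow> \<xi> (gen s i) = z (s, i)"
proof -
  have diff: "eval_free z (\<lambda>i. v i - v' i) = eval_free z v - eval_free z v'" for v v'
    using eval_free_add[of z "\<lambda>i. v i - v' i" v'] by (simp add: eq_diff_eq)
  have mult: "eval_free z (\<lambda>i. r * w i) = 0" if "w \<in> S" for r w
  proof (rule additive_group_ring_eqI[of "\<lambda>r. eval_free z (\<lambda>i. r * w i)" "\<lambda>_. 0"])
    show "eval_free z (\<lambda>i. (r + r') * w i) = eval_free z (\<lambda>i. r * w i) + eval_free z (\<lambda>i. r' * w i)" for r r'
      by (simp add: distrib_right eval_free_add)
    fix s :: 'g and k :: int
    let ?f = "\<lambda>k. eval_free z (\<lambda>i. Poly_Mapping.single s k * w i)"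
    have "?f k = int_circle k (?f 1)"
      by (rule additive_to_circle_of_int) (simp add: single_add distrib_right eval_free_add)
    also have "?f 1 = 0"
      using rel[OF that, of s] by (simp add: eval_free_def eval_ring_translate)
    finally show "?f k = 0" by simp
  qed simp
  have vanish: "eval_free z v = 0" if "v \<in> generated_submodule S" for v
  proof -
    have "\<exists>c. v = (\<lambda>i. \<Sum>w\<in>S. c w * w i)"
      using that unfolding generated_submodule_def by (elim CollectE exE conjE) (rule exI)
    then obtain c where v: "v = (\<lambda>i. \<Sum>w\<in>S. c w * w i)" ..
    have "eval_free z (\<lambda>i. \<Sum>w\<in>T. c w * w i) = 0" if "T \<subseteq> S" for T
      using finite_subset[OF that finite_S] that
    proof (induction T rule: finite_induct)
      case empty
      then show ?case by (simp add: eval_free_def)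
    next
      case (insert w T)
      then show ?case by (simp add: eval_free_add mult)
    qed
    then show ?thesis by (simp add: v)
  qed
  define pre where "pre a = (SOME v. v \<in> free_module n \<and> free_hom smul n x v = a)" for a
  have pre: "pre a \<in> free_module n \<and> free_hom smul n x (pre a) = a" for a
  proof -
    have "\<exists>v. v \<in> free_module n \<and> free_hom smul n x v = a" by (rule free_hom_surjE[of a]) auto
    then show ?thesis unfolding pre_def by (rule someI_ex)
  qed
  have hom_diff: "free_hom smul n x (\<lambda>i. v i - v' i) = free_hom smul n x v - free_hom smul n x v'" for v v'
    by (simp add: free_hom_def sum_subtractf additive_diff_right[of "\<lambda>r. smul r _"] smul_add_left)
  have hom_add: "free_hom smul n x (\<lambda>i. v i + v' i) = free_hom smul n x v + free_hom smul n x v'" for v v'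
    by (simp add: free_hom_def sum.distrib smul_add_left)
  define \<xi> where "\<xi> a = eval_free z (pre a)" for a
  have \<xi>: "\<xi> (free_hom smul n x v) = eval_free z v" if "v \<in> free_module n" for v
  proof -
    let ?u = "\<lambda>i. pre (free_hom smul n x v) i - v i"
    have "?u \<in> {v \<in> free_module n. free_hom smul n x v = 0}"
      using pre[of "free_hom smul n x v"] that by (auto simp: hom_diff free_module_def)
    then have "eval_free z ?u = 0" using vanish kernel by simp
    then show ?thesis by (simp add: diff \<xi>_def)
  qed
  show ?thesis
  proof (rule that[of \<xi>])
    have "\<xi> (a + b) = \<xi> a + \<xi> b" for a b
    proof -
      let ?v = "\<lambda>i. pre a i + pre b i"
      have "?v \<in> free_module n" "free_hom smul n x ?v = a + b"
        using pre[of a] pre[of b] by (auto simp: hom_add free_module_def)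
      then show ?thesis using \<xi>[of ?v] by (simp add: eval_free_add \<xi>_def)
    qed
    then show "\<xi> \<in> dual" by (simp add: Modules.additive_def)
    fix s :: 'g and i assume i: "i < n"
    let ?v = "\<lambda>k. if k = i then Poly_Mapping.single s 1 else 0"
    have "?v \<in> free_module n" using i by (auto simp: free_module_def)
    moreover have "free_hom smul n x ?v = gen s i"
      using i by (simp add: free_hom_def gen_def if_distrib[of "\<lambda>r. smul r _"] cong: if_cong)
    moreover have "eval_free z ?v = z (s, i)"
      using i by (simp add: eval_free_def if_distrib[of "\<lambda>r. eval_ring r _"] eval_ring_single cong: if_cong)
    ultimately show "\<xi> (gen s i) = z (s, i)" using \<xi>[of ?v] by simp
  qed
qed

lemma act_gen: "act g \<xi> (gen s i) = \<xi> (gen (- g + s) i)"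
  by (simp add: dual_action_def gen_def smul_smul mult_single)

lemma act_x: "act g \<xi> (x i) = \<xi> (gen (- g) i)"
  by (simp add: dual_action_def gen_def)

lemma gen_0: "gen 0 i = x i"
  using smul_one[of "x i"] by (simp add: gen_def single_one)

text \<open>
  Countability makes the dual metrizable, so that a compatible metric exists.
\<close>

lemma countable_module: "countable (UNIV :: 'a set)"
proof -
  let ?h = "\<lambda>vs. free_hom smul n x (\<lambda>i. if i < n then vs ! i else 0)"
  have "UNIV \<subseteq> ?h ` lists (UNIV :: 'g group_ring set)"
  proof
    fix a
    obtain v where "a = free_hom smul n x v" by (rule free_hom_surjE)
    then have "a = ?h (map v [0..<n])" by (simp add: free_hom_def)
    then show "a \<in> ?h ` lists (UNIV :: 'g group_ring set)" by blast
  qed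
  moreover have "countable (?h ` lists (UNIV :: 'g group_ring set))"
    by (intro countable_image countable_lists countable_group_ring)
  ultimately show ?thesis by (rule countable_subset)
qed

lemma closed_dual: "closed dual"
proof -
  have "closed {\<xi>::'a \<Rightarrow> circle. \<xi> (a + b) = \<xi> a + \<xi> b}" for a b
    by (intro closed_Collect_eq continuous_on_circle_add continuous_on_product_coordinates)
  then have "closed (\<Inter>a b. {\<xi>::'a \<Rightarrow> circle. \<xi> (a + b) = \<xi> a + \<xi> b})" by auto
  also have "(\<Inter>a b. {\<xi>::'a \<Rightarrow> circle. \<xi> (a + b) = \<xi> a + \<xi> b}) = dual"
    by (auto simp: Modules.additive_def)
  finally show ?thesis .
qed

lemma compact_dual: "compact dual"
  using compact_Int_closed[OF compact_UNIV_circle_fun closed_dual] by simp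

sublocale compact_action dual act
proof
  show "compact dual" by (rule compact_dual)
  show "act g \<xi> \<in> dual" if "\<xi> \<in> dual" for g \<xi>
    using that by (simp add: Modules.additive_def dual_action_def smul_add_right)
  show "continuous_on dual (act g)" for g
    unfolding dual_action_def
    by (intro continuous_on_coordinatewise_then_product
        continuous_on_subset[OF continuous_on_product_coordinates]) auto
  show "act (g + h) \<xi> = act g (act h \<xi>)" for g h \<xi>
    by (simp add: dual_action_def smul_smul mult_single minus_add)
  show "act 0 \<xi> = \<xi>" for \<xi>
    by (simp add: dual_action_def single_one smul_one)
qed

lemma pontryagin_dual_eq: "pontryagin_dual = top_of_set dual"
  by (simp add: pontryagin_dual_def)

lemma exists_compatible_metric: "\<exists>\<rho>. compatible_metric (top_of_set dual) \<rho>"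
proof -
  have "metrizable_space (euclidean :: circle topology)"
    by (simp add: metrizable_space_euclidean)
  then have "metrizable_space (product_topology (\<lambda>_::'a. euclidean :: circle topology) UNIV)"
    using countable_subset[OF subset_UNIV countable_module]
    by (simp add: metrizable_space_product_topology)
  then have "metrizable_space (top_of_set dual)"
    unfolding euclidean_product_topology by (rule metrizable_space_subtopology)
  then obtain M \<rho> where M: "Metric_space M \<rho>" "top_of_set dual = Metric_space.mtopology M \<rho>"
    unfolding metrizable_space_def by metis
  have "topspace (top_of_set dual) = M"
    unfolding M(2) by (rule Metric_space.topspace_mtopology[OF M(1)])
  then have "compatible_metric (top_of_set dual) \<rho>" unfolding compatible_metric_def using M by simp
  then show ?thesis by (rule exI[of _ \<rho>])
qed

text \<open>
  This pseudometric sees only the values at the generators.  It is dynamically generating because the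
  translates of the generators generate the module.
\<close>

definition gen_dist :: "('a \<Rightarrow> circle) \<Rightarrow> ('a \<Rightarrow> circle) \<Rightarrow> real" where
  "gen_dist \<xi> \<xi>' = (\<Sum>i<n. circle_norm (\<xi> (x i) - \<xi>' (x i)))"

lemma pseudo_gen_dist: "pseudo gen_dist"
  unfolding continuous_pseudometric_iff
proof (intro conjI ballI)
  show "0 \<le> gen_dist \<xi> \<xi>'" for \<xi> \<xi>' by (simp add: gen_dist_def sum_nonneg)
  show "gen_dist \<xi> \<xi>' = gen_dist \<xi>' \<xi>" for \<xi> \<xi>'
    unfolding gen_dist_def by (intro sum.cong refl circle_norm_commute)
  show "gen_dist \<xi> \<xi> = 0" for \<xi> by (simp add: gen_dist_def)
  show "gen_dist a c \<le> gen_dist a b + gen_dist b c" for a b c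
    unfolding gen_dist_def sum.distrib[symmetric] by (intro sum_mono circle_norm_triangle)
  show "continuous_on (dual \<times> dual) (\<lambda>p. gen_dist (fst p) (snd p))"
    unfolding gen_dist_def
  proof (intro continuous_on_sum continuous_on_compose2[OF continuous_on_circle_norm[of UNIV]]
        continuous_on_circle_diff)
    fix i
    show "continuous_on (dual \<times> dual) (\<lambda>p. fst p (x i))"
      by (rule continuous_on_product_then_coordinatewise[OF continuous_on_fst[OF continuous_on_id]])
    show "continuous_on (dual \<times> dual) (\<lambda>p. snd p (x i))"
      by (rule continuous_on_product_then_coordinatewise[OF continuous_on_snd[OF continuous_on_id]])
  qed auto
qed

lemma generating_gen_dist: "generating gen_dist"
  unfolding dynamically_generating_def
proof (intro ballI impI, rule ccontr)
  fix \<xi> \<xi>' assume \<xi>: "\<xi> \<in> topspace (top_of_set dual)" "\<xi>' \<in> topspace (top_of_set dual)" "\<xi> \<noteq> \<xi>'"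
    and "\<not> (\<exists>g. 0 < gen_dist (act g \<xi>) (act g \<xi>'))"
  then have "gen_dist (act (- s) \<xi>) (act (- s) \<xi>') \<le> 0" for s by (simp add: not_less)
  then have 0: "(\<Sum>i<n. circle_norm (\<xi> (gen s i) - \<xi>' (gen s i))) \<le> 0" for s
    by (simp add: gen_dist_def act_x)
  have "\<xi> (gen s i) = \<xi>' (gen s i)" if "i < n" for s i
  proof -
    have "circle_norm (\<xi> (gen s i) - \<xi>' (gen s i)) \<le> (\<Sum>i<n. circle_norm (\<xi> (gen s i) - \<xi>' (gen s i)))"
      using that by (intro member_le_sum) auto
    with 0[of s] have "circle_norm (\<xi> (gen s i) - \<xi>' (gen s i)) = 0"
      by (intro antisym) (auto intro: order_trans)
    then show ?thesis by simp
  qed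
  with \<xi> show False using character_eqI[of \<xi> \<xi>'] by simp
qed

end

section \<open>The finite linear systems of a sofic approximation\<close>

text \<open>
  Take a set of coordinates of least size on which no nonzero vector of \<open>V\<close> vanishes.  Removing a
  coordinate \<open>i\<close> destroys the property, which yields a vector that is \<open>1\<close> at \<open>i\<close> and \<open>0\<close> at the other
  coordinates of the set.
\<close>

lemma exists_information_set:
  fixes V :: "('b \<Rightarrow> real) set"
  assumes "finite N" and supp: "\<And>v b. v \<in> V \<Longrightarrow> b \<notin> N \<Longrightarrow> v b = 0"
    and scale: "\<And>v c. v \<in> V \<Longrightarrow> (\<lambda>b. c * v b) \<in> V"
  obtains I where "I \<subseteq> N" "\<And>v. v \<in> V \<Longrightarrow> (\<And>b. b \<in> I \<Longrightarrow> v b = 0) \<Longrightarrow> v = (\<lambda>_. 0)"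
    "\<And>i. i \<in> I \<Longrightarrow> \<exists>u\<in>V. u i = 1 \<and> (\<forall>k\<in>I - {i}. u k = 0)"
proof -
  define det where "det I \<longleftrightarrow> I \<subseteq> N \<and> (\<forall>v\<in>V. (\<forall>b\<in>I. v b = 0) \<longrightarrow> v = (\<lambda>_. 0))" for I
  have "det N"
    unfolding det_def
  proof (intro conjI ballI impI ext subset_refl)
    fix v b assume "v \<in> V" "\<forall>b\<in>N. v b = 0"
    then show "v b = 0" using supp by (cases "b \<in> N") auto
  qed
  then have "\<exists>I. det I \<and> (\<forall>J. det J \<longrightarrow> card I \<le> card J)" by (rule ex_has_least_nat)
  then obtain I where I: "det I" and min: "\<And>J. det J \<Longrightarrow> card I \<le> card J" by blast
  have IN: "I \<subseteq> N" using I by (simp add: det_def)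
  have zero: "v = (\<lambda>_. 0)" if "v \<in> V" "\<And>b. b \<in> I \<Longrightarrow> v b = 0" for v
    using I that unfolding det_def by blast
  have "finite I" using IN \<open>finite N\<close> by (rule finite_subset)
  have basis: "\<exists>u\<in>V. u i = 1 \<and> (\<forall>k\<in>I - {i}. u k = 0)" if i: "i \<in> I" for i
  proof -
    have "\<not> det (I - {i})"
      using min[of "I - {i}"] card_Diff1_less[OF \<open>finite I\<close> i] by linarith
    moreover have "I - {i} \<subseteq> N" using IN by blast
    ultimately obtain v where v: "v \<in> V" "\<forall>b\<in>I - {i}. v b = 0" "v \<noteq> (\<lambda>_. 0)"
      unfolding det_def by blast
    have "v i \<noteq> 0"
    proof
      assume "v i = 0"
      then have "v b = 0" if "b \<in> I" for b using v(2) that by (cases "b = i") auto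
      then show False using zero[OF v(1)] v(3) by blast
    qed
    then show ?thesis
      using scale[OF v(1), of "1 / v i"] v(2) by (intro bexI[of _ "\<lambda>b. 1 / v i * v b"]) auto
  qed
  show ?thesis by (rule that[OF IN zero basis])
qed

definition circle_lift :: "circle \<Rightarrow> real" where
  "circle_lift c = (SOME t. 0 \<le> t \<and> t < 1 \<and> abs_circle t = c)"

lemma circle_lift: "0 \<le> circle_lift c" "circle_lift c < 1" "abs_circle (circle_lift c) = c"
proof -
  obtain t where t: "c = abs_circle t" using abs_circle_surj by metis
  have "c = abs_circle (frac t)" by (simp add: t abs_circle_eq_iff frac_def)
  then have "\<exists>t. 0 \<le> t \<and> t < 1 \<and> abs_circle t = c" using frac_ge_0 frac_lt_1 by metis
  from someI_ex[OF this]
  show "0 \<le> circle_lift c" "circle_lift c < 1" "abs_circle (circle_lift c) = c"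
    unfolding circle_lift_def by auto
qed

context finitely_presented_dual
begin

text \<open>
  The equation of the relation \<open>w\<close> at the site \<open>j\<close>.  A configuration assigns to \<open>(i, j)\<close> the value of
  the \<open>j\<close>-th character at \<open>x i\<close>; its value at the translate of \<open>x i\<close> by \<open>s\<close> is, approximately, the value
  at \<open>x i\<close> of the character at the site \<open>\<pi> (- s) j\<close>.  The coefficients are integers, so the same
  definition serves for real and for integer configurations.
\<close>

definition rel :: "('g \<Rightarrow> nat \<Rightarrow> nat) \<Rightarrow> (nat \<Rightarrow> 'g group_ring) \<Rightarrow> nat \<Rightarrow> (nat \<times> nat \<Rightarrow> 'b::ring_1) \<Rightarrow> 'b" where
  "rel \<pi> w j y = (\<Sum>i<n. \<Sum>s\<in>Poly_Mapping.keys (w i). of_int (Poly_Mapping.lookup (w i) s) * y (i, \<pi> (- s) j))"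

text \<open>
  An upper bound for the absolute row sums of the linear system.
\<close>

definition weight :: nat where
  "weight = nat (\<Sum>w\<in>S. \<Sum>i<n. \<Sum>s\<in>Poly_Mapping.keys (w i). \<bar>Poly_Mapping.lookup (w i) s\<bar>)"

lemma weight_bound:
  assumes "w \<in> S"
  shows "(\<Sum>i<n. \<Sum>s\<in>Poly_Mapping.keys (w i). real_of_int \<bar>Poly_Mapping.lookup (w i) s\<bar>) \<le> real weight"
proof -
  have "(\<Sum>i<n. \<Sum>s\<in>Poly_Mapping.keys (w i). \<bar>Poly_Mapping.lookup (w i) s\<bar>) \<le>
      (\<Sum>w\<in>S. \<Sum>i<n. \<Sum>s\<in>Poly_Mapping.keys (w i). \<bar>Poly_Mapping.lookup (w i) s\<bar>)"
    using assms finite_S by (intro member_le_sum) (auto intro!: sum_nonneg)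
  also have "\<dots> \<le> int weight" by (simp add: weight_def)
  finally have "real_of_int (\<Sum>i<n. \<Sum>s\<in>Poly_Mapping.keys (w i). \<bar>Poly_Mapping.lookup (w i) s\<bar>) \<le> real weight"
    by linarith
  then show ?thesis by simp
qed

lemma rel_bound:
  fixes y :: "nat \<times> nat \<Rightarrow> real"
  assumes "w \<in> S" "\<And>i s. i < n \<Longrightarrow> \<bar>y (i, \<pi> (- s) j)\<bar> \<le> B" "0 \<le> B"
  shows "\<bar>rel \<pi> w j y\<bar> \<le> real weight * B"
proof -
  have "\<bar>rel \<pi> w j y\<bar> \<le> (\<Sum>i<n. \<Sum>s\<in>Poly_Mapping.keys (w i).
      \<bar>of_int (Poly_Mapping.lookup (w i) s) * y (i, \<pi> (- s) j)\<bar>)"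
    unfolding rel_def by (intro order_trans[OF sum_abs] sum_mono sum_abs)
  also have "\<dots> \<le> (\<Sum>i<n. \<Sum>s\<in>Poly_Mapping.keys (w i). real_of_int \<bar>Poly_Mapping.lookup (w i) s\<bar> * B)"
    using assms(2) by (intro sum_mono) (auto simp: abs_mult intro!: mult_left_mono)
  also have "\<dots> = (\<Sum>i<n. \<Sum>s\<in>Poly_Mapping.keys (w i). real_of_int \<bar>Poly_Mapping.lookup (w i) s\<bar>) * B"
    by (simp add: sum_distrib_right)
  also have "\<dots> \<le> real weight * B" using weight_bound[OF assms(1)] assms(3) by (rule mult_right_mono)
  finally show ?thesis .
qed

lemma rel_diff: "rel \<pi> w j (\<lambda>p. y p - y' p) = rel \<pi> w j y - rel \<pi> w j y'"
  by (simp add: rel_def right_diff_distrib sum_subtractf)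

lemma rel_add: "rel \<pi> w j (\<lambda>p. y p + y' p) = rel \<pi> w j y + rel \<pi> w j y'"
  by (simp add: rel_def distrib_left sum.distrib)

lemma rel_scale:
  fixes c :: "'b::comm_ring_1"
  shows "rel \<pi> w j (\<lambda>p. c * y p) = c * rel \<pi> w j y"
  by (simp add: rel_def sum_distrib_left mult.left_commute)

lemma rel_of_int:
  fixes p :: "nat \<times> nat \<Rightarrow> int"
  shows "rel \<pi> w j (\<lambda>q. of_int (p q)) = of_int (rel \<pi> w j p)"
  by (simp add: rel_def)

lemma abs_circle_rel:
  "abs_circle (rel \<pi> w j y) = eval_free (\<lambda>(s, i). abs_circle (y (i, \<pi> (- s) j))) w"
  by (simp add: rel_def eval_free_def eval_ring_def abs_circle_sum int_circle_abs_circle)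

lemma eval_free_close:
  assumes "w \<in> S" "\<And>i s. i < n \<Longrightarrow> s \<in> Poly_Mapping.keys (w i) \<Longrightarrow> circle_norm (z (s, i) - z' (s, i)) \<le> B" "0 \<le> B"
  shows "circle_norm (eval_free z w - eval_free z' w) \<le> real weight * B"
proof -
  have "eval_free z w - eval_free z' w =
      (\<Sum>i<n. \<Sum>s\<in>Poly_Mapping.keys (w i). int_circle (Poly_Mapping.lookup (w i) s) (z (s, i) - z' (s, i)))"
    by (simp add: eval_free_def eval_ring_def int_circle_diff_right sum_subtractf)
  then have "circle_norm (eval_free z w - eval_free z' w) \<le>
      (\<Sum>i<n. \<Sum>s\<in>Poly_Mapping.keys (w i). circle_norm (int_circle (Poly_Mapping.lookup (w i) s) (z (s, i) - z' (s, i))))"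
    by (simp only:) (intro order_trans[OF circle_norm_sum] sum_mono circle_norm_sum)
  also have "\<dots> \<le> (\<Sum>i<n. \<Sum>s\<in>Poly_Mapping.keys (w i). real_of_int \<bar>Poly_Mapping.lookup (w i) s\<bar> * B)"
    using assms(2)
    by (intro sum_mono order_trans[OF circle_norm_int_circle] mult_left_mono) auto
  also have "\<dots> = (\<Sum>i<n. \<Sum>s\<in>Poly_Mapping.keys (w i). real_of_int \<bar>Poly_Mapping.lookup (w i) s\<bar>) * B"
    by (simp add: sum_distrib_right)
  also have "\<dots> \<le> real weight * B" using weight_bound[OF assms(1)] assms(3) by (rule mult_right_mono)
  finally show ?thesis .
qed

definition solutions :: "nat \<Rightarrow> ('g \<Rightarrow> nat \<Rightarrow> nat) \<Rightarrow> (nat \<times> nat \<Rightarrow> real) set" where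
  "solutions m \<pi> = {v. (\<forall>q. q \<notin> {..<n} \<times> {1..m} \<longrightarrow> v q = 0) \<and> (\<forall>w\<in>S. \<forall>j\<in>{1..m}. rel \<pi> w j v = 0)}"

text \<open>
  The size of such a set is the dimension of the solution space, in a form that provides both the
  injectivity used for the upper bound and the cube of solutions used for the lower bound.
\<close>

definition information_set :: "nat \<Rightarrow> ('g \<Rightarrow> nat \<Rightarrow> nat) \<Rightarrow> (nat \<times> nat) set \<Rightarrow> bool" where
  "information_set m \<pi> I \<longleftrightarrow> I \<subseteq> {..<n} \<times> {1..m} \<and>
    (\<forall>v\<in>solutions m \<pi>. (\<forall>q\<in>I. v q = 0) \<longrightarrow> v = (\<lambda>_. 0)) \<and>
    (\<forall>q\<in>I. \<exists>u\<in>solutions m \<pi>. u q = 1 \<and> (\<forall>k\<in>I - {q}. u k = 0))"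

definition info :: "nat \<Rightarrow> ('g \<Rightarrow> nat \<Rightarrow> nat) \<Rightarrow> (nat \<times> nat) set" where
  "info m \<pi> = (SOME I. information_set m \<pi> I)"

lemma info: "information_set m \<pi> (info m \<pi>)"
proof -
  have "\<exists>I. information_set m \<pi> I"
  proof (rule exists_information_set[of "{..<n} \<times> {1..m}" "solutions m \<pi>"])
    show "(\<lambda>b. c * v b) \<in> solutions m \<pi>" if "v \<in> solutions m \<pi>" for v c
      using that by (auto simp: solutions_def rel_scale)
    show "\<exists>I. information_set m \<pi> I" if "I \<subseteq> {..<n} \<times> {1..m}"
      "\<And>v. v \<in> solutions m \<pi> \<Longrightarrow> (\<And>b. b \<in> I \<Longrightarrow> v b = 0) \<Longrightarrow> v = (\<lambda>_. 0)"
      "\<And>i. i \<in> I \<Longrightarrow> \<exists>u\<in>solutions m \<pi>. u i = 1 \<and> (\<forall>k\<in>I - {i}. u k = 0)" for I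
      unfolding information_set_def using that by (intro exI[of _ I]) blast
    show "v q = 0" if "v \<in> solutions m \<pi>" "q \<notin> {..<n} \<times> {1..m}" for v q
      using that unfolding solutions_def by blast
  qed simp
  then show ?thesis unfolding info_def by (rule someI_ex)
qed

lemma info_subset: "info m \<pi> \<subseteq> {..<n} \<times> {1..m}"
  using info[of m \<pi>] by (simp add: information_set_def)

lemma info_determines:
  assumes "v \<in> solutions m \<pi>" "\<And>q. q \<in> info m \<pi> \<Longrightarrow> v q = 0"
  shows "v = (\<lambda>_. 0)"
  using info[of m \<pi>] assms by (simp add: information_set_def)

lemma info_basis:
  assumes "q \<in> info m \<pi>"
  shows "\<exists>u\<in>solutions m \<pi>. u q = 1 \<and> (\<forall>k\<in>info m \<pi> - {q}. u k = 0)"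
  using info[of m \<pi>] assms unfolding information_set_def by (elim conjE) (rule bspec)

lemma finite_info: "finite (info m \<pi>)"
  by (rule finite_subset[OF info_subset]) simp

end

section \<open>Small solution spaces give finite entropy\<close>

locale sofic_dual = finitely_presented_dual smul n x S + sofic d \<sigma>
  for smul :: "'g::{group_add, countable} group_ring \<Rightarrow> 'a::ab_group_add \<Rightarrow> 'a"
    and n x S d and \<sigma> :: "nat \<Rightarrow> 'g \<Rightarrow> nat \<Rightarrow> nat"
begin

sublocale sofic_compact_action dual act d \<sigma> ..

abbreviation "sols k \<equiv> solutions (d k) (\<sigma> k)"
abbreviation "inf_set k \<equiv> info (d k) (\<sigma> k)"

definition lift_config :: "nat \<Rightarrow> (nat \<Rightarrow> 'a \<Rightarrow> circle) \<Rightarrow> nat \<times> nat \<Rightarrow> real" where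
  "lift_config m \<phi> = (\<lambda>(i, j). if i < n \<and> j \<in> {1..m} then circle_lift (\<phi> j (x i)) else 0)"

lemma lift_config_bounds: "0 \<le> lift_config m \<phi> q" "lift_config m \<phi> q \<le> 1"
  using circle_lift(1,2) by (auto simp: lift_config_def less_imp_le split: prod.split)

text \<open>
  The character at the site \<open>j\<close> satisfies the relation exactly, and its values at the translates of
  the generators are close to the entries of the configuration at the other sites.
\<close>

lemma rel_lift_config_near_int:
  assumes \<phi>: "\<phi> j \<in> dual" and j: "j \<in> {1..d k}" and w: "w \<in> S" and "0 \<le> B"
    and close: "\<And>i s. i < n \<Longrightarrow> s \<in> Poly_Mapping.keys (w i) \<Longrightarrow> gen_dist (\<phi> (\<sigma> k (- s) j)) (act (- s) (\<phi> j)) \<le> B"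
  shows "circle_norm (abs_circle (rel (\<sigma> k) w j (lift_config (d k) \<phi>))) \<le> real weight * B"
proof -
  let ?z = "\<lambda>(s, i). abs_circle (lift_config (d k) \<phi> (i, \<sigma> k (- s) j))"
  have "circle_norm (eval_free ?z w - eval_free (\<lambda>(s, i). \<phi> j (gen s i)) w) \<le> real weight * B"
  proof (rule eval_free_close[OF w _ \<open>0 \<le> B\<close>], unfold prod.case)
    fix i s assume i: "i < n" and s: "s \<in> Poly_Mapping.keys (w i)"
    have "abs_circle (lift_config (d k) \<phi> (i, \<sigma> k (- s) j)) = \<phi> (\<sigma> k (- s) j) (x i)"
      using i j sofic_in[of k "- s" j] circle_lift(3) by (simp add: lift_config_def del: atLeastAtMost_iff)
    moreover have "\<phi> j (gen s i) = act (- s) (\<phi> j) (x i)" by (simp add: act_x)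
    moreover have "circle_norm (\<phi> (\<sigma> k (- s) j) (x i) - act (- s) (\<phi> j) (x i)) \<le>
        gen_dist (\<phi> (\<sigma> k (- s) j)) (act (- s) (\<phi> j))"
      unfolding gen_dist_def using i by (intro member_le_sum) auto
    ultimately show "circle_norm (abs_circle (lift_config (d k) \<phi> (i, \<sigma> k (- s) j)) - \<phi> j (gen s i)) \<le> B"
      using close[OF i s] by simp
  qed
  then show ?thesis by (simp add: relation_character[OF w \<phi>] abs_circle_rel)
qed

text \<open>
  The square is the number of pairs \<open>(z, t)\<close> with entries of absolute value at most \<open>weight + 1\<close>; an
  integer \<open>L z + t\<close> of this form is the value of a relation at a good site.
\<close>

definition entropy_bound :: real where
  "entropy_bound = real (card S) * ln (2 * real ((2 * weight + 3)\<^sup>2)) + 2"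

text \<open>
  The bound does not depend on \<open>\<epsilon>\<close>: the precision \<open>1 / L\<close> enters only through the bad sites, whose
  proportion \<open>\<beta>\<close> is chosen after \<open>L\<close>, and through the coordinates in the information set, whose
  proportion tends to \<open>0\<close>.
\<close>

lemma entropy_le_if_info_small:
  assumes \<rho>: "pseudo \<rho>" "generating \<rho>"
    and small: "(\<lambda>i. real (card (inf_set i)) / real (d i)) \<longlonglongrightarrow> 0"
  shows "sofic_entropy_wrt d \<sigma> (top_of_set dual) act \<rho> \<le> ereal entropy_bound"
  unfolding sofic_entropy_wrt_def
proof (rule SUP_least)
  fix \<epsilon> :: real assume "\<epsilon> \<in> {0<..}"
  then have "\<epsilon> > 0" by simp
  obtain E \<tau> where E: "finite E" "\<tau> > 0"
    "\<And>x y. x \<in> dual \<Longrightarrow> y \<in> dual \<Longrightarrow> (\<And>g. g \<in> E \<Longrightarrow> gen_dist (act g x) (act g y) < \<tau>) \<Longrightarrow> \<rho> x y < \<epsilon> / 2"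
    using pseudo_finite_window[OF pseudo_gen_dist generating_gen_dist \<rho>(1), of "\<epsilon> / 2"] \<open>\<epsilon> > 0\<close> by auto
  obtain D where D: "D > 0" "\<And>x y. x \<in> dual \<Longrightarrow> y \<in> dual \<Longrightarrow> \<rho> x y \<le> D"
    by (rule pseudo_bounded[OF \<rho>(1)]) (erule that)
  define \<beta>1 where "\<beta>1 = \<epsilon>\<^sup>2 / (2 * D\<^sup>2)"
  have \<beta>1: "\<beta>1 > 0" "\<beta>1 * D\<^sup>2 + (\<epsilon> / 2)\<^sup>2 \<le> \<epsilon>\<^sup>2"
    using D(1) \<open>\<epsilon> > 0\<close> by (auto simp: \<beta>1_def power_divide)
  obtain L0 :: nat where L0: "3 * real n / \<tau> < real L0" using reals_Archimedean2 by blast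
  define L where "L = Suc L0"
  have L: "L > 0" "real n / real L < \<tau> / 3"
  proof -
    show "L > 0" by (simp add: L_def)
    have "3 * real n / \<tau> < real L" using L0 by (simp add: L_def)
    then show "real n / real L < \<tau> / 3" using E(2) \<open>L > 0\<close> by (simp add: field_simps)
  qed
  define K2 where "K2 = 2 * weight * L + 1"
  have "0 \<le> real (card S) * ln (real K2)"
    by (intro mult_nonneg_nonneg ln_ge_zero) (auto simp: K2_def)
  then obtain \<beta> where \<beta>: "\<beta> > 0" "real (card S) * ln (real K2) * \<beta> \<le> 1"
    using exists_small_multiple[of "real (card S) * ln (real K2)" 1] by auto
  obtain \<eta> where \<eta>: "\<eta> > 0" "ln (real (Suc L)) * \<eta> \<le> 1"
    using exists_small_multiple[of "ln (real (Suc L))" 1] by auto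
  obtain \<tau>' where \<tau>': "\<tau>' > 0" "\<tau>' \<le> \<tau> / 3" "real weight * \<tau>' \<le> 1 / real L"
  proof -
    obtain t where t: "t > 0" "real weight * t \<le> 1 / real L"
      using exists_small_multiple[of "real weight" "1 / real L"] L(1) by auto
    show ?thesis
    proof (rule that[of "min t (\<tau> / 3)"])
      show "real weight * min t (\<tau> / 3) \<le> 1 / real L"
        by (rule order_trans[OF mult_left_mono t(2)]) auto
    qed (use t(1) E(2) in auto)
  qed
  define F' where "F' = E \<union> (\<Union>w\<in>S. \<Union>i<n. uminus ` Poly_Mapping.keys (w i))"
  have "finite F'" using E(1) finite_S by (auto simp: F'_def)
  obtain \<beta>' where \<beta>': "\<beta>' > 0" "2 * real (card E) * \<beta>' \<le> \<beta>1" "real (card F') * \<beta>' \<le> \<beta>"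
  proof -
    obtain b where b: "b > 0" "(2 * real (card E) + real (card F')) * b \<le> min \<beta>1 \<beta>"
      using exists_small_multiple[of "2 * real (card E) + real (card F')" "min \<beta>1 \<beta>"] \<beta>1(1) \<beta>(1) by auto
    have "2 * real (card E) * b + real (card F') * b \<le> min \<beta>1 \<beta>" using b(2) by (simp only: distrib_right)
    moreover have "0 \<le> real (card E) * b" "0 \<le> real (card F') * b" using b(1) by auto
    ultimately show ?thesis by (intro that[OF b(1)]) linarith+
  qed
  obtain F \<delta> where F: "finite F" "\<delta> > 0"
    "\<forall>\<^sub>F i in sequentially. \<forall>\<phi>\<in>Map \<rho> F \<delta> i. almost_equivariant dual act gen_dist F' \<tau>' \<beta>' (d i) (\<sigma> i) \<phi>"
    by (rule Map_change_metric[OF \<rho> pseudo_gen_dist \<open>finite F'\<close> \<tau>'(1) \<beta>'(1)]) (erule (1) that)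
  have "\<forall>\<^sub>F i in sequentially. real (card (inf_set i)) / real (d i) < \<eta>"
    using small \<eta>(1) by (rule order_tendstoD)
  with F(3) sofic_d_pos have "\<forall>\<^sub>F i in sequentially.
      enat_log (covering_number \<epsilon> (Map \<rho> F \<delta> i) (rho_2 \<rho> (d i))) \<le> ereal (entropy_bound * real (d i))"
  proof eventually_elim
    case (elim k)
    show ?case
    proof (rule enat_log_covering_le)
      show "rho_2 \<rho> (d k) \<phi> \<phi> \<le> \<epsilon>" if "\<phi> \<in> Map \<rho> F \<delta> k" for \<phi>
        using pseudo_refl[OF \<rho>(1)] Map_D[OF that] \<open>\<epsilon> > 0\<close> by (simp add: rho_2_def)
      show "rho_2 \<rho> (d k) \<phi> \<psi> = rho_2 \<rho> (d k) \<psi> \<phi>" if "\<phi> \<in> Map \<rho> F \<delta> k" "\<psi> \<in> Map \<rho> F \<delta> k" for \<phi> \<psi>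
        using pseudo_commute[OF \<rho>(1)] Map_D[OF that(1)] Map_D[OF that(2)] by (simp add: rho_2_def)
      fix \<Phi> assume \<Phi>: "\<Phi> \<subseteq> Map \<rho> F \<delta> k" and sep: "separated \<epsilon> (rho_2 \<rho> (d k)) \<Phi>"
      have X: "\<phi> j \<in> dual" if "\<phi> \<in> \<Phi>" "j \<in> {1..d k}" for \<phi> j
        using Map_D[of \<phi> \<rho> F \<delta> k j] \<Phi> that by auto
      have ae: "mostly \<beta>' (d k) (\<lambda>j. gen_dist (\<phi> (\<sigma> k g j)) (act g (\<phi> j)) < \<tau>')"
        if "\<phi> \<in> \<Phi>" "g \<in> F'" for \<phi> g
        using elim(1) \<Phi> that unfolding almost_equivariant_def by blast
      let ?y = "lift_config (d k)" and ?J = "S \<times> {1..d k}" and ?I = "inf_set k"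
      define p where "p \<phi> q = round (real L * ?y \<phi> q)" for \<phi> q
      have p_near: "\<bar>real_of_int (p \<phi> q) - real L * ?y \<phi> q\<bar> \<le> 1 / 2" for \<phi> q
        unfolding p_def by (rule of_int_round_abs_le)
      have p_range: "0 \<le> p \<phi> q" "p \<phi> q \<le> int L" for \<phi> q
      proof -
        have "round (0::real) \<le> p \<phi> q" unfolding p_def
          using lift_config_bounds[of "d k" \<phi> q] by (intro round_mono) auto
        then show "0 \<le> p \<phi> q" by simp
        have "p \<phi> q \<le> round (real L)" unfolding p_def
          using lift_config_bounds[of "d k" \<phi> q] by (intro round_mono) (auto intro: mult_left_le)
        then show "p \<phi> q \<le> int L" by simp
      qed
      \<comment> \<open>Maps with the same rounded configuration are \<open>\<epsilon>\<close>-close in the mean square.\<close>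
      have p_inj: "\<phi> = \<psi>" if \<phi>: "\<phi> \<in> \<Phi>" and \<psi>: "\<psi> \<in> \<Phi>" and eq: "p \<phi> = p \<psi>" for \<phi> \<psi>
      proof (rule ccontr)
        assume "\<phi> \<noteq> \<psi>"
        have near: "gen_dist (\<phi> j) (\<psi> j) < \<tau> / 3" if j: "j \<in> {1..d k}" for j
        proof -
          have "circle_norm (\<phi> j (x i) - \<psi> j (x i)) \<le> 1 / real L" if i: "i < n" for i
          proof -
            have lift: "\<phi> j (x i) = abs_circle (?y \<phi> (i, j))" "\<psi> j (x i) = abs_circle (?y \<psi> (i, j))"
              using i j by (auto simp: lift_config_def circle_lift(3))
            have "real L * \<bar>?y \<phi> (i, j) - ?y \<psi> (i, j)\<bar> = \<bar>real L * ?y \<phi> (i, j) - real L * ?y \<psi> (i, j)\<bar>"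
              by (simp flip: right_diff_distrib add: abs_mult)
            also have "\<dots> \<le> 1"
              using p_near[of \<phi> "(i, j)"] p_near[of \<psi> "(i, j)"] unfolding eq by linarith
            finally have "\<bar>?y \<phi> (i, j) - ?y \<psi> (i, j)\<bar> \<le> 1 / real L" using L(1) by (simp add: field_simps)
            then show ?thesis
              unfolding lift abs_circle_diff[symmetric] by (rule order_trans[OF circle_norm_abs_circle_le_abs])
          qed
          then have "gen_dist (\<phi> j) (\<psi> j) \<le> (\<Sum>i<n. 1 / real L)"
            unfolding gen_dist_def by (intro sum_mono) auto
          also have "\<dots> < \<tau> / 3" using L(2) by simp
          finally show ?thesis .
        qed
        have "mostly (\<beta>' + \<beta>') (d k) (\<lambda>j. gen_dist (\<phi> (\<sigma> k g j)) (act g (\<phi> j)) < \<tau>' \<and>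
            gen_dist (\<psi> (\<sigma> k g j)) (act g (\<psi> j)) < \<tau>')" if "g \<in> E" for g
          using that \<phi> \<psi> by (intro mostly_conj ae) (auto simp: F'_def)
        from mostly_ball[OF E(1) this]
        have "mostly \<beta>1 (d k) (\<lambda>j. \<rho> (\<phi> j) (\<psi> j) < \<epsilon> / 2)"
        proof (rule mostly_mono)
          fix j assume j: "j \<in> {1..d k}" and *: "\<forall>g\<in>E. gen_dist (\<phi> (\<sigma> k g j)) (act g (\<phi> j)) < \<tau>' \<and>
            gen_dist (\<psi> (\<sigma> k g j)) (act g (\<psi> j)) < \<tau>'"
          show "\<rho> (\<phi> j) (\<psi> j) < \<epsilon> / 2"
          proof (rule E(3))
            fix g assume g: "g \<in> E"
            have gj: "\<sigma> k g j \<in> {1..d k}" using j sofic_in by blast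
            let ?a = "act g (\<phi> j)" and ?b = "\<phi> (\<sigma> k g j)" and ?c = "\<psi> (\<sigma> k g j)" and ?d = "act g (\<psi> j)"
            have in_X: "?a \<in> dual" "?b \<in> dual" "?c \<in> dual" "?d \<in> dual"
              using X[OF \<phi>] X[OF \<psi>] act_in j gj by blast+
            note tri = pseudo_triangle[OF pseudo_gen_dist] and comm = pseudo_commute[OF pseudo_gen_dist]
            have "gen_dist ?a ?d \<le> gen_dist ?b ?a + gen_dist ?b ?c + gen_dist ?c ?d"
              using tri[of ?a ?b ?d] tri[of ?b ?c ?d] comm[of ?a ?b] in_X by linarith
            moreover have "gen_dist ?b ?a < \<tau>'" "gen_dist ?c ?d < \<tau>'" using * g by auto
            ultimately show "gen_dist ?a ?d < \<tau>" using near[OF gj] \<tau>'(2) by linarith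
          qed (use X \<phi> \<psi> j in blast)+
        qed (use \<beta>'(2) in \<open>auto simp: algebra_simps\<close>)
        then have "rho_2 \<rho> (d k) \<phi> \<psi> \<le> \<epsilon>"
          by (rule rho_2_le_if_mostly[where \<rho> = \<rho> and \<phi> = \<phi> and \<psi> = \<psi> and D = D])
            (use X \<phi> \<psi> pseudo_nonneg[OF \<rho>(1)] D(2) \<beta>1(2) \<open>\<epsilon> > 0\<close> in auto)
        with sep \<phi> \<psi> \<open>\<phi> \<noteq> \<psi>\<close> show False by (fastforce simp: separated_def)
      qed
      define G :: "int set" where
        "G = (\<lambda>(z, t). int L * z + t) ` ({- int (weight + 1)..int (weight + 1)} \<times> {- int (weight + 1)..int (weight + 1)})"
      define H :: "int set" where "H = {- int (weight * L)..int (weight * L)}"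
      have G: "finite G" "card G \<le> (2 * weight + 3)\<^sup>2"
      proof -
        show "finite G" by (simp add: G_def)
        have "card G \<le> card ({- int (weight + 1)..int (weight + 1)} \<times> {- int (weight + 1)..int (weight + 1)})"
          unfolding G_def by (intro card_image_le) auto
        also have "\<dots> = (2 * weight + 3)\<^sup>2"
        proof -
          have "card {- int (weight + 1)..int (weight + 1)} = 2 * weight + 3"
            unfolding card_atLeastAtMost_int by arith
          then show ?thesis by (simp only: card_cartesian_product power2_eq_square)
        qed
        finally show "card G \<le> (2 * weight + 3)\<^sup>2" .
      qed
      have H: "finite H" "card H \<le> K2"
      proof -
        show "finite H" by (simp add: H_def)
        have "card H = 2 * (weight * L) + 1" unfolding H_def card_atLeastAtMost_int by arith
        then show "card H \<le> K2" by (simp add: K2_def)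
      qed
      have rel_H: "rel (\<sigma> k) w j (p \<phi>) \<in> H" if "w \<in> S" for w j \<phi>
      proof -
        have "\<bar>rel (\<sigma> k) w j (\<lambda>q. real_of_int (p \<phi> q))\<bar> \<le> real weight * real L"
        proof (rule rel_bound[OF that])
          show "\<bar>real_of_int (p \<phi> (i, \<sigma> k (- s) j))\<bar> \<le> real L" for i s
            using p_range[of \<phi> "(i, \<sigma> k (- s) j)"] by simp
        qed simp
        then have "real_of_int \<bar>rel (\<sigma> k) w j (p \<phi>)\<bar> \<le> real_of_int (int (weight * L))"
          by (simp add: rel_of_int)
        then have "\<bar>rel (\<sigma> k) w j (p \<phi>)\<bar> \<le> int (weight * L)" by (simp only: of_int_le_iff)
        then show ?thesis by (simp add: H_def abs_le_iff)
      qed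
      \<comment> \<open>At a good site the value at \<open>L\<close> times the configuration is within \<open>1\<close> of an integer multiple
        of \<open>L\<close>, and rounding changes it by at most \<open>weight / 2\<close>.\<close>
      have rel_G: "rel (\<sigma> k) w j (p \<phi>) \<in> G"
        if \<phi>: "\<phi> \<in> \<Phi>" and w: "w \<in> S" and j: "j \<in> {1..d k}"
          and good: "\<forall>g\<in>F'. gen_dist (\<phi> (\<sigma> k g j)) (act g (\<phi> j)) < \<tau>'" for \<phi> w j
      proof -
        let ?r = "rel (\<sigma> k) w j (?y \<phi>)"
        have "circle_norm (abs_circle ?r) \<le> real weight * \<tau>'"
        proof (rule rel_lift_config_near_int[where \<phi> = \<phi> and j = j and k = k and w = w])
          show "\<phi> j \<in> dual" "j \<in> {1..d k}" "w \<in> S" using X[OF \<phi> j] j w by auto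
          show "gen_dist (\<phi> (\<sigma> k (- s) j)) (act (- s) (\<phi> j)) \<le> \<tau>'"
            if "i < n" "s \<in> Poly_Mapping.keys (w i)" for i s
            using good that w by (intro less_imp_le) (auto simp: F'_def)
        qed (use \<tau>'(1) in simp)
        then have 1: "\<bar>?r - real_of_int (round ?r)\<bar> \<le> 1 / real L"
          using \<tau>'(3) by (simp add: circle_norm_abs_circle)
        have 2: "\<bar>?r\<bar> \<le> real weight"
          using rel_bound[OF w, of "?y \<phi>" "\<sigma> k" j 1] lift_config_bounds[of "d k" \<phi>] by simp
        have "\<bar>rel (\<sigma> k) w j (\<lambda>q. real_of_int (p \<phi> q) - real L * ?y \<phi> q)\<bar> \<le> real weight * (1 / 2)"
          by (rule rel_bound[OF w p_near]) simp
        then have 3: "\<bar>real_of_int (rel (\<sigma> k) w j (p \<phi>)) - real L * ?r\<bar> \<le> real weight / 2"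
          by (simp add: rel_diff rel_scale rel_of_int)
        have "1 / real L \<le> 1" using L(1) by simp
        with 1 2 have "\<bar>real_of_int (round ?r)\<bar> \<le> real weight + 1" by linarith
        then have z: "\<bar>round ?r\<bar> \<le> int (weight + 1)" by linarith
        have "\<bar>real L * ?r - real L * real_of_int (round ?r)\<bar> = real L * \<bar>?r - real_of_int (round ?r)\<bar>"
          by (simp flip: right_diff_distrib add: abs_mult)
        also have "\<dots> \<le> real L * (1 / real L)" using 1 by (intro mult_left_mono) auto
        also have "\<dots> = 1" using L(1) by simp
        finally have "\<bar>real_of_int (rel (\<sigma> k) w j (p \<phi>)) - real L * real_of_int (round ?r)\<bar> \<le> real weight + 1"
          using 3 by linarith
        then have "\<bar>real_of_int (rel (\<sigma> k) w j (p \<phi>) - int L * round ?r)\<bar> \<le> real weight + 1" by simp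
        then have t: "\<bar>rel (\<sigma> k) w j (p \<phi>) - int L * round ?r\<bar> \<le> int (weight + 1)" by linarith
        show ?thesis
          unfolding G_def
          by (rule image_eqI[of _ _ "(round ?r, rel (\<sigma> k) w j (p \<phi>) - int L * round ?r)"])
            (use z t in auto)
      qed
      define code1 where "code1 \<phi> = (\<lambda>q\<in>?J. rel (\<sigma> k) (fst q) (snd q) (p \<phi>))" for \<phi>
      define code2 where "code2 \<phi> = (\<lambda>q\<in>?I. p \<phi> q)" for \<phi>
      \<comment> \<open>The difference of two integer configurations with the same code is a real solution that vanishes
        on the information set.\<close>
      have inj: "inj_on (\<lambda>\<phi>. (code1 \<phi>, code2 \<phi>)) \<Phi>"
      proof (rule inj_onI)
        fix \<phi> \<psi> assume \<phi>: "\<phi> \<in> \<Phi>" and \<psi>: "\<psi> \<in> \<Phi>" and "(code1 \<phi>, code2 \<phi>) = (code1 \<psi>, code2 \<psi>)"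
        then have eq: "code1 \<phi> q = code1 \<psi> q" "code2 \<phi> q' = code2 \<psi> q'" for q q' by auto
        let ?v = "\<lambda>q. real_of_int (p \<phi> q) - real_of_int (p \<psi> q)"
        have "?v \<in> sols k"
          unfolding solutions_def
        proof (intro CollectI conjI allI impI ballI)
          fix q assume "q \<notin> {..<n} \<times> {1..d k}"
          then show "?v q = 0" by (auto simp: p_def lift_config_def split: prod.split)
        next
          fix w j assume "w \<in> S" "j \<in> {1..d k}"
          then have "rel (\<sigma> k) w j (p \<phi>) = rel (\<sigma> k) w j (p \<psi>)" using eq(1)[of "(w, j)"] by (simp add: code1_def)
          then show "rel (\<sigma> k) w j ?v = 0" by (simp add: rel_diff rel_of_int)
        qed
        then have v0: "?v = (\<lambda>_. 0)"
        proof (rule info_determines)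
          show "?v q = 0" if "q \<in> ?I" for q using eq(2)[of q] that by (simp add: code2_def)
        qed
        have "p \<phi> = p \<psi>"
        proof
          fix q
          show "p \<phi> q = p \<psi> q" using fun_cong[OF v0, of q] by simp
        qed
        then show "\<phi> = \<psi>" by (rule p_inj[OF \<phi> \<psi>])
      qed
      have codes1: "code1 ` \<Phi> \<subseteq> {f \<in> ?J \<rightarrow>\<^sub>E (G \<union> H).
          real (card {q \<in> ?J. f q \<notin> G}) \<le> real (card S) * \<beta> * real (d k)}"
      proof (rule image_subsetI, rule CollectI, rule conjI)
        fix \<phi> assume \<phi>: "\<phi> \<in> \<Phi>"
        show "code1 \<phi> \<in> ?J \<rightarrow>\<^sub>E (G \<union> H)"
          unfolding code1_def using rel_H by (intro PiE_I) auto
        let ?bad = "{j \<in> {1..d k}. \<not> (\<forall>g\<in>F'. gen_dist (\<phi> (\<sigma> k g j)) (act g (\<phi> j)) < \<tau>')}"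
        have "{q \<in> ?J. code1 \<phi> q \<notin> G} \<subseteq> S \<times> ?bad"
        proof (intro subsetI, elim CollectE conjE)
          fix q assume q: "q \<in> ?J" "code1 \<phi> q \<notin> G"
          obtain w j where wj: "q = (w, j)" "w \<in> S" "j \<in> {1..d k}" using q(1) by (elim SigmaE)
          have "rel (\<sigma> k) w j (p \<phi>) \<notin> G" using q wj by (simp add: code1_def)
          then have "\<not> (\<forall>g\<in>F'. gen_dist (\<phi> (\<sigma> k g j)) (act g (\<phi> j)) < \<tau>')"
            using rel_G[OF \<phi> wj(2,3)] by meson
          then show "q \<in> S \<times> ?bad" using wj by (intro SigmaI CollectI conjI | simp only:)+
        qed
        then have "card {q \<in> ?J. code1 \<phi> q \<notin> G} \<le> card (S \<times> ?bad)"
          using finite_S by (intro card_mono) auto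
        then have "real (card {q \<in> ?J. code1 \<phi> q \<notin> G}) \<le> real (card (S \<times> ?bad))" by (rule of_nat_mono)
        also have "\<dots> = real (card S) * real (card ?bad)" by (simp add: card_cartesian_product)
        also have "\<dots> \<le> real (card S) * (\<beta> * real (d k))"
        proof (rule mult_left_mono)
          have "mostly \<beta> (d k) (\<lambda>j. \<forall>g\<in>F'. gen_dist (\<phi> (\<sigma> k g j)) (act g (\<phi> j)) < \<tau>')"
            using mostly_ball[OF \<open>finite F'\<close> ae[OF \<phi>]] by (rule mostly_mono) (use \<beta>'(3) in auto)
          then show "real (card ?bad) \<le> \<beta> * real (d k)" by (simp only: mostly_def)
        qed simp
        finally show "real (card {q \<in> ?J. code1 \<phi> q \<notin> G}) \<le> real (card S) * \<beta> * real (d k)" by simp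
      qed
      have K: "1 \<le> (2 * weight + 3)\<^sup>2" "1 \<le> K2" by (auto simp: K2_def)
      have "finite ?J" using finite_S by simp
      note count = count_with_few_exceptions[OF this G(1) H(1) G(2) H(2) K codes1]
      have codes2: "code2 ` \<Phi> \<subseteq> ?I \<rightarrow>\<^sub>E {0..int L}" using p_range by (auto simp: code2_def)
      have fin2: "finite (?I \<rightarrow>\<^sub>E {0..int L})" by (intro finite_PiE finite_info) auto
      have "real (card (code2 ` \<Phi>)) \<le> real (card (?I \<rightarrow>\<^sub>E {0..int L}))"
        using card_mono[OF fin2 codes2] by (rule of_nat_mono)
      also have "\<dots> = real (Suc L) ^ card ?I"
        by (simp add: card_PiE finite_info nat_add_distrib)
      also have "\<dots> = exp (real (card ?I) * ln (real (Suc L)))" by (simp add: exp_of_nat_mult)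
      also have "\<dots> \<le> exp (1 * real (d k))"
      proof -
        have "real (card ?I) \<le> \<eta> * real (d k)" using elim(2,3) by (simp add: field_simps)
        then have "real (card ?I) * ln (real (Suc L)) \<le> (\<eta> * real (d k)) * ln (real (Suc L))"
          by (intro mult_right_mono ln_ge_zero) auto
        also have "\<dots> = (ln (real (Suc L)) * \<eta>) * real (d k)" by simp
        also have "\<dots> \<le> 1 * real (d k)" using \<eta>(2) by (intro mult_right_mono) auto
        finally show ?thesis by simp
      qed
      finally have count2: "real (card (code2 ` \<Phi>)) \<le> exp (real (d k))" by simp
      have "real (card \<Phi>) = real (card ((\<lambda>\<phi>. (code1 \<phi>, code2 \<phi>)) ` \<Phi>))" using card_image[OF inj] by simp
      also have "\<dots> \<le> real (card (code1 ` \<Phi> \<times> code2 ` \<Phi>))"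
        using count(1) finite_subset[OF codes2 fin2] by (intro of_nat_mono card_mono) auto
      also have "\<dots> = real (card (code1 ` \<Phi>)) * real (card (code2 ` \<Phi>))" by (simp add: card_cartesian_product)
      also have "\<dots> \<le> exp (real (card ?J) * ln (2 * real ((2 * weight + 3)\<^sup>2)) +
          real (card S) * \<beta> * real (d k) * ln (real K2)) * exp (real (d k))"
        using count(2) count2 by (intro mult_mono) auto
      also have "\<dots> = exp (real (card S) * real (d k) * ln (2 * real ((2 * weight + 3)\<^sup>2)) +
          (real (card S) * ln (real K2) * \<beta>) * real (d k) + real (d k))"
        by (simp add: exp_add card_cartesian_product algebra_simps)
      also have "\<dots> \<le> exp (entropy_bound * real (d k))"
      proof -
        have "(real (card S) * ln (real K2) * \<beta>) * real (d k) \<le> 1 * real (d k)"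
          using \<beta>(2) by (intro mult_right_mono) auto
        then show ?thesis by (simp add: entropy_bound_def algebra_simps)
      qed
      finally show "real (card \<Phi>) \<le> exp (entropy_bound * real (d k))" .
    qed
  qed
  then have "limsup (\<lambda>i. ereal (1 / real (d i)) *
      enat_log (covering_number \<epsilon> (Map \<rho> F \<delta> i) (rho_2 \<rho> (d i)))) \<le> ereal entropy_bound"
    by (rule limsup_rate_le[OF sofic_d_pos])
  with F(1,2) show "(INF (F, \<delta>)\<in>{F. finite F} \<times> {0<..}. limsup (\<lambda>i. ereal (1 / real (d i)) *
      enat_log (covering_number \<epsilon> (Map \<rho> F \<delta> i) (rho_2 \<rho> (d i))))) \<le> ereal entropy_bound"
    by (intro INF_lower2[of "(F, \<delta>)"]) auto
qed

end

section \<open>Large solution spaces give positive metric mean dimension\<close>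

text \<open>
  A discrete Poincare-Miranda theorem: a function on a grid that changes little between adjacent
  points and lies on the correct sides of the target on the faces comes close to the target.  No
  continuity is involved, which matters because the correction of configurations to characters is
  not continuous.  Kuhn's lemma, applied to the labels that say on which side of the target a
  coordinate lies, yields a small cube in which every coordinate crosses its target.
\<close>

lemma kuhn_crossing:
  fixes f :: "(nat \<Rightarrow> nat) \<Rightarrow> nat \<Rightarrow> real"
  assumes "0 < p"
    and low: "\<And>y l. (\<And>l. l < k \<Longrightarrow> y l \<le> p) \<Longrightarrow> l < k \<Longrightarrow> y l = 0 \<Longrightarrow> f y l < t l"
    and high: "\<And>y l. (\<And>l. l < k \<Longrightarrow> y l \<le> p) \<Longrightarrow> l < k \<Longrightarrow> y l = p \<Longrightarrow> t l \<le> f y l"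
    and close: "\<And>y y' l. (\<And>l. l < k \<Longrightarrow> y l \<le> p \<and> y' l \<le> p \<and> y l \<le> y' l \<and> y' l \<le> y l + 1) \<Longrightarrow> l < k \<Longrightarrow>
      \<bar>f y l - f y' l\<bar> < \<epsilon>"
  obtains y where "\<And>l. l < k \<Longrightarrow> \<bar>f y l - t l\<bar> < \<epsilon>"
proof -
  define label where "label y l = (if t l \<le> f y l then 1 else 0 :: nat)" for y l
  obtain q where q: "\<forall>l<k. q l < p"
    "\<forall>l<k. \<exists>r s. (\<forall>j<k. q j \<le> r j \<and> r j \<le> q j + 1) \<and> (\<forall>j<k. q j \<le> s j \<and> s j \<le> q j + 1) \<and>
      label r l \<noteq> label s l"
  proof (rule kuhn_lemma[of p k label])
    show "\<forall>y. (\<forall>l<k. y l \<le> p) \<longrightarrow> (\<forall>l<k. label y l = 0 \<or> label y l = 1)"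
      by (simp add: label_def)
    show "\<forall>y. (\<forall>l<k. y l \<le> p) \<longrightarrow> (\<forall>l<k. y l = 0 \<longrightarrow> label y l = 0)"
    proof (intro allI impI)
      fix y l assume "\<forall>l<k. y l \<le> p" "l < k" "y l = 0"
      then have "f y l < t l" by (intro low) auto
      then show "label y l = 0" by (simp add: label_def)
    qed
    show "\<forall>y. (\<forall>l<k. y l \<le> p) \<longrightarrow> (\<forall>l<k. y l = p \<longrightarrow> label y l = 1)"
    proof (intro allI impI)
      fix y l assume "\<forall>l<k. y l \<le> p" "l < k" "y l = p"
      then have "t l \<le> f y l" by (intro high) auto
      then show "label y l = 1" by (simp add: label_def)
    qed
  qed (use \<open>0 < p\<close> in auto)
  show ?thesis
  proof (rule that[of q])
    fix l assume l: "l < k"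
    then obtain r s where r: "\<forall>j<k. q j \<le> r j \<and> r j \<le> q j + 1"
      and s: "\<forall>j<k. q j \<le> s j \<and> s j \<le> q j + 1" and neq: "label r l \<noteq> label s l"
      using q(2)[rule_format, OF l] by (elim exE conjE)
    have near: "\<bar>f q l - f y l\<bar> < \<epsilon>" if "\<forall>j<k. q j \<le> y j \<and> y j \<le> q j + 1" for y
    proof (rule close[OF _ l])
      fix j assume j: "j < k"
      then have "q j < p" "q j \<le> y j" "y j \<le> q j + 1" using q(1) that by auto
      then show "q j \<le> p \<and> y j \<le> p \<and> q j \<le> y j \<and> y j \<le> q j + 1" by auto
    qed
    show "\<bar>f q l - t l\<bar> < \<epsilon>"
    proof (cases "t l \<le> f r l")
      case True
      then have "f s l < t l" using neq by (auto simp: label_def split: if_splits)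
      with True show ?thesis using near[OF r] near[OF s] by linarith
    next
      case False
      then have "t l \<le> f s l" using neq by (auto simp: label_def split: if_splits)
      with False show ?thesis using near[OF r] near[OF s] by linarith
    qed
  qed
qed

context finitely_presented_dual
begin

text \<open>
  Values that satisfy finitely many translates of the relations are close, on a given finite set, to
  those of a character.  By compactness of the space of all values this follows from the exact
  statement \<open>character_extension\<close>.
\<close>

lemma approximate_character_extension:
  assumes "finite E" "\<tau> > 0"
  obtains G :: "'g set" where "finite G"
    "\<And>z. (\<forall>g\<in>G. \<forall>w\<in>S. eval_free (\<lambda>(s, i). z (g + s, i)) w = 0) \<Longrightarrow>
      \<exists>\<xi>. \<xi> \<in> dual \<and> (\<forall>s\<in>E. \<forall>i<n. circle_norm (\<xi> (gen s i) - z (s, i)) < \<tau>)"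
proof -
  define U where "U = {z :: 'g \<times> nat \<Rightarrow> circle.
    \<exists>\<xi>. \<xi> \<in> dual \<and> (\<forall>s\<in>E. \<forall>i<n. circle_norm (\<xi> (gen s i) - z (s, i)) < \<tau>)}"
  define f where "f = (\<lambda>(g, w) z. circle_norm (eval_free (\<lambda>(s, i). z (g + s, i)) w))"
  have coord: "continuous_on UNIV (\<lambda>z::'g \<times> nat \<Rightarrow> circle. z q)" for q
    by (rule continuous_on_product_coordinates)
  have norm: "continuous_on UNIV (\<lambda>z. circle_norm (h z))" if "continuous_on UNIV h"
    for h :: "('g \<times> nat \<Rightarrow> circle) \<Rightarrow> circle"
    by (rule continuous_on_compose2[OF continuous_on_circle_norm[of UNIV] that]) simp
  have "openin (top_of_set UNIV) U"
  proof -
    have "open {z :: 'g \<times> nat \<Rightarrow> circle. circle_norm (\<xi> (gen s i) - z (s, i)) < \<tau>}" for \<xi> s i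
      by (intro open_Collect_less norm continuous_on_circle_diff continuous_on_const coord)
    then have "open (\<Union>\<xi>\<in>dual. \<Inter>s\<in>E. \<Inter>i\<in>{..<n}.
        {z :: 'g \<times> nat \<Rightarrow> circle. circle_norm (\<xi> (gen s i) - z (s, i)) < \<tau>})"
      using assms(1) by (intro open_UN open_INT ballI) auto
    moreover have "(\<Union>\<xi>\<in>dual. \<Inter>s\<in>E. \<Inter>i\<in>{..<n}.
        {z :: 'g \<times> nat \<Rightarrow> circle. circle_norm (\<xi> (gen s i) - z (s, i)) < \<tau>}) = U"
      unfolding U_def by auto
    ultimately show ?thesis by simp
  qed
  obtain E' \<tau>' where E': "finite E'" "E' \<subseteq> UNIV \<times> S" "\<tau>' > 0"
    "\<And>z. z \<in> UNIV \<Longrightarrow> (\<And>k. k \<in> E' \<Longrightarrow> f k z < \<tau>') \<Longrightarrow> z \<in> U"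
  proof (rule compact_finite_tolerance[where Z = "UNIV :: ('g \<times> nat \<Rightarrow> circle) set" and K = "UNIV \<times> S"
        and f = f and U = U])
    show "continuous_on UNIV (f k)" for k
      unfolding f_def case_prod_beta' eval_free_def eval_ring_def
      by (intro norm continuous_on_circle_sum continuous_on_int_circle coord)
    show "0 \<le> f k z" for k z by (simp add: f_def case_prod_beta')
    fix z assume zero: "\<And>k. k \<in> UNIV \<times> S \<Longrightarrow> f k z = 0"
    have rel: "eval_free (\<lambda>(s, i). z (g + s, i)) w = 0" if "w \<in> S" for g w
      using zero[of "(g, w)"] that by (simp add: f_def)
    show "z \<in> U"
    proof (rule character_extension[of z])
      fix \<xi> assume "\<xi> \<in> dual" "\<And>s i. i < n \<Longrightarrow> \<xi> (gen s i) = z (s, i)"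
      then have "\<xi> \<in> dual \<and> (\<forall>s\<in>E. \<forall>i<n. circle_norm (\<xi> (gen s i) - z (s, i)) < \<tau>)"
        using \<open>\<tau> > 0\<close> by simp
      then show "z \<in> U" unfolding U_def by blast
    qed (rule rel)
  qed (use \<open>openin (top_of_set UNIV) U\<close> in \<open>simp_all add: compact_UNIV_circle_fun\<close>)
  show ?thesis
  proof (rule that[of "fst ` E'"])
    show "finite (fst ` E')" using E'(1) by simp
    fix z assume zero: "\<forall>g\<in>fst ` E'. \<forall>w\<in>S. eval_free (\<lambda>(s, i). z (g + s, i)) w = 0"
    have "z \<in> U"
    proof (rule E'(4))
      fix k assume k: "k \<in> E'"
      then have "fst k \<in> fst ` E'" "snd k \<in> S" using E'(2) by auto
      then show "f k z < \<tau>'" using zero[rule_format, of "fst k" "snd k"] E'(3) by (simp add: f_def case_prod_beta')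
    qed simp
    then show "\<exists>\<xi>. \<xi> \<in> dual \<and> (\<forall>s\<in>E. \<forall>i<n. circle_norm (\<xi> (gen s i) - z (s, i)) < \<tau>)"
      by (simp add: U_def)
  qed
qed

lemma finitely_many_coordinates_control:
  assumes "pseudo \<rho>" "\<eta> > 0"
  obtains E \<tau> where "finite E" "\<tau> > 0"
    "\<And>\<xi> \<xi>'. \<xi> \<in> dual \<Longrightarrow> \<xi>' \<in> dual \<Longrightarrow>
      (\<forall>s\<in>E. \<forall>i<n. circle_norm (\<xi> (gen s i) - \<xi>' (gen s i)) < \<tau>) \<Longrightarrow> \<rho> \<xi> \<xi>' < \<eta>"
proof -
  obtain E \<tau> where E: "finite E" "\<tau> > 0"
    "\<And>x y. x \<in> dual \<Longrightarrow> y \<in> dual \<Longrightarrow> (\<And>g. g \<in> E \<Longrightarrow> gen_dist (act g x) (act g y) < \<tau>) \<Longrightarrow> \<rho> x y < \<eta>"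
    using pseudo_finite_window[OF pseudo_gen_dist generating_gen_dist assms] by auto
  show ?thesis
  proof (rule that[of "uminus ` E" "\<tau> / (real n + 1)"])
    show "finite (uminus ` E)" "\<tau> / (real n + 1) > 0" using E(1,2) by (auto intro: divide_pos_pos)
    fix \<xi> \<xi>' assume \<xi>: "\<xi> \<in> dual" "\<xi>' \<in> dual" and close: "\<forall>s\<in>uminus ` E. \<forall>i<n.
      circle_norm (\<xi> (gen s i) - \<xi>' (gen s i)) < \<tau> / (real n + 1)"
    show "\<rho> \<xi> \<xi>' < \<eta>"
    proof (rule E(3)[OF \<xi>])
      fix g assume g: "g \<in> E"
      have "gen_dist (act g \<xi>) (act g \<xi>') \<le> (\<Sum>i<n. \<tau> / (real n + 1))"
        unfolding gen_dist_def act_x using g close by (intro sum_mono less_imp_le) auto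
      also have "\<dots> = (real n / (real n + 1)) * \<tau>" by simp
      also have "\<dots> < 1 * \<tau>" using E(2) by (intro mult_strict_right_mono) (auto simp: divide_less_eq)
      finally show "gen_dist (act g \<xi>) (act g \<xi>') < \<tau>" by simp
    qed
  qed
qed

text \<open>
  A metric, in contrast to a dynamically generating pseudometric, controls the generators without
  passing to translates.
\<close>

lemma compatible_metric_controls_generators:
  assumes "compatible_metric (top_of_set dual) \<rho>" "\<eta> > 0"
  obtains c where "c > 0" "\<And>\<xi> \<xi>'. \<xi> \<in> dual \<Longrightarrow> \<xi>' \<in> dual \<Longrightarrow> \<rho> \<xi> \<xi>' < c \<Longrightarrow> gen_dist \<xi> \<xi>' < \<eta>"
proof -
  note \<rho> = compatible_imp_pseudo(1)[OF assms(1)]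
  interpret Metric_space dual \<rho> using assms(1) by (simp add: compatible_metric_def)
  define U where "U = {z \<in> dual \<times> dual. gen_dist (fst z) (snd z) < \<eta>}"
  obtain E \<tau> where E: "finite E" "E \<subseteq> (UNIV :: unit set)" "\<tau> > 0"
    "\<And>z. z \<in> dual \<times> dual \<Longrightarrow> (\<And>k. k \<in> E \<Longrightarrow> \<rho> (fst z) (snd z) < \<tau>) \<Longrightarrow> z \<in> U"
  proof (rule compact_finite_tolerance[where Z = "dual \<times> dual" and K = "UNIV :: unit set"
        and f = "\<lambda>_ z. \<rho> (fst z) (snd z)" and U = U])
    show "compact (dual \<times> dual)" by (intro compact_Times compact_dual)
    show "continuous_on (dual \<times> dual) (\<lambda>z. \<rho> (fst z) (snd z))" by (rule pseudo_continuous[OF \<rho>])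
    show "0 \<le> \<rho> (fst z) (snd z)" for z by simp
    show "openin (top_of_set (dual \<times> dual)) U"
      unfolding U_def by (intro openin_sublevel pseudo_continuous pseudo_gen_dist)
    fix z assume z: "z \<in> dual \<times> dual" and "\<And>k. k \<in> (UNIV :: unit set) \<Longrightarrow> \<rho> (fst z) (snd z) = 0"
    then have "\<rho> (fst z) (snd z) = 0" by blast
    then have "fst z = snd z" using z zero[of "fst z" "snd z"] by (simp add: mem_Times_iff)
    then show "z \<in> U" using z \<open>\<eta> > 0\<close> by (simp add: U_def gen_dist_def)
  qed blast
  show ?thesis
  proof (rule that[OF E(3)])
    fix \<xi> \<xi>' assume "\<xi> \<in> dual" "\<xi>' \<in> dual" "\<rho> \<xi> \<xi>' < \<tau>"
    then have "(\<xi>, \<xi>') \<in> U" by (intro E(4)) auto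
    then show "gen_dist \<xi> \<xi>' < \<eta>" by (simp add: U_def)
  qed
qed

text \<open>
  The function \<open>zero_dist \<rho> i\<close> is used as a coordinate on the dual that is \<open>1\<close>-Lipschitz for \<open>\<rho>\<close>.  A
  neighbourhood of the characters vanishing at \<open>x i\<close> is taken instead of these characters themselves,
  so that the coordinate is exactly \<open>0\<close> for values at \<open>x i\<close> that are only approximately \<open>0\<close>.
\<close>

definition near_zero :: "nat \<Rightarrow> ('a \<Rightarrow> circle) set" where
  "near_zero i = {\<beta> \<in> dual. circle_norm (\<beta> (x i)) \<le> 1 / 8}"

definition zero_dist :: "(('a \<Rightarrow> circle) \<Rightarrow> ('a \<Rightarrow> circle) \<Rightarrow> real) \<Rightarrow> nat \<Rightarrow> ('a \<Rightarrow> circle) \<Rightarrow> real" where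
  "zero_dist \<rho> i \<xi> = (INF \<beta>\<in>near_zero i. \<rho> \<xi> \<beta>)"

lemma zero_character: "(\<lambda>_. 0) \<in> dual"
  by (simp add: Modules.additive_def)

lemma near_zero_nonempty: "near_zero i \<noteq> {}"
  using zero_character unfolding near_zero_def by (intro ex_in_conv[THEN iffD1] exI[of _ "\<lambda>_. 0"]) simp

context
  fixes \<rho> assumes pseudo: "pseudo \<rho>"
begin

lemma zero_dist_bdd: "\<xi> \<in> dual \<Longrightarrow> bdd_below (\<rho> \<xi> ` near_zero i)"
  using pseudo_nonneg[OF pseudo] by (intro bdd_belowI[of _ 0]) (auto simp: near_zero_def)

lemma zero_dist_le:
  assumes "\<xi> \<in> dual" "\<beta> \<in> near_zero i"
  shows "zero_dist \<rho> i \<xi> \<le> \<rho> \<xi> \<beta>"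
  unfolding zero_dist_def using zero_dist_bdd[OF assms(1)] assms(2) by (rule cINF_lower)

lemma zero_dist_le_0:
  assumes "\<xi> \<in> dual" "circle_norm (\<xi> (x i)) \<le> 1 / 8"
  shows "zero_dist \<rho> i \<xi> \<le> 0"
  using zero_dist_le[OF assms(1), of \<xi> i] pseudo_refl[OF pseudo assms(1)] assms by (simp add: near_zero_def)

lemma zero_dist_ge:
  assumes "\<xi> \<in> dual" "i < n" "3 / 8 \<le> circle_norm (\<xi> (x i))"
    and c: "\<And>\<xi> \<xi>'. \<xi> \<in> dual \<Longrightarrow> \<xi>' \<in> dual \<Longrightarrow> \<rho> \<xi> \<xi>' < c \<Longrightarrow> gen_dist \<xi> \<xi>' < 1 / 4"
  shows "c \<le> zero_dist \<rho> i \<xi>"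
  unfolding zero_dist_def
proof (rule cINF_greatest[OF near_zero_nonempty])
  fix \<beta> assume \<beta>: "\<beta> \<in> near_zero i"
  have "circle_norm (\<xi> (x i)) \<le> circle_norm (\<xi> (x i) - \<beta> (x i)) + circle_norm (\<beta> (x i))"
    using circle_norm_add[of "\<xi> (x i) - \<beta> (x i)" "\<beta> (x i)"] by simp
  moreover have "circle_norm (\<xi> (x i) - \<beta> (x i)) \<le> gen_dist \<xi> \<beta>"
    unfolding gen_dist_def using assms(2) by (intro member_le_sum) auto
  ultimately have "\<not> gen_dist \<xi> \<beta> < 1 / 4" using assms(3) \<beta> by (simp add: near_zero_def)
  then show "c \<le> \<rho> \<xi> \<beta>" using c[OF assms(1), of \<beta>] \<beta> by (auto simp: near_zero_def not_less[symmetric])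
qed

lemma zero_dist_lipschitz:
  assumes "\<xi> \<in> dual" "\<xi>' \<in> dual"
  shows "\<bar>zero_dist \<rho> i \<xi> - zero_dist \<rho> i \<xi>'\<bar> \<le> \<rho> \<xi> \<xi>'"
proof -
  have le: "zero_dist \<rho> i a - \<rho> a b \<le> zero_dist \<rho> i b" if ab: "a \<in> dual" "b \<in> dual" for a b
    unfolding zero_dist_def[of \<rho> i b]
  proof (rule cINF_greatest[OF near_zero_nonempty])
    fix \<beta> assume \<beta>: "\<beta> \<in> near_zero i"
    then have "zero_dist \<rho> i a \<le> \<rho> a \<beta>" by (rule zero_dist_le[OF ab(1)])
    also have "\<dots> \<le> \<rho> a b + \<rho> b \<beta>"
      using \<beta> ab by (intro pseudo_triangle[OF pseudo]) (auto simp: near_zero_def)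
    finally show "zero_dist \<rho> i a - \<rho> a b \<le> \<rho> b \<beta>" by simp
  qed
  show ?thesis
    using le[OF assms] le[OF assms(2,1)] pseudo_commute[OF pseudo assms] by (simp add: abs_le_iff)
qed

end

lemma eval_free_cong:
  assumes "\<And>i s. i < n \<Longrightarrow> s \<in> Poly_Mapping.keys (w i) \<Longrightarrow> z (s, i) = z' (s, i)"
  shows "eval_free z w = eval_free z' w"
  unfolding eval_free_def eval_ring_def using assms by (intro sum.cong refl) auto

lemma solutions_combination:
  assumes "finite T" "\<And>l. l \<in> T \<Longrightarrow> b l \<in> solutions m \<pi>"
  shows "(\<lambda>q. \<Sum>l\<in>T. c l * b l q) \<in> solutions m \<pi>"
  using assms
proof (induction T rule: finite_induct)
  case empty
  then show ?case by (simp add: solutions_def rel_def)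
next
  case (insert l T)
  then have "(\<lambda>q. \<Sum>l\<in>T. c l * b l q) \<in> solutions m \<pi>" "b l \<in> solutions m \<pi>" by auto
  then have "(\<lambda>q. c l * b l q + (\<Sum>l\<in>T. c l * b l q)) \<in> solutions m \<pi>"
    unfolding solutions_def by (simp add: rel_add rel_scale)
  then show ?case using insert.hyps by simp
qed

end

lemma circle_norm_half: "circle_norm (abs_circle (1 / 2)) = 1 / 2"
  by (simp add: circle_norm_abs_circle round_def)

context sofic_dual
begin

text \<open>
  A way \<open>\<phi>\<close> of turning solutions into almost equivariant maps that moves the values at the generators
  by less than \<open>1 / 8\<close> at the sites satisfying \<open>Good\<close> and takes solutions that are uniformly close to
  maps that are close at every site.
\<close>

definition correction ::
    "(('a \<Rightarrow> circle) \<Rightarrow> ('a \<Rightarrow> circle) \<Rightarrow> real) \<Rightarrow> 'g set \<Rightarrow> real \<Rightarrow> real \<Rightarrow> real \<Rightarrow> real \<Rightarrow> nat \<Rightarrow>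
     (nat \<Rightarrow> bool) \<Rightarrow> ((nat \<times> nat \<Rightarrow> real) \<Rightarrow> nat \<Rightarrow> 'a \<Rightarrow> circle) \<Rightarrow> bool" where
  "correction \<rho> F \<delta> \<gamma> \<tau> \<eta> k Good \<phi> \<longleftrightarrow>
    mostly \<gamma> (d k) Good \<and>
    (\<forall>v\<in>sols k. \<phi> v \<in> Map \<rho> F \<delta> k \<and>
      (\<forall>j\<in>{1..d k}. \<forall>i<n. Good j \<longrightarrow> circle_norm (\<phi> v j (x i) - abs_circle (v (i, j))) < 1 / 8)) \<and>
    (\<forall>v\<in>sols k. \<forall>v'\<in>sols k. (\<forall>q. \<bar>v q - v' q\<bar> < \<tau>) \<longrightarrow>
      (\<forall>j\<in>{1..d k}. \<rho> (\<phi> v j) (\<phi> v' j) < \<eta>))"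

text \<open>
  At a site where \<open>\<sigma> k\<close> is multiplicative on a finite set, the values \<open>v (i, \<sigma> k (- s) j)\<close> of a solution
  satisfy many translates of the relations, so they are close to a character; elsewhere the zero
  character is taken.  Almost equivariance and the continuity estimate hold because finitely many
  coordinates control \<open>\<rho>\<close>.  The tolerance \<open>\<tau>\<close> does not depend on \<open>k\<close>.
\<close>

lemma solution_to_Map:
  assumes \<rho>: "pseudo \<rho>" and "finite F" "\<delta> > 0" "\<gamma> > 0" "\<eta> > 0"
  obtains \<tau> where "\<tau> > 0"
    "\<forall>\<^sub>F k in sequentially. \<exists>Good \<phi>. correction \<rho> F \<delta> \<gamma> \<tau> \<eta> k Good \<phi>"
proof -
  obtain \<tau>0 \<beta>0 where \<tau>0: "\<tau>0 > 0" "\<beta>0 > 0"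
    "\<And>F i \<phi>. almost_equivariant dual act \<rho> F \<tau>0 \<beta>0 (d i) (\<sigma> i) \<phi> \<Longrightarrow> \<phi> \<in> Map \<rho> F \<delta> i"
    by (rule almost_equivariant_imp_Map[OF \<rho> \<open>\<delta> > 0\<close>]) (erule (1) that)
  have "min \<eta> \<tau>0 > 0" using \<open>\<eta> > 0\<close> \<tau>0(1) by simp
  obtain E \<tau> where E: "finite E" "\<tau> > 0"
    "\<And>\<xi> \<xi>'. \<xi> \<in> dual \<Longrightarrow> \<xi>' \<in> dual \<Longrightarrow>
      (\<forall>s\<in>E. \<forall>i<n. circle_norm (\<xi> (gen s i) - \<xi>' (gen s i)) < \<tau>) \<Longrightarrow> \<rho> \<xi> \<xi>' < min \<eta> \<tau>0"
    by (rule finitely_many_coordinates_control[OF \<rho> \<open>min \<eta> \<tau>0 > 0\<close>]) (erule (1) that)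
  define \<tau>1 where "\<tau>1 = min (\<tau> / 3) (1 / 8)"
  have \<tau>1: "\<tau>1 > 0" "\<tau>1 \<le> \<tau> / 3" "\<tau>1 \<le> 1 / 8" using E(2) by (auto simp: \<tau>1_def)
  define E' where "E' = insert 0 E \<union> (\<lambda>(g, s). - g + s) ` (F \<times> E)"
  have "finite E'" using E(1) \<open>finite F\<close> by (simp add: E'_def)
  obtain G :: "'g set" where G: "finite G"
    "\<And>z. (\<forall>g\<in>G. \<forall>w\<in>S. eval_free (\<lambda>(s, i). z (g + s, i)) w = 0) \<Longrightarrow>
      \<exists>\<xi>. \<xi> \<in> dual \<and> (\<forall>s\<in>E'. \<forall>i<n. circle_norm (\<xi> (gen s i) - z (s, i)) < \<tau>1)"
    by (rule approximate_character_extension[OF \<open>finite E'\<close> \<tau>1(1)]) (erule that)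
  define supp where "supp = (\<Union>w\<in>S. \<Union>i<n. Poly_Mapping.keys (w i))"
  have "finite supp" using finite_S by (auto simp: supp_def)
  \<comment> \<open>The pairs with \<open>supp\<close> give the relations, those with \<open>E\<close> give equivariance, and \<open>(0, 0)\<close> makes
    \<open>\<sigma> k 0\<close> fix the site.\<close>
  define P where "P = insert (0, 0) ((\<lambda>(s, g). (- s, - g)) ` (supp \<times> G) \<union> (\<lambda>(s, g). (- s, g)) ` (E \<times> F))"
  have "finite P" using E(1) G(1) \<open>finite supp\<close> \<open>finite F\<close> by (simp add: P_def)
  define \<gamma>1 where "\<gamma>1 = min \<gamma> (\<beta>0 / 2)"
  have \<gamma>1: "\<gamma>1 > 0" "\<gamma>1 \<le> \<gamma>" "\<gamma>1 + \<gamma>1 \<le> \<beta>0" using \<open>\<gamma> > 0\<close> \<tau>0(2) by (auto simp: \<gamma>1_def)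
  show ?thesis
  proof (rule that[of "\<tau> / 3"])
    show "\<tau> / 3 > 0" using E(2) by simp
    show "\<forall>\<^sub>F k in sequentially. \<exists>Good \<phi>. correction \<rho> F \<delta> \<gamma> (\<tau> / 3) \<eta> k Good \<phi>"
      using sofic_multiplicative[OF \<open>finite P\<close> \<gamma>1(1)]
    proof eventually_elim
      case (elim k)
      define Good where "Good j \<longleftrightarrow> (\<forall>(g, h)\<in>P. \<sigma> k g (\<sigma> k h j) = \<sigma> k (g + h) j)" for j
      have Good_D: "\<sigma> k (- s) (\<sigma> k (- g) j) = \<sigma> k (- s + - g) j" if "Good j" "s \<in> supp" "g \<in> G" for j s g
        using that unfolding Good_def P_def by force
      have Good_F: "\<sigma> k (- s) (\<sigma> k g j) = \<sigma> k (- s + g) j" if "Good j" "s \<in> E" "g \<in> F" for j s g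
        using that unfolding Good_def P_def by force
      have Good_0: "\<sigma> k 0 j = j" if "Good j" for j
      proof -
        have "\<sigma> k 0 (\<sigma> k 0 j) = \<sigma> k 0 j" using that unfolding Good_def P_def by force
        then show ?thesis using permutes_inj[OF sofic_permutes[of k 0]] by (simp add: inj_eq)
      qed
      define approx where "approx v j \<xi> \<longleftrightarrow> \<xi> \<in> dual \<and>
        (\<forall>s\<in>E'. \<forall>i<n. circle_norm (\<xi> (gen s i) - abs_circle (v (i, \<sigma> k (- s) j))) < \<tau>1)" for v j \<xi>
      have ex_approx: "\<exists>\<xi>. approx v j \<xi>"
        if v: "v \<in> sols k" and j: "j \<in> {1..d k}" and good: "Good j" for v j
      proof -
        let ?z = "\<lambda>(s, i). abs_circle (v (i, \<sigma> k (- s) j))"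
        have "\<exists>\<xi>. \<xi> \<in> dual \<and> (\<forall>s\<in>E'. \<forall>i<n. circle_norm (\<xi> (gen s i) - ?z (s, i)) < \<tau>1)"
        proof (rule G(2), intro ballI)
          fix g w assume g: "g \<in> G" and w: "w \<in> S"
          have "eval_free (\<lambda>(s, i). ?z (g + s, i)) w =
              eval_free (\<lambda>(s, i). abs_circle (v (i, \<sigma> k (- s) (\<sigma> k (- g) j)))) w"
          proof (rule eval_free_cong)
            fix i s assume "i < n" "s \<in> Poly_Mapping.keys (w i)"
            then have "s \<in> supp" using w by (auto simp: supp_def)
            then have "\<sigma> k (- s) (\<sigma> k (- g) j) = \<sigma> k (- (g + s)) j" using Good_D[OF good _ g] by (simp add: minus_add)
            then show "(\<lambda>(s, i). ?z (g + s, i)) (s, i) =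
                (\<lambda>(s, i). abs_circle (v (i, \<sigma> k (- s) (\<sigma> k (- g) j)))) (s, i)" by simp
          qed
          also have "\<dots> = abs_circle (rel (\<sigma> k) w (\<sigma> k (- g) j) v)" by (simp add: abs_circle_rel)
          also have "rel (\<sigma> k) w (\<sigma> k (- g) j) v = 0"
            using v w j sofic_in[of k "- g" j] unfolding solutions_def by blast
          finally show "eval_free (\<lambda>(s, i). ?z (g + s, i)) w = 0" by simp
        qed
        then show ?thesis by (simp add: approx_def)
      qed
      define \<phi> where "\<phi> v = (\<lambda>j\<in>{1..d k}. if Good j then SOME \<xi>. approx v j \<xi> else (\<lambda>_. 0))" for v
      have \<phi>_good: "approx v j (\<phi> v j)" if "v \<in> sols k" "j \<in> {1..d k}" "Good j" for v j
        using someI_ex[OF ex_approx[OF that]] that by (simp add: \<phi>_def)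
      have \<phi>_bad: "\<phi> v j = (\<lambda>_. 0)" if "j \<in> {1..d k}" "\<not> Good j" for v j
        using that by (simp add: \<phi>_def)
      have \<phi>_dual: "\<phi> v j \<in> dual" if "v \<in> sols k" "j \<in> {1..d k}" for v j
        using \<phi>_good[OF that] \<phi>_bad[OF that(2)] zero_character unfolding approx_def by metis
      have mostly_good: "mostly \<gamma>1 (d k) Good" using elim unfolding Good_def[abs_def] .
      have in_Map: "\<phi> v \<in> Map \<rho> F \<delta> k" if v: "v \<in> sols k" for v
      proof (rule \<tau>0(3))
        show "almost_equivariant dual act \<rho> F \<tau>0 \<beta>0 (d k) (\<sigma> k) (\<phi> v)"
          unfolding almost_equivariant_def
        proof (intro conjI ballI)
          show "\<phi> v \<in> {1..d k} \<rightarrow>\<^sub>E dual"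
            using \<phi>_dual[OF v] by (intro PiE_I) (auto simp: \<phi>_def)
          fix g assume g: "g \<in> F"
          from mostly_conj[OF mostly_good mostly_permute[OF sofic_permutes[of k g] mostly_good]]
          show "mostly \<beta>0 (d k) (\<lambda>j. \<rho> (\<phi> v (\<sigma> k g j)) (act g (\<phi> v j)) < \<tau>0)"
          proof (rule mostly_mono)
            fix j assume j: "j \<in> {1..d k}" and good: "Good j \<and> Good (\<sigma> k g j)"
            have gj: "\<sigma> k g j \<in> {1..d k}" using j sofic_in by blast
            have "\<rho> (\<phi> v (\<sigma> k g j)) (act g (\<phi> v j)) < min \<eta> \<tau>0"
            proof (rule E(3)[OF \<phi>_dual[OF v gj] act_in[OF \<phi>_dual[OF v j]]], intro ballI allI impI)
              fix s i assume s: "s \<in> E" and i: "i < n"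
              let ?c = "abs_circle (v (i, \<sigma> k (- s) (\<sigma> k g j)))"
              have "s \<in> E'" "- g + s \<in> E'" using s g by (force simp: E'_def)+
              have 1: "circle_norm (\<phi> v (\<sigma> k g j) (gen s i) - ?c) < \<tau>1"
                using \<phi>_good[OF v gj] good \<open>s \<in> E'\<close> i unfolding approx_def by blast
              have "circle_norm (\<phi> v j (gen (- g + s) i) - abs_circle (v (i, \<sigma> k (- (- g + s)) j))) < \<tau>1"
                using \<phi>_good[OF v j] good \<open>- g + s \<in> E'\<close> i unfolding approx_def by blast
              moreover have "\<sigma> k (- (- g + s)) j = \<sigma> k (- s) (\<sigma> k g j)"
                using Good_F[of j s g] good s g by (simp add: minus_add)
              ultimately have 2: "circle_norm (act g (\<phi> v j) (gen s i) - ?c) < \<tau>1" by (simp add: act_gen)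
              have "circle_norm (\<phi> v (\<sigma> k g j) (gen s i) - act g (\<phi> v j) (gen s i)) < \<tau>1 + \<tau>1"
                using circle_norm_triangle[of "\<phi> v (\<sigma> k g j) (gen s i)" "act g (\<phi> v j) (gen s i)" ?c]
                  1 2 circle_norm_commute[of ?c "act g (\<phi> v j) (gen s i)"] by linarith
              then show "circle_norm (\<phi> v (\<sigma> k g j) (gen s i) - act g (\<phi> v j) (gen s i)) < \<tau>"
                using \<tau>1(2) E(2) by linarith
            qed
            then show "\<rho> (\<phi> v (\<sigma> k g j)) (act g (\<phi> v j)) < \<tau>0" by simp
          qed (use \<gamma>1(3) in auto)
        qed
      qed
      have at_x: "circle_norm (\<phi> v j (x i) - abs_circle (v (i, j))) < 1 / 8"
        if v: "v \<in> sols k" and j: "j \<in> {1..d k}" and good: "Good j" and i: "i < n" for v j i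
      proof -
        have "0 \<in> E'" by (simp add: E'_def)
        then have "circle_norm (\<phi> v j (gen 0 i) - abs_circle (v (i, \<sigma> k (- 0) j))) < \<tau>1"
          using \<phi>_good[OF v j good] i unfolding approx_def by blast
        then show ?thesis using \<tau>1(3) by (simp add: gen_0 Good_0[OF good])
      qed
      have close: "\<rho> (\<phi> v j) (\<phi> v' j) < \<eta>"
        if v: "v \<in> sols k" and v': "v' \<in> sols k"
          and near: "\<forall>q. \<bar>v q - v' q\<bar> < \<tau> / 3" and j: "j \<in> {1..d k}" for v v' j
      proof (cases "Good j")
        case True
        have "\<rho> (\<phi> v j) (\<phi> v' j) < min \<eta> \<tau>0"
        proof (rule E(3)[OF \<phi>_dual[OF v j] \<phi>_dual[OF v' j]], intro ballI allI impI)
          fix s i assume s: "s \<in> E" and i: "i < n"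
          have "s \<in> E'" using s by (simp add: E'_def)
          let ?c = "abs_circle (v (i, \<sigma> k (- s) j))" and ?c' = "abs_circle (v' (i, \<sigma> k (- s) j))"
          have 1: "circle_norm (\<phi> v j (gen s i) - ?c) < \<tau>1"
            using \<phi>_good[OF v j True] \<open>s \<in> E'\<close> i unfolding approx_def by blast
          have 2: "circle_norm (\<phi> v' j (gen s i) - ?c') < \<tau>1"
            using \<phi>_good[OF v' j True] \<open>s \<in> E'\<close> i unfolding approx_def by blast
          have "circle_norm (?c - ?c') \<le> \<bar>v (i, \<sigma> k (- s) j) - v' (i, \<sigma> k (- s) j)\<bar>"
            unfolding abs_circle_diff[symmetric] by (rule circle_norm_abs_circle_le_abs)
          then have 3: "circle_norm (?c - ?c') < \<tau> / 3" using near by (meson le_less_trans)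
          show "circle_norm (\<phi> v j (gen s i) - \<phi> v' j (gen s i)) < \<tau>"
            using circle_norm_triangle[of "\<phi> v j (gen s i)" "\<phi> v' j (gen s i)" ?c]
              circle_norm_triangle[of ?c "\<phi> v' j (gen s i)" ?c'] circle_norm_commute[of ?c' "\<phi> v' j (gen s i)"]
              1 2 3 \<tau>1(2) by linarith
        qed
        then show ?thesis by simp
      next
        case False
        then show ?thesis using j \<phi>_bad pseudo_refl[OF \<rho> zero_character] \<open>\<eta> > 0\<close> by simp
      qed
      show ?case
        using mostly_mono[OF mostly_good _ \<gamma>1(2), of Good] in_Map at_x close
        unfolding correction_def by (intro exI[of _ Good] exI[of _ \<phi>]) blast
    qed
  qed
qed

end

context sofic_dual
begin

text \<open>
  The solutions \<open>v y\<close> with coordinates \<open>y l / (2 p)\<close> on the good part \<open>I'\<close> of the information set form a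
  cube.  On the face \<open>y l = 0\<close> the function \<open>h y l\<close> is at most \<open>0\<close>, and on the face \<open>y l = p\<close>, where the
  solution has the value \<open>1 / 2\<close>, it is at least \<open>c\<close>.  Hence every point of the grid with \<open>M\<close> values
  \<open>3 \<epsilon>, 6 \<epsilon>, \<dots>\<close> in each coordinate is approximated up to \<open>\<epsilon>\<close> by some \<open>h y\<close>, and different grid points
  lead to \<open>\<epsilon>\<close>-separated maps.
\<close>

lemma many_separated_maps:
  assumes \<rho>: "pseudo \<rho>" and "finite F" "\<delta> > 0" "\<gamma> > 0" "\<epsilon> > 0"
    and c: "\<And>\<xi> \<xi>'. \<xi> \<in> dual \<Longrightarrow> \<xi>' \<in> dual \<Longrightarrow> \<rho> \<xi> \<xi>' < c \<Longrightarrow> gen_dist \<xi> \<xi>' < 1 / 4"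
    and M: "1 \<le> M" "3 * \<epsilon> * real M \<le> c"
  shows "\<forall>\<^sub>F k in sequentially.
    ereal ((real (card (inf_set k)) - \<gamma> * real (d k)) * ln (real M)) \<le>
      enat_log (separation_number \<epsilon> (Map \<rho> F \<delta> k) (rho_inf \<rho> (d k)))"
proof -
  obtain \<gamma>1 where \<gamma>1: "\<gamma>1 > 0" "real n * \<gamma>1 \<le> \<gamma>"
    using exists_small_multiple[of "real n" \<gamma>] \<open>\<gamma> > 0\<close> by auto
  obtain \<tau> where \<tau>: "\<tau> > 0"
    "\<forall>\<^sub>F k in sequentially. \<exists>Good \<phi>. correction \<rho> F \<delta> \<gamma>1 \<tau> \<epsilon> k Good \<phi>"
    by (rule solution_to_Map[OF \<rho> assms(2,3) \<gamma>1(1) \<open>\<epsilon> > 0\<close>]) (erule that)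
  from \<tau>(2) show ?thesis
  proof eventually_elim
    case (elim k)
    then obtain Good \<phi> where corr: "correction \<rho> F \<delta> \<gamma>1 \<tau> \<epsilon> k Good \<phi>" by blast
    then have good: "mostly \<gamma>1 (d k) Good" by (simp add: correction_def)
    let ?V = "sols k" and ?I = "inf_set k"
    have \<phi>_Map: "\<phi> v \<in> Map \<rho> F \<delta> k" if "v \<in> ?V" for v using corr that unfolding correction_def by blast
    have \<phi>_x: "circle_norm (\<phi> v j (x i) - abs_circle (v (i, j))) < 1 / 8"
      if "v \<in> ?V" "j \<in> {1..d k}" "i < n" "Good j" for v i j using corr that unfolding correction_def by blast
    have \<phi>_close: "\<rho> (\<phi> v j) (\<phi> v' j) < \<epsilon>"
      if "v \<in> ?V" "v' \<in> ?V" "\<And>q. \<bar>v q - v' q\<bar> < \<tau>" "j \<in> {1..d k}" for v v' j using corr that unfolding correction_def by blast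
    have \<phi>_dual: "\<phi> v j \<in> dual" if "v \<in> ?V" "j \<in> {1..d k}" for v j
      by (rule Map_D[OF \<phi>_Map[OF that(1)] that(2)])
    define I' where "I' = {q \<in> ?I. Good (snd q)}"
    have I': "finite I'" "I' \<subseteq> ?I" using finite_info[of "d k" "\<sigma> k"] by (auto simp: I'_def)
    have card_I': "real (card ?I) - \<gamma> * real (d k) \<le> real (card I')"
    proof -
      let ?bad = "{j \<in> {1..d k}. \<not> Good j}"
      have "?I \<subseteq> I' \<union> {..<n} \<times> ?bad" using info_subset[of "d k" "\<sigma> k"] by (auto simp: I'_def)
      then have "card ?I \<le> card (I' \<union> {..<n} \<times> ?bad)" using I'(1) by (intro card_mono) auto
      also have "\<dots> \<le> card I' + card ({..<n} \<times> ?bad)" by (rule card_Un_le)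
      also have "\<dots> = card I' + n * card ?bad" by (simp add: card_cartesian_product)
      finally have "real (card ?I) \<le> real (card I' + n * card ?bad)" by (rule of_nat_mono)
      also have "\<dots> = real (card I') + real n * real (card ?bad)" by simp
      also have "\<dots> \<le> real (card I') + real n * (\<gamma>1 * real (d k))"
        using good unfolding mostly_def by (intro add_left_mono mult_left_mono) auto
      also have "\<dots> \<le> real (card I') + \<gamma> * real (d k)"
        using mult_right_mono[OF \<gamma>1(2), of "real (d k)"] by simp
      finally show ?thesis by simp
    qed
    define m where "m = card I'"
    obtain e where e: "bij_betw e {0..<m} I'" using ex_bij_betw_nat_finite[OF I'(1)] unfolding m_def by blast
    have e_I': "e l \<in> I'" if "l < m" for l using bij_betwE[OF e] that by simp
    have e_props: "fst (e l) < n" "snd (e l) \<in> {1..d k}" "Good (snd (e l))" if "l < m" for l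
      using e_I'[OF that] info_subset[of "d k" "\<sigma> k"] by (auto simp: I'_def)
    have e_inj: "e l = e l' \<longleftrightarrow> l = l'" if "l < m" "l' < m" for l l'
      using inj_onD[OF bij_betw_imp_inj_on[OF e], of l l'] that by auto
    have "\<forall>q\<in>?I. \<exists>u. u \<in> ?V \<and> u q = 1 \<and> (\<forall>k\<in>?I - {q}. u k = 0)"
      using info_basis by blast
    then obtain b where b: "\<And>q. q \<in> ?I \<Longrightarrow> b q \<in> ?V" "\<And>q. q \<in> ?I \<Longrightarrow> b q q = 1"
      "\<And>q q'. q \<in> ?I \<Longrightarrow> q' \<in> ?I - {q} \<Longrightarrow> b q q' = 0"
      unfolding bchoice_iff by blast
    have b_e: "b (e l) (e l') = (if l = l' then 1 else 0)" if "l < m" "l' < m" for l l'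
    proof -
      have "e l \<in> ?I" "e l' \<in> ?I" using e_I'[OF that(1)] e_I'[OF that(2)] I'(2) by auto
      then show ?thesis using b(2)[of "e l"] b(3)[of "e l" "e l'"] e_inj[OF that] by auto
    qed
    define \<Lambda> where "\<Lambda> = (\<Sum>l<m. \<Sum>q\<in>{..<n} \<times> {1..d k}. \<bar>b (e l) q\<bar>)"
    have \<Lambda>: "(\<Sum>l<m. \<bar>b (e l) q\<bar>) \<le> \<Lambda>" for q
      unfolding \<Lambda>_def
    proof (rule sum_mono)
      fix l assume "l \<in> {..<m}"
      then have bl: "b (e l) \<in> ?V" using e_I'[of l] I'(2) by (intro b(1)) auto
      show "\<bar>b (e l) q\<bar> \<le> (\<Sum>q\<in>{..<n} \<times> {1..d k}. \<bar>b (e l) q\<bar>)"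
      proof (cases "q \<in> {..<n} \<times> {1..d k}")
        case True
        then show ?thesis by (intro member_le_sum) auto
      next
        case False
        then have "b (e l) q = 0" using bl unfolding solutions_def by blast
        then show ?thesis by (simp add: sum_nonneg)
      qed
    qed
    obtain p0 :: nat where p0: "\<Lambda> / \<tau> < real p0" using reals_Archimedean2 by blast
    define p where "p = Suc p0"
    have p: "0 < p" "\<Lambda> / (2 * real p) < \<tau>"
    proof -
      show "0 < p" by (simp add: p_def)
      have "\<Lambda> < \<tau> * real p" using p0 \<tau>(1) by (simp add: p_def field_simps)
      also have "\<dots> \<le> \<tau> * (2 * real p)" using \<tau>(1) by (intro mult_left_mono) auto
      finally show "\<Lambda> / (2 * real p) < \<tau>" using \<open>0 < p\<close> by (simp add: field_simps)
    qed
    define v where "v y q = (\<Sum>l<m. real (y l) / (2 * real p) * b (e l) q)" for y q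
    have v_V: "v y \<in> ?V" for y
    proof -
      have "b (e l) \<in> ?V" if "l \<in> {..<m}" for l using e_I'[of l] I'(2) that by (intro b(1)) auto
      then show ?thesis
        unfolding v_def[abs_def] by (intro solutions_combination) auto
    qed
    have v_e: "v y (e l) = real (y l) / (2 * real p)" if l: "l < m" for y l
    proof -
      have "v y (e l) = (\<Sum>l'<m. if l' = l then real (y l') / (2 * real p) else 0)"
        unfolding v_def using b_e l by (intro sum.cong refl) auto
      then show ?thesis using l by simp
    qed
    have v_close: "\<bar>v y q - v y' q\<bar> < \<tau>"
      if step: "\<And>l. l < m \<Longrightarrow> y l \<le> y' l \<and> y' l \<le> y l + 1" for y y' q
    proof -
      have "\<bar>v y q - v y' q\<bar> = \<bar>\<Sum>l<m. (real (y l) - real (y' l)) / (2 * real p) * b (e l) q\<bar>"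
        unfolding v_def by (simp add: sum_subtractf[symmetric] diff_divide_distrib left_diff_distrib)
      also have "\<dots> \<le> (\<Sum>l<m. \<bar>(real (y l) - real (y' l)) / (2 * real p) * b (e l) q\<bar>)" by (rule sum_abs)
      also have "\<dots> \<le> (\<Sum>l<m. 1 / (2 * real p) * \<bar>b (e l) q\<bar>)"
      proof (rule sum_mono)
        fix l assume "l \<in> {..<m}"
        then have "real (y l) \<le> real (y' l)" "real (y' l) \<le> real (y l) + 1" using step[of l] by auto
        then have "\<bar>real (y l) - real (y' l)\<bar> \<le> 1" by linarith
        then have "\<bar>real (y l) - real (y' l)\<bar> / (2 * real p) \<le> 1 / (2 * real p)"
          by (rule divide_right_mono) simp
        then show "\<bar>(real (y l) - real (y' l)) / (2 * real p) * b (e l) q\<bar> \<le> 1 / (2 * real p) * \<bar>b (e l) q\<bar>"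
          unfolding abs_mult abs_divide by (intro mult_right_mono) auto
      qed
      also have "\<dots> = (\<Sum>l<m. \<bar>b (e l) q\<bar>) / (2 * real p)" by (simp add: sum_divide_distrib)
      also have "\<dots> \<le> \<Lambda> / (2 * real p)" using \<Lambda>[of q] by (rule divide_right_mono) simp
      finally show ?thesis using p(2) by linarith
    qed
    define h where "h y l = zero_dist \<rho> (fst (e l)) (\<phi> (v y) (snd (e l)))" for y l
    have near_target: "\<exists>y. \<forall>l<m. \<bar>h y l - 3 * \<epsilon> * real (t l)\<bar> < \<epsilon>"
      if t: "t \<in> {..<m} \<rightarrow>\<^sub>E {1..M}" for t
    proof (rule kuhn_crossing[OF p(1), where f = h and k = m and t = "\<lambda>l. 3 * \<epsilon> * real (t l)" and \<epsilon> = \<epsilon>])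
      have t_bounds: "1 \<le> t l" "t l \<le> M" if "l < m" for l using PiE_mem[OF t, of l] that by auto
      have at_e: "circle_norm (\<phi> (v y) (snd (e l)) (x (fst (e l))) - abs_circle (real (y l) / (2 * real p))) < 1 / 8"
        if "l < m" for y l
        using \<phi>_x[OF v_V e_props(2,1,3)[OF that], of y] v_e[OF that, of y] by simp
      fix l assume l: "l < m"
      have dual_l: "\<phi> (v y) (snd (e l)) \<in> dual" for y by (rule \<phi>_dual[OF v_V e_props(2)[OF l]])
      {
        fix y :: "nat \<Rightarrow> nat" assume "y l = 0"
        then have "circle_norm (\<phi> (v y) (snd (e l)) (x (fst (e l)))) \<le> 1 / 8" using at_e[OF l, of y] by simp
        then have "h y l \<le> 0" unfolding h_def by (rule zero_dist_le_0[OF \<rho> dual_l])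
        also have "0 < 3 * \<epsilon> * real (t l)" using \<open>\<epsilon> > 0\<close> t_bounds(1)[OF l] by simp
        finally show "h y l < 3 * \<epsilon> * real (t l)" .
      next
        fix y :: "nat \<Rightarrow> nat" assume "y l = p"
        then have "real (y l) / (2 * real p) = 1 / 2" using p(1) by simp
        then have "circle_norm (\<phi> (v y) (snd (e l)) (x (fst (e l))) - abs_circle (1 / 2)) < 1 / 8"
          using at_e[OF l, of y] by simp
        moreover have "circle_norm (abs_circle (1 / 2)) \<le>
            circle_norm (abs_circle (1 / 2) - \<phi> (v y) (snd (e l)) (x (fst (e l)))) +
            circle_norm (\<phi> (v y) (snd (e l)) (x (fst (e l))))"
          using circle_norm_add[of "abs_circle (1 / 2) - \<phi> (v y) (snd (e l)) (x (fst (e l)))"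
              "\<phi> (v y) (snd (e l)) (x (fst (e l)))"] by simp
        ultimately have "3 / 8 \<le> circle_norm (\<phi> (v y) (snd (e l)) (x (fst (e l))))"
          by (simp add: circle_norm_half circle_norm_commute)
        then have "c \<le> h y l"
          unfolding h_def by (rule zero_dist_ge[OF \<rho> dual_l e_props(1)[OF l]]) (rule c)
        moreover have "3 * \<epsilon> * real (t l) \<le> 3 * \<epsilon> * real M"
          using \<open>\<epsilon> > 0\<close> t_bounds(2)[OF l] by (intro mult_left_mono) auto
        ultimately show "3 * \<epsilon> * real (t l) \<le> h y l" using M(2) by linarith
      next
        fix y y' :: "nat \<Rightarrow> nat" assume step: "\<And>l. l < m \<Longrightarrow> y l \<le> p \<and> y' l \<le> p \<and> y l \<le> y' l \<and> y' l \<le> y l + 1"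
        have "\<bar>h y l - h y' l\<bar> \<le> \<rho> (\<phi> (v y) (snd (e l))) (\<phi> (v y') (snd (e l)))"
          unfolding h_def by (rule zero_dist_lipschitz[OF \<rho> dual_l dual_l])
        also have "\<dots> < \<epsilon>"
          using step by (intro \<phi>_close v_V v_close e_props(2)[OF l]) auto
        finally show "\<bar>h y l - h y' l\<bar> < \<epsilon>" .
      }
    next
      fix y assume "\<And>l. l < m \<Longrightarrow> \<bar>h y l - 3 * \<epsilon> * real (t l)\<bar> < \<epsilon>"
      then show "\<exists>y. \<forall>l<m. \<bar>h y l - 3 * \<epsilon> * real (t l)\<bar> < \<epsilon>" by blast
    qed
    let ?T = "{..<m} \<rightarrow>\<^sub>E {1..M}"
    have "\<forall>t\<in>?T. \<exists>y. \<forall>l<m. \<bar>h y l - 3 * \<epsilon> * real (t l)\<bar> < \<epsilon>" using near_target by blast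
    then obtain Y where Y: "\<And>t l. t \<in> ?T \<Longrightarrow> l < m \<Longrightarrow> \<bar>h (Y t) l - 3 * \<epsilon> * real (t l)\<bar> < \<epsilon>"
      unfolding bchoice_iff by blast
    have far: "\<epsilon> < rho_inf \<rho> (d k) (\<phi> (v (Y t))) (\<phi> (v (Y t')))"
      if t: "t \<in> ?T" and t': "t' \<in> ?T" and "t \<noteq> t'" for t t'
    proof -
      obtain l where l: "l < m" "t l \<noteq> t' l"
        using PiE_ext[OF t t'] \<open>t \<noteq> t'\<close> by auto
      have "1 \<le> \<bar>real (t l) - real (t' l)\<bar>" using l(2) by linarith
      then have "3 * \<epsilon> * 1 \<le> 3 * \<epsilon> * \<bar>real (t l) - real (t' l)\<bar>"
        using \<open>\<epsilon> > 0\<close> by (intro mult_left_mono) auto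
      also have "\<dots> = \<bar>3 * \<epsilon> * real (t l) - 3 * \<epsilon> * real (t' l)\<bar>"
        using \<open>\<epsilon> > 0\<close> by (simp flip: right_diff_distrib add: abs_mult)
      finally have "\<epsilon> < \<bar>h (Y t) l - h (Y t') l\<bar>" using Y[OF t l(1)] Y[OF t' l(1)] by linarith
      also have "\<dots> \<le> \<rho> (\<phi> (v (Y t)) (snd (e l))) (\<phi> (v (Y t')) (snd (e l)))"
        unfolding h_def by (intro zero_dist_lipschitz[OF \<rho>] \<phi>_dual v_V e_props(2)[OF l(1)])
      also have "\<dots> \<le> rho_inf \<rho> (d k) (\<phi> (v (Y t))) (\<phi> (v (Y t')))"
        unfolding rho_inf_def using e_props(2)[OF l(1)] by (intro Max_ge) auto
      finally show ?thesis .
    qed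
    let ?\<Phi> = "\<lambda>t. \<phi> (v (Y t))"
    have zero: "rho_inf \<rho> (d k) f f \<le> \<epsilon>" if "f \<in> Map \<rho> F \<delta> k" "d k > 0" for f
      unfolding rho_inf_def using that pseudo_refl[OF \<rho> Map_D[OF that(1)]] \<open>\<epsilon> > 0\<close> by (subst Max_le_iff) auto
    have inj: "inj_on ?\<Phi> ?T"
    proof (rule inj_onI, rule ccontr)
      fix t t' assume t: "t \<in> ?T" "t' \<in> ?T" "?\<Phi> t = ?\<Phi> t'" "t \<noteq> t'"
      then obtain l where "l < m" using PiE_ext[OF t(1,2)] by auto
      then have "d k > 0" using e_props(2)[of l] by simp
      then show False using far[OF t(1,2,4)] zero[OF \<phi>_Map[OF v_V]] t(3) by (simp add: not_less[symmetric])
    qed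
    have fin_T: "finite ?T" by (intro finite_PiE) auto
    have "ereal (ln (real (M ^ m))) \<le> enat_log (separation_number \<epsilon> (Map \<rho> F \<delta> k) (rho_inf \<rho> (d k)))"
    proof (rule enat_log_separation_ge[of "?\<Phi> ` ?T"])
      show "?\<Phi> ` ?T \<subseteq> Map \<rho> F \<delta> k" using \<phi>_Map[OF v_V] by auto
      show "separated \<epsilon> (rho_inf \<rho> (d k)) (?\<Phi> ` ?T)"
        unfolding separated_def using fin_T far by auto
      show "1 \<le> M ^ m" using M(1) by simp
      have "card (?\<Phi> ` ?T) = card ?T" by (rule card_image[OF inj])
      also have "\<dots> = M ^ m" by (simp add: card_PiE)
      finally show "M ^ m \<le> card (?\<Phi> ` ?T)" by simp
    qed
    moreover have "(real (card ?I) - \<gamma> * real (d k)) * ln (real M) \<le> real m * ln (real M)"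
      using card_I' M(1) unfolding m_def by (intro mult_right_mono) auto
    ultimately show ?case using M(1) by (simp add: ln_realpow) (meson ereal_less_eq(3) order_trans)
  qed
qed

text \<open>
  The grid has about \<open>c / (3 \<epsilon>)\<close> values per coordinate, which is at least \<open>1 / sqrt \<epsilon>\<close> for small \<open>\<epsilon>\<close>;
  the square root costs the factor \<open>1 / 2\<close>.  For \<open>a = 0\<close> a grid with one value per coordinate shows
  that the metric mean dimension is nonnegative.  The bound has to be uniform in \<open>\<rho>\<close>, as the metric
  mean dimension is an infimum over all compatible metrics.
\<close>

lemma mdim_ge:
  assumes \<rho>: "compatible_metric (top_of_set dual) \<rho>" and "0 \<le> a"
    and large: "\<exists>\<^sub>F k in sequentially. 2 * a * real (d k) \<le> real (card (inf_set k))"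
  shows "ereal (a / 2) \<le> metric_mean_dimension_wrt d \<sigma> (top_of_set dual) act \<rho>"
proof -
  note pseudo = compatible_imp_pseudo(1)[OF \<rho>]
  obtain c where c: "c > 0" "\<And>\<xi> \<xi>'. \<xi> \<in> dual \<Longrightarrow> \<xi>' \<in> dual \<Longrightarrow> \<rho> \<xi> \<xi>' < c \<Longrightarrow> gen_dist \<xi> \<xi>' < 1 / 4"
    by (rule compatible_metric_controls_generators[OF \<rho>, of "1 / 4"]) (simp, erule that)
  \<comment> \<open>This makes \<open>c / (3 \<epsilon>)\<close> larger than \<open>2 / sqrt \<epsilon>\<close> for \<open>\<epsilon> < \<epsilon>0\<close>.\<close>
  define \<epsilon>0 where "\<epsilon>0 = min 1 ((c / 6)\<^sup>2)"
  have "\<epsilon>0 > 0" using c(1) by (simp add: \<epsilon>0_def)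
  show ?thesis
    unfolding metric_mean_dimension_wrt_def
  proof (rule Liminf_bounded)
    show "\<forall>\<^sub>F \<epsilon> in at_right 0. ereal (a / 2) \<le> ereal (1 / \<bar>ln \<epsilon>\<bar>) *
      separation_rate \<rho> \<epsilon>"
      using eventually_at_right_real[OF \<open>\<epsilon>0 > 0\<close>]
    proof eventually_elim
      case (elim \<epsilon>)
      then have \<epsilon>: "0 < \<epsilon>" "\<epsilon> < 1" "\<epsilon> < (c / 6)\<^sup>2" by (auto simp: \<epsilon>0_def)
      have ln_neg: "ln \<epsilon> < 0" using \<epsilon>(1,2) by simp
      define C where "C = a / 2 * \<bar>ln \<epsilon>\<bar>"
      have "6 * sqrt \<epsilon> < c"
        using \<epsilon>(3) c(1) real_less_lsqrt[of "c / 6" \<epsilon>] \<epsilon>(1) by simp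
      obtain M :: nat and \<gamma> :: real where M: "1 \<le> M" "3 * \<epsilon> * real M \<le> c" "\<gamma> > 0"
        "\<exists>\<^sub>F k in sequentially. C * real (d k) \<le>
          (real (card (inf_set k)) - \<gamma> * real (d k)) * ln (real M)"
      proof (cases "a = 0")
        case True
        have "sqrt \<epsilon> * sqrt \<epsilon> \<le> sqrt \<epsilon> * 1" using \<epsilon> by (intro mult_left_mono) auto
        then have "3 * \<epsilon> * real 1 \<le> c" using \<open>6 * sqrt \<epsilon> < c\<close> \<epsilon>(1) by simp
        then show ?thesis using True by (intro that[of 1 1]) (auto simp: C_def)
      next
        case False
        then have "a > 0" using \<open>0 \<le> a\<close> by simp
        define M where "M = nat \<lfloor>c / (3 * \<epsilon>)\<rfloor>"
        have "c / (3 * \<epsilon>) \<ge> 0" using c(1) \<epsilon>(1) by simp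
        then have M_le: "real M \<le> c / (3 * \<epsilon>)" and M_ge: "c / (3 * \<epsilon>) < real M + 1"
          unfolding M_def by (simp_all add: of_nat_floor)
        have "2 / sqrt \<epsilon> < c / (3 * \<epsilon>)"
        proof -
          have "2 / sqrt \<epsilon> = 6 * sqrt \<epsilon> / (3 * \<epsilon>)" using \<epsilon>(1) by (simp add: field_simps)
          also have "\<dots> < c / (3 * \<epsilon>)" using \<open>6 * sqrt \<epsilon> < c\<close> \<epsilon>(1) by (intro divide_strict_right_mono) auto
          finally show ?thesis .
        qed
        moreover have "1 < 1 / sqrt \<epsilon>" using \<epsilon>(1,2) by simp
        moreover have "2 / sqrt \<epsilon> = 1 / sqrt \<epsilon> + 1 / sqrt \<epsilon>" by simp
        ultimately have M_big: "1 / sqrt \<epsilon> < real M" "1 < real M" using M_ge by linarith+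
        have "\<bar>ln \<epsilon>\<bar> / 2 = ln (1 / sqrt \<epsilon>)" using \<epsilon>(1) ln_neg by (simp add: ln_div ln_sqrt)
        also have "\<dots> \<le> ln (real M)" using M_big \<epsilon>(1) by (subst ln_le_cancel_iff) auto
        finally have ln_M: "\<bar>ln \<epsilon>\<bar> / 2 \<le> ln (real M)" .
        show ?thesis
        proof (rule that[of M a])
          show "1 \<le> M" using M_big(2) by simp
          show "3 * \<epsilon> * real M \<le> c" using M_le \<epsilon>(1) by (simp add: field_simps)
          show "\<exists>\<^sub>F k in sequentially. C * real (d k) \<le>
              (real (card (inf_set k)) - a * real (d k)) * ln (real M)"
            using large
          proof (rule frequently_mono[rotated], intro allI impI)
            fix k assume "2 * a * real (d k) \<le> real (card (inf_set k))"
            then have "a * real (d k) \<le> real (card (inf_set k)) - a * real (d k)" by simp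
            then have "(a * real (d k)) * (\<bar>ln \<epsilon>\<bar> / 2) \<le>
                (real (card (inf_set k)) - a * real (d k)) * ln (real M)"
              using ln_M \<open>a > 0\<close> by (intro mult_mono) auto
            then show "C * real (d k) \<le> (real (card (inf_set k)) - a * real (d k)) * ln (real M)"
              by (simp add: C_def mult_ac)
          qed
        qed (use \<open>a > 0\<close> in auto)
      qed
      have "ereal C \<le> separation_rate \<rho> \<epsilon>"
      proof (rule INF_greatest)
        fix F\<delta> :: "'g set \<times> real" assume "F\<delta> \<in> {F. finite F} \<times> {0<..}"
        then obtain F \<delta> where F: "F\<delta> = (F, \<delta>)" "finite F" "\<delta> > 0" by auto
        let ?N = "\<lambda>k. enat_log (separation_number \<epsilon> (Map \<rho> F \<delta> k) (rho_inf \<rho> (d k)))"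
        have many: "\<forall>\<^sub>F k in sequentially.
            ereal ((real (card (inf_set k)) - \<gamma> * real (d k)) * ln (real M)) \<le> ?N k"
          by (rule many_separated_maps[OF pseudo F(2,3) M(3) \<epsilon>(1) _ M(1,2)]) (rule c(2))
        have "ereal C \<le> limsup (\<lambda>k. ereal (1 / real (d k)) * ?N k)"
        proof (rule ccontr)
          assume "\<not> ereal C \<le> limsup (\<lambda>k. ereal (1 / real (d k)) * ?N k)"
          then have "\<forall>\<^sub>F k in sequentially. ereal (1 / real (d k)) * ?N k < ereal C"
            by (intro Limsup_lessD) simp
          with many sofic_d_pos have "\<forall>\<^sub>F k in sequentially. \<not> C * real (d k) \<le>
              (real (card (inf_set k)) - \<gamma> * real (d k)) * ln (real M)"
          proof eventually_elim
            case (elim k)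
            show ?case
            proof
              assume "C * real (d k) \<le> (real (card (inf_set k)) - \<gamma> * real (d k)) * ln (real M)"
              then have "ereal (C * real (d k)) \<le> ?N k" using elim(1) by (meson ereal_less_eq(3) order_trans)
              then have "ereal (1 / real (d k)) * ereal (C * real (d k)) \<le> ereal (1 / real (d k)) * ?N k"
                by (intro ereal_mult_left_mono) auto
              moreover have "ereal (1 / real (d k)) * ereal (C * real (d k)) = ereal C" using elim(2) by simp
              ultimately show False using elim(3) by simp
            qed
          qed
          with M(4) show False by (simp add: frequently_def)
        qed
        then show "ereal C \<le> (case F\<delta> of (F, \<delta>) \<Rightarrow> limsup (\<lambda>i. ereal (1 / real (d i)) *
            enat_log (separation_number \<epsilon> (Map \<rho> F \<delta> i) (rho_inf \<rho> (d i)))))"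
          by (simp add: F(1))
      qed
      then have "ereal (1 / \<bar>ln \<epsilon>\<bar>) * ereal C \<le> ereal (1 / \<bar>ln \<epsilon>\<bar>) *
          separation_rate \<rho> \<epsilon>"
        by (intro ereal_mult_left_mono) auto
      moreover have "ereal (1 / \<bar>ln \<epsilon>\<bar>) * ereal C = ereal (a / 2)" using ln_neg by (simp add: C_def)
      ultimately show ?case by (simp only:)
    qed
  qed
qed

section \<open>The equivalence\<close>

text \<open>The entropy is computed with some dynamically generating pseudometric; the implications used here
  hold for each of them.\<close>

lemma finite_entropy_iff_mdim_0:
  "sofic_entropy d \<sigma> (top_of_set dual) act < \<infinity> \<longleftrightarrow> metric_mean_dimension d \<sigma> (top_of_set dual) act = 0"
proof
  define \<rho>0 where "\<rho>0 = (SOME \<rho>. pseudo \<rho> \<and> generating \<rho>)"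
  obtain \<rho>1 where \<rho>1: "compatible_metric (top_of_set dual) \<rho>1" using exists_compatible_metric by blast
  have "\<exists>\<rho>. pseudo \<rho> \<and> generating \<rho>" using compatible_imp_pseudo[OF \<rho>1] by blast
  from someI_ex[OF this] have \<rho>0: "pseudo \<rho>0" "generating \<rho>0" unfolding \<rho>0_def by auto
  have entropy: "sofic_entropy d \<sigma> (top_of_set dual) act = sofic_entropy_wrt d \<sigma> (top_of_set dual) act \<rho>0"
    by (simp add: sofic_entropy_def \<rho>0_def)
  {
    assume "sofic_entropy d \<sigma> (top_of_set dual) act < \<infinity>"
    then have "metric_mean_dimension_wrt d \<sigma> (top_of_set dual) act \<rho>1 \<le> 0"
      unfolding entropy by (intro finite_entropy_imp_mdim_le_0[OF \<rho>0] compatible_imp_pseudo[OF \<rho>1])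
    then have "metric_mean_dimension d \<sigma> (top_of_set dual) act \<le> 0"
      unfolding metric_mean_dimension_def using \<rho>1 by (intro INF_lower2[of \<rho>1]) auto
    moreover have "0 \<le> metric_mean_dimension d \<sigma> (top_of_set dual) act"
      unfolding metric_mean_dimension_def
    proof (rule INF_greatest)
      fix \<rho> assume "\<rho> \<in> {\<rho>. compatible_metric (top_of_set dual) \<rho>}"
      then show "0 \<le> metric_mean_dimension_wrt d \<sigma> (top_of_set dual) act \<rho>"
        using mdim_ge[of \<rho> 0] by (simp add: zero_ereal_def)
    qed
    ultimately show "metric_mean_dimension d \<sigma> (top_of_set dual) act = 0" by (rule antisym)
  next
    assume mdim: "metric_mean_dimension d \<sigma> (top_of_set dual) act = 0"
    have "(\<lambda>k. real (card (inf_set k)) / real (d k)) \<longlonglongrightarrow> 0"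
    proof (rule ccontr)
      assume "\<not> (\<lambda>k. real (card (inf_set k)) / real (d k)) \<longlonglongrightarrow> 0"
      then obtain r where r: "r > 0"
        "\<not> (\<forall>\<^sub>F k in sequentially. dist (real (card (inf_set k)) / real (d k)) 0 < r)"
        unfolding tendsto_iff by blast
      have "\<exists>\<^sub>F k in sequentially. 2 * (r / 2) * real (d k) \<le> real (card (inf_set k))"
        unfolding frequently_def
      proof
        assume "\<forall>\<^sub>F k in sequentially. \<not> 2 * (r / 2) * real (d k) \<le> real (card (inf_set k))"
        with sofic_d_pos
        have "\<forall>\<^sub>F k in sequentially. dist (real (card (inf_set k)) / real (d k)) 0 < r"
          by eventually_elim (simp add: divide_less_eq)
        with r(2) show False by contradiction
      qed
      then have "ereal (r / 2 / 2) \<le> metric_mean_dimension_wrt d \<sigma> (top_of_set dual) act \<rho>"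
        if "compatible_metric (top_of_set dual) \<rho>" for \<rho>
        using that r(1) by (intro mdim_ge) auto
      then have "ereal (r / 2 / 2) \<le> metric_mean_dimension d \<sigma> (top_of_set dual) act"
        unfolding metric_mean_dimension_def by (intro INF_greatest) auto
      then show False using mdim r(1) by (simp add: zero_ereal_def)
    qed
    then have "sofic_entropy_wrt d \<sigma> (top_of_set dual) act \<rho>0 \<le> ereal entropy_bound"
      by (rule entropy_le_if_info_small[OF \<rho>0])
    then show "sofic_entropy d \<sigma> (top_of_set dual) act < \<infinity>" unfolding entropy by auto
  }
qed

end

theorem theorem1p5:
  fixes d :: "nat \<Rightarrow> nat"
    and \<sigma> :: "nat \<Rightarrow> 'g::{group_add, countable} \<Rightarrow> nat \<Rightarrow> nat"
    and smul :: "'g group_ring \<Rightarrow> 'a::ab_group_add \<Rightarrow> 'a"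
  assumes "sofic_approximation d \<sigma>"
    and "left_module smul"
    and "finitely_presented smul"
  shows "sofic_entropy d \<sigma> pontryagin_dual (dual_action smul) < \<infinity> \<longleftrightarrow>
    metric_mean_dimension d \<sigma> pontryagin_dual (dual_action smul) = 0"
proof -
  obtain n x S where "free_hom smul n x ` free_module n = UNIV" "finite S"
    "{v \<in> free_module n. free_hom smul n x v = 0} = generated_submodule S"
    using assms(3) unfolding finitely_presented_def by blast
  then interpret sofic_dual smul n x S d \<sigma>
    using assms(1,2) by (simp add: sofic_dual_def finitely_presented_dual_def
        finitely_presented_dual_axioms_def sofic_def)
  show ?thesis using finite_entropy_iff_mdim_0 by (simp add: pontryagin_dual_eq)
qed

end
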